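(* With $p(q)$, $\Delta(q)$, $q_{53}=0.6510501858\ldots$, $\delta_{FT}(q)$ and the perturbed Packing 53 $P_q$ as defined in the context, let $q_{max}=0.6585340820\ldots$ be defined by $\Delta(q_{max})=\pi/\sqrt{12}$ (the solution in the interval $(q_{53},0.67)$). Then for all $q$ with $q_{53}<q\le q_{max}$, $$\Delta(q)\ge\delta_{FT}(q).$$ Therefore, in this range the perturbed Packing 53 $P_q$, which is a doubly periodic disk packing with ratio of smallest to largest radius equal to $q$ and with density $\Delta(q)$, improves on the hexagonal lattice packing, in the sense that its density is at least $\pi/\sqrt{12}$, the density of the hexagonal lattice packing.
   Context: A disk packing in the plane is a collection of closed circular disks with pairwise disjoint interiors; for a doubly periodic packing, the density is the covered area of a fundamental region of the translation lattice divided by the area of the region. The function $p(q)$: for $0<q<1$, $p=p(q)$ denotes the root with $q<p<1$ of $$2p^4+(4q+3)p^3+(2q^2-2q+1)p^2-(5q^2+6q)p+q^2=0.$$ The function $\Delta$: with $p=p(q)$, $$\Delta(q)=\frac{\pi(1+p^2+q^2)(p+q)^4(1+p)^2(1+q)^2}{32pq(1+p+q)\big(8p^2q^2-(p^2-6pq+q^2)(1+p+q-pq)\big)\sqrt{pq(1+p+q)}}.$$ The number $q_{53}=0.6510501858\ldots$ is the root near this value of $89x^8+1344x^7+4008x^6-464x^5-2410x^4+176x^3+296x^2-96x+1$; it is the ratio of smallest to largest radius in the triangulated three-size packing "Packing 53" (Fernique, Hashemi and Sizova). The function $\delta_{FT}$ (density of Fejes Tóth's best packing): let $q_1=0.6375559772\ldots$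 be the root near this value of $x^4-10x^2-8x+9$. For $q_1\le q\le q_2$, $$\delta_{FT}(q)=\frac{\pi(q^2+1)(q+1)^4\sqrt{1+2q}}{4q(2q^2+5q+\sqrt{2q^3+5q^2+2q}+2)(q+\sqrt{2q^3+5q^2+2q})},$$ where $q_2=0.6457072159\ldots$ is the number near this value at which this expression equals $\pi/\sqrt{12}$; for $q_2<q\le1$, $\delta_{FT}(q)=\pi/\sqrt{12}$ (the hexagonal lattice packing). The perturbed Packing 53, $P_q$: it consists of disks of radii $1$ (large), $p=p(q)$ (medium) and $q$ (small), with four disks of each size per fundamental region, and symmetry group of type pgg. Explicitly, identify the plane with $\mathbb{C}$. Let $\beta$ and $\gamma$ be the angles at the centers of the disks of radius $p$ and $q$, respectively, in the triangle with side lengths $1+p$, $1+q$, $p+q$ formed by the centers of mutually tangent disks of radii $1,p,q$. Put $$x=\frac{8pq(1+p+q)}{(p+q)^2(1+q)}-(1+q),\qquad y=\sqrt{(1+q)^2-x^2},\qquad D=x+1+q.$$ Let $G$ be the group of isometries generated by the half-turn $z\mapsto -z$ and the glide reflection $z\mapsto e^{i(\pi-2\beta)}\,\overline{z}+iy+De^{i(\pi-2\beta)}$. Then $P_q$ consists of the disks of radius $1$ centered at the points of the $G$-orbit of $iy$, the disks of radius $q$ centered at the points of the $G$-orbit of $x$, and the disks of radius $p$ centered at the points of the $G$-orbit of $x+(p+q)e^{i\gamma}$. (Thus around the origin there are two large disks at $\pm iy$ and two small disks at $\pm x$ whose centers form a rhombus with side $1+q$; further large disks are centered at $\pm D$. The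 polynomial equation for $p$ expresses that pairs of medium disks symmetric under a half-turn in $G$ are tangent.) *)

theory Defs
  imports "HOL-Analysis.Analysis" "HOL-Algebra.Bij" "HOL-Algebra.Generated_Groups"
begin

definition disk_packing :: "complex set set \<Rightarrow> bool" where
  "disk_packing P \<longleftrightarrow>
     (\<forall>A\<in>P. \<exists>c r. 0 < r \<and> A = cball c r) \<and>
     pairwise (\<lambda>A B. interior A \<inter> interior B = {}) P"

definition disk_radii :: "complex set set \<Rightarrow> real set" where
  "disk_radii P = {r. 0 < r \<and> (\<exists>c. cball c r \<in> P)}"

definition has_radius_ratio :: "complex set set \<Rightarrow> real \<Rightarrow> bool" where
  "has_radius_ratio P \<rho> \<longleftrightarrow>
     (\<exists>r\<in>disk_radii P. \<exists>R\<in>disk_radii P. (\<forall>s\<in>disk_radii P. r \<le> s \<and> s \<le> R) \<and> \<rho> = r / R)"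

definition periods :: "complex set set \<Rightarrow> complex set" where
  "periods P = {t. (\<lambda>A. (+) t ` A) ` P = P}"

definition period_basis :: "complex set set \<Rightarrow> complex \<Rightarrow> complex \<Rightarrow> bool" where
  "period_basis P u v \<longleftrightarrow> u \<in> periods P \<and> v \<in> periods P \<and> u \<noteq> v \<and> independent {u, v}"

definition doubly_periodic :: "complex set set \<Rightarrow> bool" where
  "doubly_periodic P \<longleftrightarrow> (\<exists>u v. period_basis P u v)"

definition fundamental_parallelogram :: "complex \<Rightarrow> complex \<Rightarrow> complex set" where
  "fundamental_parallelogram u v =
     {s *\<^sub>R u + t *\<^sub>R v | s t. 0 \<le> s \<and> s < 1 \<and> 0 \<le> t \<and> t < 1}"

text \<open>
  The density does not depend on the lattice of periods nor on its basis. We demand the value for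
  every lattice \<open>\<int>u + \<int>v\<close> of periods, so in particular for every basis of the lattice of all
  translational symmetries of the packing.
\<close>

definition has_density :: "complex set set \<Rightarrow> real \<Rightarrow> bool" where
  "has_density P d \<longleftrightarrow> doubly_periodic P \<and>
     (\<forall>u v. period_basis P u v \<longrightarrow>
        measure lebesgue (\<Union>P \<inter> fundamental_parallelogram u v)
          / measure lebesgue (fundamental_parallelogram u v) = d)"

definition hexagonal_packing :: "complex set set" where
  "hexagonal_packing =
     {cball (2 * (of_int m + of_int n * cis (pi / 3))) 1 | m n :: int. True}"

definition med_radius :: "real \<Rightarrow> real" where
  "med_radius q = (THE p. q < p \<and> p < 1 \<and>
     2 * p^4 + (4 * q + 3) * p^3 + (2 * q^2 - 2 * q + 1) * p^2 - (5 * q^2 + 6 * q) * p + q^2 = 0)"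

definition \<Delta> :: "real \<Rightarrow> real" where
  "\<Delta> q = (let p = med_radius q in
     (pi * (1 + p^2 + q^2) * (p + q)^4 * (1 + p)^2 * (1 + q)^2) /
     (32 * p * q * (1 + p + q)
        * (8 * p^2 * q^2 - (p^2 - 6 * p * q + q^2) * (1 + p + q - p * q))
        * sqrt (p * q * (1 + p + q))))"

text \<open>
  A number given as the solution near a truncated decimal expansion is taken to be the solution
  having exactly the displayed digits.
\<close>

definition q53 :: real where
  "q53 = (THE x. 0.6510501858 \<le> x \<and> x < 0.6510501859 \<and>
     89 * x^8 + 1344 * x^7 + 4008 * x^6 - 464 * x^5 - 2410 * x^4 + 176 * x^3 + 296 * x^2
       - 96 * x + 1 = 0)"

definition FT_density_expr :: "real \<Rightarrow> real" where
  "FT_density_expr q =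
     (pi * (q^2 + 1) * (q + 1)^4 * sqrt (1 + 2 * q)) /
     (4 * q * (2 * q^2 + 5 * q + sqrt (2 * q^3 + 5 * q^2 + 2 * q) + 2)
        * (q + sqrt (2 * q^3 + 5 * q^2 + 2 * q)))"

definition q_FT1 :: real where
  "q_FT1 = (THE x. 0.6375559772 \<le> x \<and> x < 0.6375559773 \<and> x^4 - 10 * x^2 - 8 * x + 9 = 0)"

definition q_FT2 :: real where
  "q_FT2 = (THE x. 0.6457072159 \<le> x \<and> x < 0.6457072160 \<and> FT_density_expr x = pi / sqrt 12)"

definition \<delta>_FT :: "real \<Rightarrow> real" where
  "\<delta>_FT q =
     (if q_FT1 \<le> q \<and> q \<le> q_FT2 then FT_density_expr q
      else if q_FT2 < q \<and> q \<le> 1 then pi / sqrt 12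
      else undefined)"

definition q_max :: real where
  "q_max = (THE x. q53 < x \<and> x < 0.67 \<and> \<Delta> x = pi / sqrt 12)"

text \<open>The angle between the sides of lengths \<open>a\<close> and \<open>b\<close>, opposite the side of length \<open>c\<close>.\<close>

definition triangle_angle :: "real \<Rightarrow> real \<Rightarrow> real \<Rightarrow> real" where
  "triangle_angle a b c = arccos ((a^2 + b^2 - c^2) / (2 * a * b))"

definition \<beta>_angle :: "real \<Rightarrow> real" where
  "\<beta>_angle q = (let p = med_radius q in triangle_angle (1 + p) (p + q) (1 + q))"

definition \<gamma>_angle :: "real \<Rightarrow> real" where
  "\<gamma>_angle q = (let p = med_radius q in triangle_angle (1 + q) (p + q) (1 + p))"

definition x53 :: "real \<Rightarrow> real" where
  "x53 q = (let p = med_radius q in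
     8 * p * q * (1 + p + q) / ((p + q)^2 * (1 + q)) - (1 + q))"

definition y53 :: "real \<Rightarrow> real" where
  "y53 q = sqrt ((1 + q)^2 - (x53 q)^2)"

definition D53 :: "real \<Rightarrow> real" where
  "D53 q = x53 q + 1 + q"

definition half_turn :: "complex \<Rightarrow> complex" where
  "half_turn z = - z"

definition glide53 :: "real \<Rightarrow> complex \<Rightarrow> complex" where
  "glide53 q z = cis (pi - 2 * \<beta>_angle q) * cnj z + \<i> * of_real (y53 q)
     + of_real (D53 q) * cis (pi - 2 * \<beta>_angle q)"

definition G53 :: "real \<Rightarrow> (complex \<Rightarrow> complex) set" where
  "G53 q = generate (BijGroup UNIV) {half_turn, glide53 q}"

definition orbit53 :: "real \<Rightarrow> complex \<Rightarrow> complex set" where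
  "orbit53 q z = (\<lambda>g. g z) ` G53 q"

definition perturbed_packing53 :: "real \<Rightarrow> complex set set" where
  "perturbed_packing53 q = (let p = med_radius q in
     (\<lambda>z. cball z 1) ` orbit53 q (\<i> * of_real (y53 q)) \<union>
     (\<lambda>z. cball z q) ` orbit53 q (of_real (x53 q)) \<union>
     (\<lambda>z. cball z p) ` orbit53 q (of_real (x53 q) + of_real (p + q) * cis (\<gamma>_angle q)))"

end

theory Submission
  imports Defs
begin

text \<open>
  The equation for the medium radius defines a rational curve. Put
  \<open>s = 1 / (2 cos \<beta>)\<close> with \<open>\<beta>\<close> the angle at the medium disk. Then \<open>p = 2 s^2 - 1\<close> and
  \<open>q = p s (2 s - 1) / (2 + s - 2 s^2)\<close>, and \<open>q\<close> increases from 0 to 1 while \<open>s\<close> runs from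
  \<open>1 / sqrt 2\<close> to 1 (\<open>q_of_strict_mono\<close>, \<open>med_radius_q_of\<close>). In this parameter every quantity of the
  construction is rational in \<open>s\<close> and \<open>w = sqrt (4 s^2 - 1)\<close>; for instance
  \<open>sqrt (p q (1 + p + q)) = p s w / (2 + s - 2 s^2)\<close>.

  Numerical part. The logarithm of \<open>\<Delta>\<close> is a sum of logarithms of polynomials in \<open>s\<close>, and bounds on
  the logarithmic derivatives of these polynomials show that \<open>\<Delta>\<close> is strictly decreasing on the relevant
  range (\<open>log_density_strict_antimono\<close>). Hence the level \<open>\<pi> / sqrt 12\<close> is attained exactly once, the
  digits of \<open>q_max\<close> follow from the evaluation at two rational parameters, and \<open>\<Delta>\<close> is at least
  \<open>\<pi> / sqrt 12\<close> up to \<open>q_max\<close>. Between \<open>q_FT2 < q53\<close> and 1 the function \<open>\<delta>_FT\<close> is the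
  constant \<open>\<pi> / sqrt 12\<close>, so nothing more is needed for the comparison.

  Geometric part. After a rotation by \<open>\<beta>\<close> the two generators become \<open>(X, Y) \<mapsto> (- X, - Y)\<close> and
  \<open>(X, Y) \<mapsto> (- X - A, Y + B)\<close>; this is the plane group pgg with the rectangular lattice spanned by
  \<open>(2 A, 0)\<close> and \<open>(0, 2 B)\<close> (\<open>glide53_frame\<close>, \<open>orbit53_eq\<close>). Thus \<open>P\<^sub>q\<close> is a lattice packing with
  twelve disks per cell of area \<open>4 A B\<close>, and \<open>\<Delta> = \<pi> (1 + p^2 + q^2) / (A B)\<close>. Two disks are
  compared by taking the difference of their centers modulo symmetry. If this difference lies in
  \<open>[-A, A] \<times> [-B, B]\<close>, no lattice translate of it is shorter (\<open>lattice_distance_ge\<close>), so that a single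
  inequality remains for each pair of sizes and each pair of signs. Nine of these are contacts,
  which are polynomial identities in \<open>s\<close> (\<open>center_identities\<close>). A tenth says that the two large disks at
  \<open>\<plusminus> i y\<close> do not overlap; this is \<open>y \<ge> 1\<close>, and the equation \<open>y = 1\<close> is the one that determines \<open>q53\<close>
  (\<open>height_ge_one\<close>, \<open>q53_polynomial_factor\<close>). All the others hold with much room.

  Density. For a set that is periodic with respect to two lattices, integrating its indicator at
  \<open>x + y\<close>, with \<open>x\<close> in a cell of one lattice and \<open>y\<close> in a cell of the other, in both orders shows that
  both lattices give the same mean (\<open>cell_mean_independent\<close>). Hence one convenient basis of periods
  determines the density for all of them (\<open>has_density_lattice_packing\<close>). This also settles the
  hexagonal packing.
\<close>

section \<open>Periods and cells of a lattice\<close>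

text \<open>
  Two complex numbers are linearly independent over the reals iff the determinant of the pair,
  written \<open>Im (cnj u * v)\<close>, does not vanish. This determinant replaces independence below.
\<close>

lemma period_basis_iff:
  "u \<noteq> v \<and> independent {u, v} \<longleftrightarrow> Im (cnj u * v) \<noteq> 0"
proof
  assume L: "u \<noteq> v \<and> independent {u, v}"
  show "Im (cnj u * v) \<noteq> 0"
  proof
    assume 0: "Im (cnj u * v) = 0"
    have u0: "u \<noteq> 0" using L dependent_zero[of "{u, v}"] by auto
    have "v = (Re (cnj u * v) / (cmod u)\<^sup>2) *\<^sub>R u"
    proof -
      have e: "Re u * Im v = Im u * Re v" using 0 by (simp add: algebra_simps)
      have nz: "(Re u)\<^sup>2 + (Im u)\<^sup>2 \<noteq> 0" using u0 by (simp add: complex_eq_iff)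
      have "Re v * ((Re u)\<^sup>2 + (Im u)\<^sup>2) = (Re u * Re v + Im u * Im v) * Re u"
        "Im v * ((Re u)\<^sup>2 + (Im u)\<^sup>2) = (Re u * Re v + Im u * Im v) * Im u"
        using e by algebra+
      then show ?thesis using nz by (simp add: complex_eq_iff cmod_power2 eq_divide_eq)
    qed
    then have "v \<in> span {u}" by (metis span_base span_scale singletonI)
    moreover have "v \<notin> span ({u, v} - {v})" using L unfolding dependent_def by blast
    moreover have "{u, v} - {v} = {u}" using L by auto
    ultimately show False by simp
  qed
next
  assume d: "Im (cnj u * v) \<noteq> 0"
  have uv: "u \<noteq> v" using d by (auto simp: algebra_simps)
  have "independent {u, v}"
  proof (rule independent_insertI)
    show "u \<notin> span {v}"
    proof
      assume "u \<in> span {v}"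
      then obtain k where "u = k *\<^sub>R v" by (auto simp: span_singleton)
      then show False using d by (simp add: algebra_simps)
    qed
    have "v \<noteq> 0" using d by auto
    then show "independent {v}" by simp
  qed
  then show "u \<noteq> v \<and> independent {u, v}" using uv by blast
qed

text \<open>
  The point \<open>m u + n v\<close> of the lattice \<open>\<int>u + \<int>v\<close>, indexed by the pair \<open>(m, n)\<close>.
\<close>

definition lattice_point :: "complex \<Rightarrow> complex \<Rightarrow> int \<times> int \<Rightarrow> complex" where
  "lattice_point u v mn = of_int (fst mn) * u + of_int (snd mn) * v"

text \<open>
  The coordinates of a point with respect to the real basis \<open>u, v\<close>, by Cramer's rule.
\<close>

definition coord1 :: "complex \<Rightarrow> complex \<Rightarrow> complex \<Rightarrow> real" where
  "coord1 u v z = Im (cnj z * v) / Im (cnj u * v)"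

definition coord2 :: "complex \<Rightarrow> complex \<Rightarrow> complex \<Rightarrow> real" where
  "coord2 u v z = Im (cnj u * z) / Im (cnj u * v)"

lemma coords_eq:
  assumes "Im (cnj u * v) \<noteq> 0"
  shows "coord1 u v z *\<^sub>R u + coord2 u v z *\<^sub>R v = z"
  using assms
  by (simp add: complex_eq_iff coord1_def coord2_def divide_simps) (simp add: algebra_simps)

lemma coord1_comb:
  assumes "Im (cnj u * v) \<noteq> 0"
  shows "coord1 u v (s *\<^sub>R u + t *\<^sub>R v) = s"
  using assms by (simp add: coord1_def divide_simps) (simp add: algebra_simps)

lemma coord2_comb:
  assumes "Im (cnj u * v) \<noteq> 0"
  shows "coord2 u v (s *\<^sub>R u + t *\<^sub>R v) = t"
  using assms by (simp add: coord2_def divide_simps) (simp add: algebra_simps)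

lemma fundamental_parallelogram_iff:
  assumes "Im (cnj u * v) \<noteq> 0"
  shows "z \<in> fundamental_parallelogram u v \<longleftrightarrow>
    0 \<le> coord1 u v z \<and> coord1 u v z < 1 \<and> 0 \<le> coord2 u v z \<and> coord2 u v z < 1"
proof
  assume "z \<in> fundamental_parallelogram u v"
  then obtain s t where "z = s *\<^sub>R u + t *\<^sub>R v" "0 \<le> s" "s < 1" "0 \<le> t" "t < 1"
    unfolding fundamental_parallelogram_def by blast
  then show "0 \<le> coord1 u v z \<and> coord1 u v z < 1 \<and> 0 \<le> coord2 u v z \<and> coord2 u v z < 1"
    by (simp add: coord1_comb[OF assms] coord2_comb[OF assms])
next
  assume "0 \<le> coord1 u v z \<and> coord1 u v z < 1 \<and> 0 \<le> coord2 u v z \<and> coord2 u v z < 1"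
  then show "z \<in> fundamental_parallelogram u v"
    unfolding fundamental_parallelogram_def using coords_eq[OF assms, of z, symmetric] by blast
qed

lemma fundamental_parallelogram_borel:
  assumes "Im (cnj u * v) \<noteq> 0"
  shows "fundamental_parallelogram u v \<in> sets borel"
proof -
  have [measurable]: "coord1 u v \<in> borel_measurable borel" "coord2 u v \<in> borel_measurable borel"
    unfolding coord1_def coord2_def
    by (intro borel_measurable_continuous_onI continuous_intros)+ (use assms in auto)
  have "fundamental_parallelogram u v =
    {z \<in> space borel. 0 \<le> coord1 u v z \<and> coord1 u v z < 1 \<and> 0 \<le> coord2 u v z \<and> coord2 u v z < 1}"
    using fundamental_parallelogram_iff[OF assms] by auto
  also have "\<dots> \<in> sets borel" by measurable
  finally show ?thesis .
qed

text \<open>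
  The half-open parallelogram is a fundamental domain of the lattice.
\<close>

lemma lattice_translate_unique:
  assumes d: "Im (cnj u * v) \<noteq> 0"
  shows "\<exists>!mn. z - lattice_point u v mn \<in> fundamental_parallelogram u v"
proof -
  have c: "coord1 u v (z - lattice_point u v mn) = coord1 u v z - of_int (fst mn)"
    "coord2 u v (z - lattice_point u v mn) = coord2 u v z - of_int (snd mn)" for mn
    using d by (simp_all add: coord1_def coord2_def lattice_point_def divide_simps)
      (simp_all add: algebra_simps)
  have f: "0 \<le> x - of_int m \<and> x - of_int m < 1 \<longleftrightarrow> m = \<lfloor>x\<rfloor>" for x :: real and m
    by linarith
  have "z - lattice_point u v mn \<in> fundamental_parallelogram u v \<longleftrightarrow>
      mn = (\<lfloor>coord1 u v z\<rfloor>, \<lfloor>coord2 u v z\<rfloor>)" for mn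
    unfolding fundamental_parallelogram_iff[OF d] c prod_eq_iff fst_conv snd_conv
    using f[of "coord1 u v z" "fst mn"] f[of "coord2 u v z" "snd mn"] by blast
  then show ?thesis by simp
qed

lemma nn_integral_ind_translates:
  assumes d: "Im (cnj u * v) \<noteq> 0"
  shows "(\<integral>\<^sup>+ mn. indicator (fundamental_parallelogram u v) (z - lattice_point u v mn)
     \<partial>count_space UNIV) = (1::ennreal)"
proof -
  obtain a where a: "\<And>mn. z - lattice_point u v mn \<in> fundamental_parallelogram u v \<longleftrightarrow> mn = a"
    using lattice_translate_unique[OF d, of z] by blast
  have "indicator (fundamental_parallelogram u v) (z - lattice_point u v mn)
      = (indicator {a} mn :: ennreal)" for mn
    using a[of mn] by (auto simp: indicator_def)
  then show ?thesis by simp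
qed

lemma nn_integral_lborel_shift:
  fixes f :: "complex \<Rightarrow> ennreal"
  assumes [measurable]: "f \<in> borel_measurable borel"
  shows "(\<integral>\<^sup>+ x. f (c + x) \<partial>lborel) = (\<integral>\<^sup>+ x. f x \<partial>lborel)"
proof -
  have "(\<integral>\<^sup>+ x. f x \<partial>lborel) = (\<integral>\<^sup>+ x. f x \<partial>distr lborel borel ((+) c))"
    by (simp add: lborel_distr_plus)
  also have "\<dots> = (\<integral>\<^sup>+ x. f (c + x) \<partial>lborel)" by (subst nn_integral_distr) auto
  finally show ?thesis by simp
qed

text \<open>
  An integral over the plane is the integral over one cell of the sum over all lattice translates.
\<close>

lemma nn_integral_unfold:
  fixes f :: "complex \<Rightarrow> ennreal"
  assumes d: "Im (cnj u * v) \<noteq> 0" and f [measurable]: "f \<in> borel_measurable borel"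
  shows "(\<integral>\<^sup>+ x. f x \<partial>lborel) = (\<integral>\<^sup>+ x. indicator (fundamental_parallelogram u v) x *
     (\<integral>\<^sup>+ mn. f (lattice_point u v mn + x) \<partial>count_space UNIV) \<partial>lborel)"
proof -
  let ?F = "fundamental_parallelogram u v" and ?l = "lattice_point u v"
  have [measurable]: "?F \<in> sets borel" by (rule fundamental_parallelogram_borel[OF d])
  have "(\<integral>\<^sup>+ x. f x \<partial>lborel)
      = (\<integral>\<^sup>+ x. (\<integral>\<^sup>+ mn. f x * indicator ?F (x - ?l mn) \<partial>count_space UNIV) \<partial>lborel)"
    by (simp add: nn_integral_cmult nn_integral_ind_translates[OF d])
  also have "\<dots> = (\<integral>\<^sup>+ mn. (\<integral>\<^sup>+ x. f x * indicator ?F (x - ?l mn) \<partial>lborel) \<partial>count_space UNIV)"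
    by (rule nn_integral_count_space_nn_integral) auto
  also have "\<dots> = (\<integral>\<^sup>+ mn. (\<integral>\<^sup>+ x. f (?l mn + x) * indicator ?F x \<partial>lborel) \<partial>count_space UNIV)"
  proof (rule nn_integral_cong)
    fix mn
    show "(\<integral>\<^sup>+ x. f x * indicator ?F (x - ?l mn) \<partial>lborel)
       = (\<integral>\<^sup>+ x. f (?l mn + x) * indicator ?F x \<partial>lborel)"
      using nn_integral_lborel_shift[of "\<lambda>x. f x * indicator ?F (x - ?l mn)" "?l mn"] by simp
  qed
  also have "\<dots> = (\<integral>\<^sup>+ x. (\<integral>\<^sup>+ mn. f (?l mn + x) * indicator ?F x \<partial>count_space UNIV) \<partial>lborel)"
    by (rule nn_integral_count_space_nn_integral[symmetric]) auto
  also have "\<dots> = (\<integral>\<^sup>+ x. indicator ?F x * (\<integral>\<^sup>+ mn. f (?l mn + x) \<partial>count_space UNIV) \<partial>lborel)"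
    by (simp add: nn_integral_cmult mult.commute)
  finally show ?thesis .
qed

text \<open>
  A periodic function has the same integral over all translates of the cell.
\<close>

lemma cell_integral_shift:
  fixes f :: "complex \<Rightarrow> ennreal"
  assumes d: "Im (cnj u * v) \<noteq> 0" and f [measurable]: "f \<in> borel_measurable borel"
    and per: "\<And>mn x. f (lattice_point u v mn + x) = f x"
  shows "(\<integral>\<^sup>+ x. indicator (fundamental_parallelogram u v) x * f (x + y) \<partial>lborel)
       = (\<integral>\<^sup>+ x. indicator (fundamental_parallelogram u v) x * f x \<partial>lborel)"
proof -
  let ?F = "fundamental_parallelogram u v" and ?l = "lattice_point u v"
  have [measurable]: "?F \<in> sets borel" by (rule fundamental_parallelogram_borel[OF d])
  have "(\<integral>\<^sup>+ x. indicator ?F x * f (x + y) \<partial>lborel) = (\<integral>\<^sup>+ x. indicator ?F (x - y) * f x \<partial>lborel)"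
    using nn_integral_lborel_shift[of "\<lambda>x. indicator ?F (x - y) * f x" y]
    by (simp add: add.commute)
  also have "\<dots> = (\<integral>\<^sup>+ x. indicator ?F x *
      (\<integral>\<^sup>+ mn. indicator ?F (?l mn + x - y) * f (?l mn + x) \<partial>count_space UNIV) \<partial>lborel)"
    by (rule nn_integral_unfold[OF d]) measurable
  also have "\<dots> = (\<integral>\<^sup>+ x. indicator ?F x * f x \<partial>lborel)"
  proof (rule nn_integral_cong)
    fix x
    have "(\<integral>\<^sup>+ mn. indicator ?F (?l mn + x - y) \<partial>count_space UNIV) = (1::ennreal)"
    proof -
      have b: "bij_betw (\<lambda>mn::int \<times> int. - mn) UNIV UNIV"
        by (rule bij_betw_byWitness[where f' = uminus]) auto
      have m: "?l (- mn) + x - y = x - y - ?l mn" for mn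
        by (simp add: lattice_point_def algebra_simps)
      show ?thesis
        using nn_integral_bij_count_space[OF b, of "\<lambda>mn. indicator ?F (?l mn + x - y)"]
          nn_integral_ind_translates[OF d, of "x - y"] by (simp add: m)
    qed
    then show "indicator ?F x * (\<integral>\<^sup>+ mn. indicator ?F (?l mn + x - y) * f (?l mn + x) \<partial>count_space UNIV)
       = indicator ?F x * f x"
      by (simp add: per nn_integral_multc)
  qed
  finally show ?thesis .
qed

text \<open>
  Both sides are the integral of \<open>f (x + y)\<close> over \<open>x\<close> in one cell and \<open>y\<close> in the other. By
  periodicity the inner integral does not depend on the outer variable, whichever of the two is
  integrated first. No relation between the two lattices is needed.
\<close>

lemma cell_mean_independent:
  fixes f :: "complex \<Rightarrow> ennreal"
  assumes d: "Im (cnj u * v) \<noteq> 0" and d': "Im (cnj u' * v') \<noteq> 0"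
    and f [measurable]: "f \<in> borel_measurable borel"
    and per: "\<And>mn x. f (lattice_point u v mn + x) = f x"
    and per': "\<And>mn x. f (lattice_point u' v' mn + x) = f x"
  shows "emeasure lborel (fundamental_parallelogram u' v') *
     (\<integral>\<^sup>+ x. indicator (fundamental_parallelogram u v) x * f x \<partial>lborel) =
     emeasure lborel (fundamental_parallelogram u v) *
     (\<integral>\<^sup>+ x. indicator (fundamental_parallelogram u' v') x * f x \<partial>lborel)"
proof -
  let ?F = "fundamental_parallelogram u v" and ?F' = "fundamental_parallelogram u' v'"
  have [measurable]: "?F \<in> sets borel" "?F' \<in> sets borel"
    by (rule fundamental_parallelogram_borel[OF d] fundamental_parallelogram_borel[OF d'])+
  have "(\<integral>\<^sup>+ y. indicator ?F' y * (\<integral>\<^sup>+ x. indicator ?F x * f (x + y) \<partial>lborel) \<partial>lborel)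
      = (\<integral>\<^sup>+ y. (\<integral>\<^sup>+ x. indicator ?F' y * indicator ?F x * f (x + y) \<partial>lborel) \<partial>lborel)"
    by (simp add: nn_integral_cmult mult.assoc)
  also have "\<dots> = (\<integral>\<^sup>+ x. (\<integral>\<^sup>+ y. indicator ?F' y * indicator ?F x * f (x + y) \<partial>lborel) \<partial>lborel)"
    by (rule lborel_pair.Fubini') measurable
  also have "\<dots> = (\<integral>\<^sup>+ x. indicator ?F x * (\<integral>\<^sup>+ y. indicator ?F' y * f (y + x) \<partial>lborel) \<partial>lborel)"
  proof (rule nn_integral_cong)
    fix x
    show "(\<integral>\<^sup>+ y. indicator ?F' y * indicator ?F x * f (x + y) \<partial>lborel) =
       indicator ?F x * (\<integral>\<^sup>+ y. indicator ?F' y * f (y + x) \<partial>lborel)"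
      by (subst nn_integral_cmult[symmetric]) (simp_all add: ac_simps)
  qed
  finally show ?thesis
    by (simp add: cell_integral_shift[OF d f per] cell_integral_shift[OF d' f per']
        nn_integral_multc)
qed

lemma measure_lborel_box_cbox: "measure lborel (box a b)
    = measure lborel (cbox a (b::'a::euclidean_space))"
  by (simp add: measure_def emeasure_lborel_box_eq emeasure_lborel_cbox_eq)

text \<open>
  The identification of \<open>\<real>\<^sup>2\<close> with the complex plane. It preserves Lebesgue measure and makes the
  formula for the measure of a linear image, which is stated for Cartesian powers, available here.
\<close>

definition vec_to_complex :: "real^2 \<Rightarrow> complex" where
  "vec_to_complex x = Complex (x $ 1) (x $ 2)"

lemma vec_to_complex_measurable [measurable]: "vec_to_complex \<in> borel_measurable borel"
  unfolding vec_to_complex_def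
  by (intro borel_measurable_continuous_onI) (simp add: Complex_eq continuous_intros)

lemma distr_vec_to_complex: "distr lborel borel vec_to_complex = lborel"
proof (rule lborel_eqI[symmetric])
  fix l u :: complex
  assume le: "\<And>b. b \<in> Basis \<Longrightarrow> l \<bullet> b \<le> u \<bullet> b"
  have le': "Re l \<le> Re u" "Im l \<le> Im u" using le[of 1] le[of \<i>] by (auto simp: Basis_complex_def)
  let ?l = "vector [Re l, Im l] :: real^2" and ?u = "vector [Re u, Im u] :: real^2"
  have in_box: "z \<in> box l u \<longleftrightarrow> Re l < Re z \<and> Re z < Re u \<and> Im l < Im z \<and> Im z < Im u" for z
    by (auto simp: box_def Basis_complex_def)
  have pre: "vec_to_complex -` box l u = box ?l ?u"
    by (auto simp: vec_to_complex_def in_box mem_box_cart forall_2)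
  have "emeasure (distr lborel borel vec_to_complex) (box l u) = emeasure lborel (box ?l ?u)"
    by (simp add: emeasure_distr pre)
  also have "\<dots> = ennreal ((Re u - Re l) * (Im u - Im l))"
  proof -
    have ne: "cbox ?l ?u \<noteq> {}" using le' by (simp add: interval_ne_empty_cart forall_2)
    have "emeasure lborel (box ?l ?u) = ennreal (measure lborel (box ?l ?u))"
      by (rule emeasure_eq_ennreal_measure) (use emeasure_lborel_box_finite in \<open>simp add: less_top\<close>)
    then show ?thesis using content_cbox_cart[OF ne] by (simp add: measure_lborel_box_cbox UNIV_2)
  qed
  also have "\<dots> = ennreal (\<Prod>b\<in>Basis. (u - l) \<bullet> b)"
    by (simp add: Basis_complex_def)
  finally show "emeasure (distr lborel borel vec_to_complex) (box l u)
    = ennreal (\<Prod>b\<in>Basis. (u - l) \<bullet> b)" .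
qed simp

lemma emeasure_fundamental_parallelogram:
  assumes d: "Im (cnj u * v) \<noteq> 0"
  shows "emeasure lborel (fundamental_parallelogram u v) = ennreal \<bar>Im (cnj u * v)\<bar>"
proof -
  define f :: "real^2 \<Rightarrow> real^2" where
    "f = (\<lambda>x. vector [x$1 * Re u + x$2 * Re v, x$1 * Im u + x$2 * Im v])"
  define Q :: "(real^2) set" where "Q = {x. \<forall>i. 0 \<le> x$i \<and> x$i < 1}"
  have lin: "linear f"
    by (rule linearI) (simp_all add: f_def vec_eq_iff forall_2 algebra_simps)
  have det: "det (matrix f) = Im (cnj u * v)"
    by (simp add: det_2 matrix_def f_def axis_def)
  have Qb: "Q \<in> sets borel"
  proof -
    have "Q = {x \<in> space borel. 0 \<le> x$1 \<and> x$1 < 1 \<and> 0 \<le> x$2 \<and> x$2 < 1}"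
      by (auto simp: Q_def forall_2)
    also have "\<dots> \<in> sets borel" by measurable
    finally show ?thesis .
  qed
  have Qs: "box 0 1 \<subseteq> Q" "Q \<subseteq> cbox 0 1"
    by (auto simp: Q_def mem_box_cart less_imp_le)
  have ne: "cbox 0 (1::real^2) \<noteq> {}" by (simp add: interval_ne_empty_cart)
  have c1: "measure lebesgue (cbox 0 (1::real^2)) = 1" "measure lebesgue (box 0 (1::real^2)) = 1"
    using content_cbox_cart[OF ne] by (simp_all add: measure_lborel_box_cbox)
  have Qm: "Q \<in> lmeasurable"
    using bounded_set_imp_lmeasurable[OF bounded_subset[OF bounded_cbox Qs(2)]] Qb by simp
  have Q1: "measure lebesgue Q = 1"
  proof (rule antisym)
    show "measure lebesgue Q \<le> 1"
      using measure_mono_fmeasurable[OF Qs(2), of lebesgue] Qm c1 by (simp add: fmeasurableD)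
    show "1 \<le> measure lebesgue Q"
      using measure_mono_fmeasurable[OF Qs(1), of lebesgue] Qm c1 by simp
  qed
  have pre: "vec_to_complex -` fundamental_parallelogram u v = f ` Q"
  proof (intro Set.set_eqI iffI)
    fix x assume "x \<in> vec_to_complex -` fundamental_parallelogram u v"
    then obtain s t where st: "vec_to_complex x = s *\<^sub>R u + t *\<^sub>R v" "0 \<le> s" "s < 1" "0 \<le> t" "t < 1"
      unfolding fundamental_parallelogram_def by auto
    have "x = f (vector [s, t])" using st(1)
      by (simp add: vec_to_complex_def f_def vec_eq_iff forall_2 complex_eq_iff)
    moreover have "vector [s, t] \<in> Q" using st by (simp add: Q_def forall_2)
    ultimately show "x \<in> f ` Q" by blast
  next
    fix x assume "x \<in> f ` Q"
    then obtain y where y: "y \<in> Q" "x = f y" by blast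
    have "vec_to_complex x = y$1 *\<^sub>R u + y$2 *\<^sub>R v"
      by (simp add: y f_def vec_to_complex_def complex_eq_iff)
    then show "x \<in> vec_to_complex -` fundamental_parallelogram u v"
      using y(1) unfolding fundamental_parallelogram_def Q_def forall_2 by auto
  qed
  have fm: "f ` Q \<in> lmeasurable" by (rule measurable_linear_image[OF lin Qm])
  have fb: "f ` Q \<in> sets borel"
    using measurable_sets[OF vec_to_complex_measurable fundamental_parallelogram_borel[OF d]]
    by (simp add: pre)
  have "emeasure lborel (fundamental_parallelogram u v)
      = emeasure (distr lborel borel vec_to_complex) (fundamental_parallelogram u v)"
    by (simp add: distr_vec_to_complex)
  also have "\<dots> = emeasure lborel (f ` Q)"
    by (subst emeasure_distr) (simp_all add: fundamental_parallelogram_borel[OF d] pre)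
  also have "\<dots> = emeasure lebesgue (f ` Q)" using fb by simp
  also have "\<dots> = ennreal (measure lebesgue (f ` Q))"
    using fm by (simp add: emeasure_eq_measure2)
  also have "measure lebesgue (f ` Q) = \<bar>Im (cnj u * v)\<bar>"
    by (simp add: measure_linear_image[OF lin Qm] det Q1)
  finally show ?thesis .
qed

text \<open>
  The periods form a group, so the covered set is invariant under the lattice that two of them
  span.
\<close>

lemma periods_lattice_point:
  assumes "u \<in> periods P" "v \<in> periods P"
  shows "z \<in> \<Union>P \<longleftrightarrow> lattice_point u v mn + z \<in> \<Union>P"
proof -
  have one: "z \<in> \<Union>P \<longleftrightarrow> t + z \<in> \<Union>P" if "t \<in> periods P" for t z
  proof -
    have "(+) t ` \<Union>P = \<Union>P"
      using that unfolding periods_def by (metis (mono_tags, lifting) image_Union mem_Collect_eq)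
    then show ?thesis by (metis (no_types, lifting) add_left_cancel image_iff)
  qed
  have nat: "z \<in> \<Union>P \<longleftrightarrow> of_nat n * t + z \<in> \<Union>P" if "t \<in> periods P" for t z n
  proof (induction n)
    case (Suc n)
    then show ?case using one[OF that, of "of_nat n * t + z"] by (simp add: algebra_simps)
  qed simp
  have int: "z \<in> \<Union>P \<longleftrightarrow> of_int k * t + z \<in> \<Union>P" if "t \<in> periods P" for t z k
  proof (cases k)
    case (nonneg n)
    then show ?thesis using nat[OF that, of z n] by simp
  next
    case (neg n)
    have e: "of_nat (Suc n) * t + (of_int k * t + z) = z" unfolding neg
      by (simp add: algebra_simps)
    show ?thesis using nat[OF that, of "of_int k * t + z" "Suc n"] unfolding e by simp
  qed
  show ?thesis
    using int[OF assms(2), of z "snd mn"] int[OF assms(1), of "of_int (snd mn) * v + z" "fst mn"]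
    by (simp add: lattice_point_def add.assoc)
qed

section \<open>The density of a lattice packing of disks\<close>

text \<open>
  The disks with centers \<open>c k\<close> and radii \<open>r k\<close>, for \<open>k\<close> in \<open>K\<close>, together with all their translates
  by the lattice \<open>\<int>u + \<int>v\<close>.
\<close>

definition lattice_packing ::
  "'k set \<Rightarrow> ('k \<Rightarrow> complex) \<Rightarrow> ('k \<Rightarrow> real) \<Rightarrow> complex \<Rightarrow> complex \<Rightarrow> complex set set" where
  "lattice_packing K c r u v = (\<lambda>(k, mn). cball (c k + lattice_point u v mn) (r k)) ` (K \<times> UNIV)"

text \<open>
  All radii are positive, and any two disks with different indices have disjoint interiors.
  Different indices are thus required to give different disks, so that no disk is counted twice in
  an area.
\<close>

definition separated_disks ::
  "'k set \<Rightarrow> ('k \<Rightarrow> complex) \<Rightarrow> ('k \<Rightarrow> real) \<Rightarrow> complex \<Rightarrow> complex \<Rightarrow> bool" where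
  "separated_disks K c r u v \<longleftrightarrow> (\<forall>k\<in>K. 0 < r k) \<and>
     (\<forall>k\<in>K. \<forall>k'\<in>K. \<forall>mn mn'. (k, mn) \<noteq> (k', mn') \<longrightarrow>
        r k + r k' \<le> dist (c k + lattice_point u v mn) (c k' + lattice_point u v mn'))"

lemma lattice_point_add:
  "lattice_point u v (a + b) = lattice_point u v a + lattice_point u v b"
  by (simp add: lattice_point_def algebra_simps)

lemma lattice_point_uminus: "lattice_point u v (- a) = - lattice_point u v a"
  by (simp add: lattice_point_def)

lemma disk_packing_lattice_packing:
  assumes "separated_disks K c r u v"
  shows "disk_packing (lattice_packing K c r u v)"
  unfolding disk_packing_def
proof
  show "\<forall>A\<in>lattice_packing K c r u v. \<exists>c r. 0 < r \<and> A = cball c r"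
  proof
    fix A assume "A \<in> lattice_packing K c r u v"
    then obtain k mn where "k \<in> K" "A = cball (c k + lattice_point u v mn) (r k)"
      unfolding lattice_packing_def by auto
    then show "\<exists>c r. 0 < r \<and> A = cball c r" using assms unfolding separated_disks_def by blast
  qed
  show "pairwise (\<lambda>A B. interior A \<inter> interior B = {}) (lattice_packing K c r u v)"
  proof (rule pairwiseI)
    fix A B assume "A \<in> lattice_packing K c r u v" "B \<in> lattice_packing K c r u v" and ne: "A \<noteq> B"
    then obtain k mn k' mn' where
      k: "k \<in> K" "k' \<in> K" and A: "A = cball (c k + lattice_point u v mn) (r k)"
      and B: "B = cball (c k' + lattice_point u v mn') (r k')"
      unfolding lattice_packing_def by (elim imageE SigmaE) (simp only: prod.case)
    have "(k, mn) \<noteq> (k', mn')" using ne A B by auto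
    then have "r k + r k' \<le> dist (c k + lattice_point u v mn) (c k' + lattice_point u v mn')"
      using assms k unfolding separated_disks_def by blast
    then show "interior A \<inter> interior B = {}"
      unfolding A B interior_cball by (rule disjoint_ballI)
  qed
qed

lemma lattice_point_period: "lattice_point u v t \<in> periods (lattice_packing K c r u v)"
proof -
  let ?f = "\<lambda>(k, mn). cball (c k + lattice_point u v mn) (r k)"
  have "(\<lambda>A. (+) (lattice_point u v t) ` A) (?f (k, mn)) = ?f (k, mn + t)" for k mn
    by (simp only: prod.case cball_translation[symmetric] lattice_point_add ac_simps)
  then have "(\<lambda>A. (+) (lattice_point u v t) ` A) ` (?f ` (K \<times> UNIV))
      = ?f ` ((\<lambda>(k, mn). (k, mn + t)) ` (K \<times> UNIV))"
    unfolding image_image by (intro image_cong refl) (clarify, simp only: prod.case)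
  also have "(\<lambda>(k, mn). (k, mn + t)) ` (K \<times> (UNIV :: (int \<times> int) set)) = K \<times> UNIV"
  proof (intro Set.set_eqI iffI)
    fix x :: "'a \<times> int \<times> int" assume "x \<in> K \<times> UNIV"
    then show "x \<in> (\<lambda>(k, mn). (k, mn + t)) ` (K \<times> UNIV)"
      by (intro image_eqI[of _ _ "(fst x, snd x - t)"]) auto
  qed auto
  finally show ?thesis unfolding periods_def lattice_packing_def by simp
qed

lemma period_basis_lattice_packing:
  assumes "Im (cnj u * v) \<noteq> 0"
  shows "period_basis (lattice_packing K c r u v) u v"
  using lattice_point_period[of u v "(1,0)"] lattice_point_period[of u v "(0,1)"]
    period_basis_iff assms
  unfolding period_basis_def by (fastforce simp: lattice_point_def)

lemma lattice_packing_borel: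
  assumes "finite K"
  shows "\<Union>(lattice_packing K c r u v) \<in> sets borel"
proof -
  have "countable (lattice_packing K c r u v)"
    unfolding lattice_packing_def
    by (intro countable_image countable_SIGMA) (auto intro: countable_finite assms)
  moreover have "A \<in> sets borel" if "A \<in> lattice_packing K c r u v" for A
    using that by (auto simp: lattice_packing_def)
  ultimately show ?thesis by (intro sets.countable_Union) auto
qed

text \<open>
  Up to the boundary circles, which form a null set, the indicator of the covered set is the sum
  of the indicators of the open disks. Unfolding the sum over the lattice turns the integral over
  the cell into the total area of the disks \<open>k \<in> K\<close>.
\<close>

lemma cell_area_lattice_packing:
  assumes d: "Im (cnj u * v) \<noteq> 0" and fin: "finite K" and sep: "separated_disks K c r u v"
  shows "(\<integral>\<^sup>+ x. indicator (fundamental_parallelogram u v) x *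
      indicator (\<Union>(lattice_packing K c r u v)) x \<partial>lborel) = ennreal (pi * (\<Sum>k\<in>K. (r k)\<^sup>2))"
proof -
  let ?F = "fundamental_parallelogram u v" and ?l = "lattice_point u v"
  let ?S = "\<Union>(lattice_packing K c r u v)"
  define Z where "Z = (\<Union>(k, mn)\<in>K \<times> UNIV. sphere (c k + ?l mn) (r k))"
  have [measurable]: "?F \<in> sets borel" by (rule fundamental_parallelogram_borel[OF d])
  have pos: "k \<in> K \<Longrightarrow> 0 < r k" for k using sep unfolding separated_disks_def by blast
  have "Z \<in> null_sets lborel"
  proof -
    have "sphere a \<rho> \<in> null_sets lborel" for a :: complex and \<rho>
      using negligible_sphere[of a \<rho>] by (simp add: negligible_iff_null_sets null_sets_completion_iff)
    then show ?thesis unfolding Z_def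
      by (intro null_sets_UN' countable_SIGMA) (auto intro: countable_finite fin)
  qed
  then have "AE x in lborel. x \<notin> Z" by (rule AE_not_in)
  then have ae: "AE x in lborel. indicator ?F x * indicator ?S x =
      indicator ?F x * (\<Sum>k\<in>K. \<integral>\<^sup>+ mn. indicator (ball (c k) (r k)) (?l mn + x) \<partial>count_space UNIV)"
  proof eventually_elim
    fix x assume nz: "x \<notin> Z"
    have "(indicator ?S x :: ennreal) =
      (\<Sum>k\<in>K. \<integral>\<^sup>+ mn. indicator (ball (c k) (r k)) (?l mn + x) \<partial>count_space UNIV)"
    proof (cases "x \<in> ?S")
      case True
      then obtain k0 m0 where k0: "k0 \<in> K" "x \<in> cball (c k0 + ?l m0) (r k0)"
        unfolding lattice_packing_def by auto
      then have xb: "x \<in> ball (c k0 + ?l m0) (r k0)"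
      proof -
        have "x \<notin> sphere (c k0 + ?l m0) (r k0)" using nz k0(1) unfolding Z_def by blast
        then show ?thesis using k0(2) by simp
      qed
      have iff: "?l mn + x \<in> ball (c k) (r k) \<longleftrightarrow> k = k0 \<and> mn = - m0" if k: "k \<in> K" for k mn
      proof
        assume "?l mn + x \<in> ball (c k) (r k)"
        then have xk: "x \<in> ball (c k + ?l (- mn)) (r k)"
          by (simp add: lattice_point_uminus dist_norm algebra_simps)
        show "k = k0 \<and> mn = - m0"
        proof (rule ccontr)
          assume "\<not> ?thesis"
          then have "(k, - mn) \<noteq> (k0, m0)" by auto
          then have "r k + r k0 \<le> dist (c k + ?l (- mn)) (c k0 + ?l m0)"
            using sep k k0(1) unfolding separated_disks_def by blast
          then show False using disjoint_ballI xk xb by blast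
        qed
      next
        assume "k = k0 \<and> mn = - m0"
        then show "?l mn + x \<in> ball (c k) (r k)"
          using xb by (simp add: lattice_point_uminus dist_norm algebra_simps)
      qed
      have "(\<integral>\<^sup>+ mn. indicator (ball (c k) (r k)) (?l mn + x) \<partial>count_space UNIV)
          = (if k = k0 then 1 else 0 :: ennreal)" if k: "k \<in> K" for k
      proof -
        have "indicator (ball (c k) (r k)) (?l mn + x)
            = (if k = k0 then 1 else 0) * (indicator {- m0} mn :: ennreal)" for mn
          using iff[OF k, of mn] by (simp add: indicator_def)
        then show ?thesis by (simp add: nn_integral_cmult)
      qed
      then show ?thesis using True k0(1) fin by simp
    next
      case False
      have z: "indicator (ball (c k) (r k)) (?l mn + x) = (0::ennreal)" if k: "k \<in> K" for k mn
      proof -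
        have "x \<notin> cball (c k + ?l (- mn)) (r k)"
          using False k unfolding lattice_packing_def by blast
        then have "?l mn + x \<notin> ball (c k) (r k)"
          by (simp add: lattice_point_uminus dist_norm algebra_simps)
        then show ?thesis by simp
      qed
      show ?thesis using False by (simp add: z)
    qed
    then show "indicator ?F x * indicator ?S x = indicator ?F x *
      (\<Sum>k\<in>K. \<integral>\<^sup>+ mn. indicator (ball (c k) (r k)) (?l mn + x) \<partial>count_space UNIV)" by simp
  qed
  have meas: "(\<lambda>x. \<integral>\<^sup>+ mn. indicator (ball (c k) (r k)) (?l mn + x) \<partial>count_space UNIV)
      \<in> borel_measurable lborel" for k
  proof -
    have "(\<lambda>z. indicator (ball (c k) (r k)) (?l (snd z) + fst z))
        \<in> borel_measurable (lborel \<Otimes>\<^sub>M count_space (UNIV :: (int \<times> int) set))"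
    proof (rule measurable_compose_countable'[where I = UNIV and g = snd
            and f = "\<lambda>mn z. indicator (ball (c k) (r k)) (?l mn + fst z)"])
      fix mn
      have "(\<lambda>x. indicator (ball (c k) (r k)) (?l mn
          + x)) \<in> borel_measurable (lborel :: complex measure)"
        by (rule measurable_compose[of "\<lambda>x. ?l mn + x" lborel borel])
          (auto intro!: borel_measurable_indicator)
      then show "(\<lambda>z. indicator (ball (c k) (r k)) (?l mn + fst z))
          \<in> borel_measurable (lborel \<Otimes>\<^sub>M count_space (UNIV :: (int \<times> int) set))"
        by (rule measurable_compose[OF measurable_fst])
    qed (auto intro: measurable_snd)
    then show ?thesis
      using sigma_finite_measure.borel_measurable_nn_integral[OF sigma_finite_measure_count_space,
          of "\<lambda>x mn. indicator (ball (c k) (r k)) (?l mn + x)" lborel]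
      by (simp add: case_prod_beta')
  qed
  have "(\<integral>\<^sup>+ x. indicator ?F x * indicator ?S x \<partial>lborel) = (\<integral>\<^sup>+ x. (\<Sum>k\<in>K. indicator ?F x *
      (\<integral>\<^sup>+ mn. indicator (ball (c k) (r k)) (?l mn + x) \<partial>count_space UNIV)) \<partial>lborel)"
    using ae by (intro nn_integral_cong_AE) (simp add: sum_distrib_left)
  also have "\<dots> = (\<Sum>k\<in>K. \<integral>\<^sup>+ x. indicator ?F x *
      (\<integral>\<^sup>+ mn. indicator (ball (c k) (r k)) (?l mn + x) \<partial>count_space UNIV) \<partial>lborel)"
    by (intro nn_integral_sum borel_measurable_times_ennreal meas borel_measurable_indicator)
      (simp add: fundamental_parallelogram_borel[OF d])
  also have "\<dots> = (\<Sum>k\<in>K. \<integral>\<^sup>+ x. indicator (ball (c k) (r k)) x \<partial>lborel)"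
    by (intro sum.cong refl nn_integral_unfold[OF d, symmetric] borel_measurable_indicator) simp
  also have "\<dots> = (\<Sum>k\<in>K. ennreal (pi * (r k)\<^sup>2))"
    by (intro sum.cong refl) (simp add: emeasure_ball pos less_imp_le unit_ball_vol_2)
  also have "\<dots> = ennreal (pi * (\<Sum>k\<in>K. (r k)\<^sup>2))"
    by (simp add: sum_ennreal sum_distrib_left)
  finally show ?thesis .
qed

text \<open>
  The lattice \<open>\<int>u + \<int>v\<close> need not contain all periods of the packing; the comparison of two
  arbitrary period lattices in \<open>cell_mean_independent\<close> covers every basis of periods.
\<close>

theorem has_density_lattice_packing:
  assumes d: "Im (cnj u * v) \<noteq> 0" and fin: "finite K" and sep: "separated_disks K c r u v"
  shows "has_density (lattice_packing K c r u v) (pi * (\<Sum>k\<in>K. (r k)\<^sup>2) / \<bar>Im (cnj u * v)\<bar>)"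
  unfolding has_density_def doubly_periodic_def
proof (intro conjI allI impI)
  let ?P = "lattice_packing K c r u v"
  show "\<exists>u v. period_basis ?P u v" using period_basis_lattice_packing[OF d] by blast
  fix u' v' assume pb: "period_basis ?P u' v'"
  let ?F = "fundamental_parallelogram u v" and ?F' = "fundamental_parallelogram u' v'"
  let ?N = "pi * (\<Sum>k\<in>K. (r k)\<^sup>2)"
  let ?a = "\<bar>Im (cnj u * v)\<bar>" and ?a' = "\<bar>Im (cnj u' * v')\<bar>"
  have d': "Im (cnj u' * v') \<noteq> 0" using pb period_basis_iff unfolding period_basis_def by blast
  have [measurable]: "\<Union>?P \<in> sets borel" by (rule lattice_packing_borel[OF fin])
  have F' [measurable]: "?F' \<in> sets borel" by (rule fundamental_parallelogram_borel[OF d'])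
  have inv: "indicator (\<Union>?P) (lattice_point w z mn + x) = (indicator (\<Union>?P) x :: ennreal)"
    if "period_basis ?P w z" for w z mn x
    using periods_lattice_point[of w ?P z x mn] that unfolding period_basis_def indicator_def by simp
  have "(\<integral>\<^sup>+ x. indicator ?F' x * indicator (\<Union>?P) x \<partial>lborel) = emeasure lborel (\<Union>?P \<inter> ?F')"
    by (simp add: indicator_inter_arith[symmetric] Int_commute)
  then have e: "ennreal ?a' * ennreal ?N = ennreal ?a * emeasure lborel (\<Union>?P \<inter> ?F')"
    using cell_mean_independent[OF d d', of "indicator (\<Union>?P)"]
      inv[OF period_basis_lattice_packing[OF d]] inv[OF pb]
    by (simp add: cell_area_lattice_packing[OF d fin sep] emeasure_fundamental_parallelogram[OF d]
        emeasure_fundamental_parallelogram[OF d'])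
  have N0: "0 \<le> ?N" by (simp add: sum_nonneg)
  have "emeasure lborel (\<Union>?P \<inter> ?F') \<le> emeasure lborel ?F'" by (intro emeasure_mono) auto
  then have "emeasure lborel (\<Union>?P \<inter> ?F') \<noteq> \<infinity>"
    by (auto simp: emeasure_fundamental_parallelogram[OF d'] top_unique)
  then have "emeasure lborel (\<Union>?P \<inter> ?F') = ennreal (measure lborel (\<Union>?P \<inter> ?F'))"
    by (simp add: emeasure_eq_ennreal_measure)
  then have "?a' * ?N = ?a * measure lborel (\<Union>?P \<inter> ?F')"
    using e N0 by (simp add: ennreal_mult[symmetric])
  moreover have "measure lebesgue (\<Union>?P \<inter> ?F') = measure lborel (\<Union>?P \<inter> ?F')"
    by (intro measure_completion) measurable
  moreover have "measure lebesgue ?F' = ?a'"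
    using measure_completion[of ?F' lborel] F'
    by (simp add: measure_def emeasure_fundamental_parallelogram[OF d'])
  ultimately show "measure lebesgue (\<Union>?P \<inter> ?F') / measure lebesgue ?F' = ?N / ?a"
    using d d' by (simp add: field_simps)
qed

section \<open>The hexagonal lattice packing\<close>

lemma hexagonal_packing_eq:
  "hexagonal_packing = lattice_packing {()} (\<lambda>_. 0) (\<lambda>_. 1) 2 (2 * cis (pi / 3))"
proof -
  have "hexagonal_packing = (\<lambda>mn. cball (lattice_point 2 (2 * cis (pi / 3)) mn) 1) ` UNIV"
  proof -
    have "2 * (of_int m + of_int n * cis (pi / 3)) = lattice_point 2 (2 * cis (pi / 3)) (m, n)" for m n
      by (simp add: lattice_point_def algebra_simps)
    moreover have "{g (m, n) | m n :: int. True} = range g" for g :: "int \<times> int \<Rightarrow> complex set"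
      by (auto simp: image_def)
    ultimately show ?thesis unfolding hexagonal_packing_def by (simp only:)
  qed
  also have "\<dots> = lattice_packing {()} (\<lambda>_. 0) (\<lambda>_. 1) 2 (2 * cis (pi / 3))"
    unfolding lattice_packing_def by (auto simp: image_iff)
  finally show ?thesis .
qed

lemma has_density_hexagonal_packing: "has_density hexagonal_packing (pi / sqrt 12)"
proof -
  let ?v = "2 * cis (pi / 3)"
  have v: "?v = Complex 1 (sqrt 3)"
    by (simp add: complex_eq_iff cos_60 sin_60)
  have det: "Im (cnj 2 * ?v) = 2 * sqrt 3" unfolding v by simp
  \<comment> \<open>The squared length \<open>(2 m + n)^2 + 3 n^2\<close> is positive and divisible by 4.\<close>
  have norm: "2 \<le> cmod (lattice_point 2 ?v a - lattice_point 2 ?v b)" if "a \<noteq> b" for a b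
  proof -
    obtain m n where mn: "a - b = (m, n)" by force
    have "lattice_point 2 ?v a - lattice_point 2 ?v b = Complex (of_int (2 * m
        + n)) (of_int n * sqrt 3)"
      using mn unfolding v lattice_point_def by (auto simp: complex_eq_iff minus_prod_def algebra_simps)
    then have "(cmod (lattice_point 2 ?v a - lattice_point 2 ?v b))\<^sup>2
        = of_int ((2 * m + n)\<^sup>2 + 3 * n\<^sup>2)"
      by (simp add: cmod_power2 power_mult_distrib)
    moreover have "4 \<le> (2 * m + n)\<^sup>2 + 3 * n\<^sup>2"
    proof -
      have "(m, n) \<noteq> 0" using mn that by (metis eq_iff_diff_eq_0)
      then have "0 < m\<^sup>2 + m * n + n\<^sup>2"
      proof -
        assume a: "(m, n) \<noteq> 0"
        have "0 < (2 * m + n)\<^sup>2 + 3 * n\<^sup>2"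
        proof (cases "n = 0")
          case True
          then show ?thesis using a by (simp add: zero_prod_def)
        next
          case False
          then show ?thesis by (simp add: add_nonneg_pos)
        qed
        then show ?thesis by (simp add: algebra_simps power2_eq_square)
      qed
      then show ?thesis by (simp add: algebra_simps power2_eq_square)
    qed
    ultimately have "2\<^sup>2 \<le> (cmod (lattice_point 2 ?v a - lattice_point 2 ?v b))\<^sup>2"
      by (metis of_int_le_iff of_int_numeral power2_eq_square mult_2 numeral_Bit0 numeral_times_numeral
          mult_numeral_1_right numeral_One)
    then show ?thesis by (rule power2_le_imp_le) simp
  qed
  have sep: "separated_disks {()} (\<lambda>_. 0) (\<lambda>_. 1) 2 ?v"
    unfolding separated_disks_def using norm by (auto simp: dist_norm)
  have "has_density hexagonal_packing (pi * (\<Sum>k\<in>{()}. 1\<^sup>2) / \<bar>Im (cnj 2 * ?v)\<bar>)"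
    unfolding hexagonal_packing_eq by (rule has_density_lattice_packing) (use det sep in auto)
  moreover have "sqrt 12 = 2 * sqrt 3" using real_sqrt_mult[of 4 3] by simp
  ultimately show ?thesis unfolding det by simp
qed

section \<open>A rational parametrization of the radii\<close>

text \<open>
  The parametrization of the curve of pairs \<open>(p, q)\<close> by \<open>s = 1 / (2 cos \<beta>)\<close>: the medium radius is
  \<open>p_of s\<close> and the small radius is \<open>q_of s\<close>. The polynomials \<open>n_of\<close> and \<open>M_of\<close> are the recurring
  factors; \<open>1 + q = 2 M / n\<close> explains the second one. The relevant range is \<open>s > 0\<close>, \<open>1 < 2 s^2\<close>,
  \<open>s < 1\<close>, which corresponds to \<open>0 < q < p < 1\<close>.
\<close>

definition p_of :: "real \<Rightarrow> real" where "p_of s = 2 * s^2 - 1"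
definition n_of :: "real \<Rightarrow> real" where "n_of s = 2 + s - 2 * s^2"
definition q_of :: "real \<Rightarrow> real" where "q_of s = p_of s * s * (2 * s - 1) / n_of s"
definition M_of :: "real \<Rightarrow> real" where "M_of s = 2 * s^4 - s^3 - 2 * s^2 + s + 1"

lemma n_of_pos: assumes "0 < s" "s \<le> 1" shows "0 < n_of s"
proof -
  have "s^2 \<le> 1" using assms by (simp add: power_le_one)
  then show ?thesis using assms unfolding n_of_def by linarith
qed

lemma one_less_double:
  fixes s :: real assumes "0 < s" "1 < 2 * s^2" shows "1 < 2 * s"
proof (rule ccontr)
  assume "\<not> 1 < 2 * s"
  then have "s * s \<le> (1/2) * (1/2)" using assms by (intro mult_mono) auto
  then show False using assms by (simp add: power2_eq_square)
qed

lemma M_of_pos: assumes "0 < s" "s \<le> 1" shows "0 < M_of s"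
proof -
  have "M_of s = (1 - s^2)^2 + s * (1 - s^2)
      + s^4" unfolding M_of_def by (simp add: algebra_simps power2_eq_square power4_eq_xxxx
      power3_eq_cube)
  moreover have "s^2 \<le> 1" using assms by (simp add: power_le_one)
  ultimately show ?thesis using assms by (simp add: add_nonneg_pos)
qed

lemma radii_sums:
  assumes "n_of s \<noteq> 0"
  shows "p_of s + q_of s = 2 * p_of s / n_of s"
    and "1 + q_of s = 2 * M_of s / n_of s"
    and "1 + p_of s = 2 * s^2"
    and "1 + p_of s + q_of s = s * (2 * s + 1) / n_of s"
proof -
  have q: "q_of s * n_of s = p_of s * s * (2 * s - 1)" using assms unfolding q_of_def by simp
  show "p_of s + q_of s = 2 * p_of s / n_of s"
    using q assms unfolding eq_divide_eq p_of_def n_of_def by simp algebra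
  show "1 + q_of s = 2 * M_of s / n_of s"
    using q assms unfolding eq_divide_eq p_of_def n_of_def M_of_def by simp algebra
  show "1 + p_of s + q_of s = s * (2 * s + 1) / n_of s"
    using q assms unfolding eq_divide_eq p_of_def n_of_def by simp algebra
  show "1 + p_of s = 2 * s^2" by (simp add: p_of_def)
qed

lemma q_of_bounds:
  assumes "0 < s" "s < 1" "1 < 2 * s^2"
  shows "0 < q_of s" "q_of s < p_of s" "p_of s < 1"
proof -
  have n: "0 < n_of s" using n_of_pos assms by simp
  have p: "0 < p_of s" using assms unfolding p_of_def by simp
  have h: "1 < 2 * s" by (rule one_less_double) fact+
  show "0 < q_of s" using n p h assms unfolding q_of_def by simp
  have "0 < 2 * (1 - s) * (2 * s + 1)" using assms by simp
  then have "s * (2 * s - 1) < n_of s"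
    unfolding n_of_def by (simp add: algebra_simps power2_eq_square)
  then have "p_of s * (s * (2 * s - 1)) < p_of s * n_of s" using p by simp
  then show "q_of s < p_of s" unfolding q_of_def using n by (simp add: pos_divide_less_eq mult.assoc)
  have "s^2 < 1" using assms by (simp add: power_less_one_iff abs_square_less_1)
  then show "p_of s < 1" unfolding p_of_def by simp
qed

text \<open>
  With \<open>p = 2 s^2 - 1\<close> the equation of the medium radius is quadratic in \<open>q\<close> with a square
  discriminant, hence splits into two factors linear in \<open>q\<close>. The two factors are exchanged by
  \<open>s \<mapsto> - s\<close>; for \<open>0 < q < p < 1\<close> and \<open>s > 0\<close> only the second can vanish.
\<close>

lemma medium_equation_factor:
  fixes p q s :: real
  assumes "p = 2 * s^2 - 1"
  shows "2 * p^4 + (4 * q + 3) * p^3 + (2 * q^2 - 2 * q + 1) * p^2 - (5 * q^2 + 6 * q) * p + q^2 =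
    2 * (q * (2 * s^2 + s - 2) + p * s * (2 * s + 1)) * (p * s * (2 * s - 1) - q * n_of s)"
  unfolding assms n_of_def by algebra

lemma q_of_strict_mono:
  assumes "0 < s" "1 < 2 * s^2" "s < t" "t \<le> 1"
  shows "q_of s < q_of t"
proof -
  have t: "0 < n_of t" "n_of t < n_of s"
  proof -
    show "0 < n_of t" using n_of_pos assms by simp
    have "0 < (t - s) * (2 * (t + s) - 1)" using assms one_less_double[of s] by simp
    then show "n_of t < n_of s" unfolding n_of_def by (simp add: algebra_simps power2_eq_square)
  qed
  have p: "0 < p_of s" "p_of s < p_of t"
    using assms power_strict_mono[of s t 2] by (auto simp: p_of_def)
  have h: "1 < 2 * s" using one_less_double assms by blast
  have "p_of s * s < p_of t * t" by (rule mult_strict_mono) (use p assms in auto)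
  then have "p_of s * s * (2 * s - 1) < p_of t * t * (2 * t - 1)"
    by (rule mult_strict_mono) (use h p assms in auto)
  moreover have "0 \<le> p_of s * s * (2 * s - 1)" using h p assms by simp
  ultimately show ?thesis unfolding q_of_def using frac_less t by (meson less_imp_le)
qed

lemma q_of_mono:
  assumes "0 < s" "1 < 2 * s^2" "s \<le> t" "t \<le> 1"
  shows "q_of s \<le> q_of t"
  using q_of_strict_mono[OF assms(1,2) _ assms(4)] assms(3) by (cases "s = t") auto

lemma med_radius_q_of:
  assumes s: "0 < s" "s < 1" "1 < 2 * s^2"
  shows "med_radius (q_of s) = p_of s"
  unfolding med_radius_def
proof (rule the_equality)
  have n: "0 < n_of s" using n_of_pos s by simp
  have "p_of s * s * (2 * s - 1) = q_of s * n_of s" using n unfolding q_of_def by simp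
  then show "q_of s < p_of s \<and> p_of s < 1 \<and> 2 * (p_of s)^4 + (4 * q_of s + 3) * (p_of s)^3 +
     (2 * (q_of s)^2 - 2 * q_of s + 1) * (p_of s)^2 - (5 * (q_of s)^2 + 6 * q_of s) * p_of s
     + (q_of s)^2 = 0"
    using q_of_bounds[OF s] medium_equation_factor[of "p_of s" s "q_of s"]
    by (simp add: p_of_def)
next
  fix p assume p: "q_of s < p \<and> p < 1 \<and> 2 * p^4 + (4 * q_of s + 3) * p^3 +
     (2 * (q_of s)^2 - 2 * q_of s + 1) * p^2 - (5 * (q_of s)^2 + 6 * q_of s) * p + (q_of s)^2 = 0"
  define q where "q = q_of s"
  have q0: "0 < q" using q_of_bounds[OF s] by (simp add: q_def)
  \<comment> \<open>The parameter of a second candidate for the medium radius.\<close>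
  define t where "t = sqrt ((p + 1) / 2)"
  have pq: "q < p" "p < 1" using p by (auto simp: q_def)
  have pt: "p = 2 * t^2 - 1" using pq q0 by (simp add: t_def field_simps)
  have t: "0 < t" "t < 1" "1 < 2 * t^2" using pq q0 by (auto simp: t_def)
  have h: "1 < 2 * t" using one_less_double t by blast
  have "0 < q * (2 * t^2 + t - 2) + p * t * (2 * t + 1)"
  proof -
    have "q * (2 - 2 * t^2 - t) \<le> q * 1" using q0 t h by (intro mult_left_mono) auto
    also have "\<dots> < p * 1" using pq by simp
    also have "\<dots> \<le> p * (t * (2 * t + 1))"
    proof -
      have "1 < t * (2 * t + 1)" using t by (simp add: algebra_simps power2_eq_square)
      then show ?thesis using pq q0 by simp
    qed
    finally show ?thesis by (simp add: algebra_simps)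
  qed
  moreover have "2 * (q * (2 * t^2 + t - 2) + p * t * (2 * t
      + 1)) * (p * t * (2 * t - 1) - q * n_of t) = 0"
    using medium_equation_factor[OF pt, of q] p by (simp add: q_def)
  ultimately have "p * t * (2 * t - 1) = q * n_of t" by simp
  then have "q = q_of t"
    using n_of_pos[of t] t by (simp add: q_of_def pt p_of_def field_simps)
  then have "q_of t = q_of s" by (simp add: q_def)
  then have "t = s" using q_of_strict_mono[of s t] q_of_strict_mono[of t s] s t
    by (cases t s rule: linorder_cases) auto
  then show "p = p_of s" by (simp add: pt p_of_def)
qed

text \<open>
  The one irrational quantity needed besides \<open>s\<close>: \<open>w = 2 s sin \<beta>\<close>.
\<close>

definition w_of :: "real \<Rightarrow> real" where "w_of s = sqrt (4 * s^2 - 1)"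

lemma w_of_sq: assumes "1 < 2 * s^2" shows "(w_of s)^2 = 4 * s^2 - 1" "0 < w_of s"
  using assms unfolding w_of_def by auto

lemma radii_product:
  assumes s: "0 < s" "s < 1" "1 < 2 * s^2"
  shows "p_of s * q_of s * (1 + p_of s + q_of s) = (p_of s * s * w_of s / n_of s)^2"
proof -
  have n: "n_of s \<noteq> 0" using n_of_pos[of s] s by simp
  show ?thesis unfolding radii_sums(4)[OF n] power_divide power_mult_distrib w_of_sq[OF s(3)]
    unfolding q_of_def using n by (simp add: field_simps power2_eq_square)
qed

lemma sqrt_radii_product:
  assumes s: "0 < s" "s < 1" "1 < 2 * s^2"
  shows "sqrt (p_of s * q_of s * (1 + p_of s + q_of s)) = p_of s * s * w_of s / n_of s"
  unfolding radii_product[OF s] using s n_of_pos[of s] w_of_sq[OF s(3)] q_of_bounds[OF s]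
  by (intro real_sqrt_unique) auto

lemma \<Delta>_q_of:
  assumes s: "0 < s" "s < 1" "1 < 2 * s^2"
  shows "\<Delta> (q_of s) = pi * (1 + (p_of s)^2 + (q_of s)^2) * (M_of s)^2 /
    ((p_of s)^2 * (w_of s)^3 * (1 + s * n_of s))"
proof -
  define p q n w M where "p = p_of s" "q = q_of s" "n = n_of s" "w = w_of s" "M = M_of s"
  note d = this
  have n: "0 < n" using n_of_pos[of s] s by (simp add: d)
  have w: "0 < w" using w_of_sq[OF s(3)] by (simp add: d)
  have p: "0 < p" using q_of_bounds[OF s] by (simp add: d)
  have qn: "q = p * s * (2 * s - 1) / n" by (simp add: d q_of_def)
  have X: "8 * p^2 * q^2 - (p^2 - 6 * p * q + q^2) * (1 + p + q - p * q) = 8 * p^3 * s * (1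
      + s * n) / n^3"
  proof -
    have "q * n = p * s * (2 * s - 1)" using n by (simp add: qn)
    moreover have "p = 2 * s^2 - 1" "n = 2 + s - 2 * s^2" by (simp_all add: d p_of_def n_of_def)
    ultimately have "(8 * p^2 * q^2 - (p^2 - 6 * p * q + q^2) * (1 + p + q - p * q)) * n^3
        = 8 * p^3 * s * (1 + s * n)" by algebra
    then show ?thesis using n by (simp add: eq_divide_eq)
  qed
  have S: "p + q = 2 * p / n" "1 + q = 2 * M / n" "1 + p = 2 * s^2"
    using radii_sums[of s] n by (simp_all add: d)
  have R: "p * q * (1 + p + q) = (p * s * w / n)^2" "sqrt (p * q * (1 + p + q)) = p * s * w / n"
    using radii_product[OF s] sqrt_radii_product[OF s] by (simp_all add: d)
  have "\<Delta> q = (pi * (1 + p^2 + q^2) * (p + q)^4 * (1 + p)^2 * (1 + q)^2) /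
     (32 * (p * q * (1 + p + q)) * (8 * p^2 * q^2 - (p^2 - 6 * p * q + q^2) * (1 + p + q - p * q))
        * sqrt (p * q * (1 + p + q)))"
    using med_radius_q_of[OF s] by (simp add: \<Delta>_def Let_def d mult.assoc)
  also have "\<dots> = (pi * (1 + p^2 + q^2) * (2 * p / n)^4 * (2 * s^2)^2 * (2 * M / n)^2) /
     (32 * (p * s * w / n)^2 * (8 * p^3 * s * (1 + s * n) / n^3) * (p * s * w / n))"
    unfolding R(2) unfolding R(1) X unfolding S ..
  also have "\<dots> = pi * (1 + p^2 + q^2) * M^2 / (p^2 * w^3 * (1 + s * n))"
  proof -
    have "0 < 1 + s * n" using s n by (simp add: add_pos_pos)
    moreover define A where "A = 1 + s * n"
    moreover define B where "B = 1 + p^2 + q^2"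
    ultimately show ?thesis unfolding A_def[symmetric] B_def[symmetric] using n w p s
      by (simp add: field_simps power_numeral_reduce)
  qed
  finally show ?thesis by (simp add: d)
qed

section \<open>Monotonicity of the density and the numbers bounding the range\<close>

text \<open>
  The numerator of \<open>1 + p^2 + q^2\<close> over the denominator \<open>n^2\<close>.
\<close>

definition T_of :: "real \<Rightarrow> real" where
  "T_of s = 32 * s^8 - 32 * s^7 - 56 * s^6 + 48 * s^5 + 52 * s^4 - 28 * s^3 - 29 * s^2 + 8 * s + 8"

lemma T_of_eq: "T_of s = (n_of s)^2 * (1 + (p_of s)^2) + (p_of s * s * (2 * s - 1))^2"
  unfolding T_of_def n_of_def p_of_def by algebra

lemma power_bound:
  fixes h :: real assumes "\<bar>h\<bar> \<le> e" shows "h^k \<le> e^k" "- (e^k) \<le> h^k"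
proof -
  have "\<bar>h^k\<bar> \<le> e^k" using assms by (simp add: power_abs power_mono)
  then show "h^k \<le> e^k" "- (e^k) \<le> h^k" by auto
qed

text \<open>
  Bounds for the logarithmic derivatives of the factors of \<open>\<Delta>\<close>. Each is a polynomial inequality on
  a short interval and becomes evident after expansion around the midpoint \<open>24/25\<close>.
\<close>

lemma log_derivative_bounds:
  fixes s :: real assumes "239/250 \<le> s" "s \<le> 241/250"
  shows "256 * s^7 - 224 * s^6 - 336 * s^5 + 240 * s^4 + 208 * s^3 - 84 * s^2 - 58 * s
      + 8 \<le> 12/5 * T_of s"
  and "8 * s^3 - 3 * s^2 - 4 * s + 1 \<le> 33/20 * M_of s"
  and "4 * s - 1 \<le> 13/5 * n_of s"
  and "-4 * s \<le> - 22/5 * p_of s"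
  and "-8 * s \<le> - 14/5 * (4 * s^2 - 1)"
  and "6 * s^2 - 2 * s - 2 \<le> 4/5 * (1 + s * n_of s)"
proof -
  define h where "h = s - 24/25"
  have h: "s = 24/25 + h" by (simp add: h_def)
  have "\<bar>h\<bar> \<le> 1/250" using assms unfolding h_def by (intro abs_leI) linarith+
  note b = power_bound[OF this]
  note bs = b[of 1, unfolded power_divide, simplified] b[of 2, unfolded power_divide, simplified]
      b[of 3, unfolded power_divide, simplified] b[of 4, unfolded power_divide, simplified]
    b[of 5, unfolded power_divide, simplified] b[of 6, unfolded power_divide, simplified]
        b[of 7, unfolded power_divide, simplified] b[of 8, unfolded power_divide, simplified]
  have "12/5 * T_of s - (256 * s^7 - 224 * s^6 - 336 * s^5 + 240 * s^4
      + 208 * s^3 - 84 * s^2 - 58 * s + 8) = (466329310184/762939453125)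
      + (-2168711045422/30517578125)*h + (-362511803448/1220703125)*h^2
      + (-66420689504/48828125)*h^3 + (-957081024/390625)*h^4 + (-130352304/78125)*h^5
      + (-515648/3125)*h^6 + (32128/125)*h^7 + (384/5)*h^8"
    unfolding h T_of_def M_of_def n_of_def p_of_def by algebra
  then show "256 * s^7 - 224 * s^6 - 336 * s^5 + 240 * s^4 + 208 * s^3 - 84 * s^2 - 58 * s
      + 8 \<le> 12/5 * T_of s" using bs by linarith
  have "33/20 * M_of s - (8 * s^3 - 3 * s^2 - 4 * s + 1) = (489541/7812500) + (-3102439/312500)*h
      + (-61527/6250)*h^2 + (1511/500)*h^3 + (33/10)*h^4"
    unfolding h T_of_def M_of_def n_of_def p_of_def by algebra
  then show "8 * s^3 - 3 * s^2 - 4 * s + 1 \<le> 33/20 * M_of s" using bs by linarith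
  have "13/5 * n_of s - (4 * s - 1) = (199/3125) + (-1423/125)*h + (-26/5)*h^2"
    unfolding h T_of_def M_of_def n_of_def p_of_def by algebra
  then show "4 * s - 1 \<le> 13/5 * n_of s" using bs by linarith
  have "- 22/5 * p_of s - (-4 * s) = (406/3125) + (-1612/125)*h + (-44/5)*h^2"
    unfolding h T_of_def M_of_def n_of_def p_of_def by algebra
  then show "-4 * s \<le> - 22/5 * p_of s" using bs by linarith
  have "- 14/5 * (4 * s^2 - 1) - (-8 * s) = (494/3125) + (-1688/125)*h + (-56/5)*h^2"
    unfolding h T_of_def M_of_def n_of_def p_of_def by algebra
  then show "-8 * s \<le> - 14/5 * (4 * s^2 - 1)" using bs by linarith
  have "4/5 * (1 + s * n_of s) - (6 * s^2 - 2 * s - 2) = (3758/78125) + (-33774/3125)*h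
      + (-1226/125)*h^2 + (-8/5)*h^3"
    unfolding h T_of_def M_of_def n_of_def p_of_def by algebra
  then show "6 * s^2 - 2 * s - 2 \<le> 4/5 * (1 + s * n_of s)" using bs by linarith
qed

text \<open>
  The polynomial whose sign decides the position relative to \<open>q53\<close>: the height \<open>y\<close> of the rhombus
  satisfies \<open>y^2 - 1 = p G / M^2\<close>, so \<open>q53\<close> is the value of \<open>q\<close> at its zero.
\<close>

definition G_of :: "real \<Rightarrow> real" where
  "G_of s = 8 * s^8 + 24 * s^7 + 2 * s^6 - 32 * s^5 - 12 * s^4 + 6 * s^3 + 3 * s^2 + 2 * s + 1"

lemma G_of_derivative_pos:
  fixes s :: real assumes "239/250 \<le> s" "s \<le> 241/250"
  shows "0 < 64 * s^7 + 168 * s^6 + 12 * s^5 - 160 * s^4 - 48 * s^3 + 18 * s^2 + 6 * s + 2"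
proof -
  define h where "h = s - 24/25"
  have h: "s = 24/25 + h" by (simp add: h_def)
  have "\<bar>h\<bar> \<le> 1/250" using assms unfolding h_def by (intro abs_leI) linarith+
  note b = power_bound[OF this]
  have "64 * s^7 + 168 * s^6 + 12 * s^5 - 160 * s^4 - 48 * s^3 + 18 * s^2 + 6 * s
      + 2 = (215859631586/6103515625) + (137976201798/244140625)*h + (22826235906/9765625)*h^2
      + (337768848/78125)*h^3 + (13130752/3125)*h^4 + (1386444/625)*h^5 + (14952/25)*h^6 + (64)*h^7"
    unfolding h by algebra
  then show ?thesis using b[of 1] b[of 2] b[of 3] b[of 4] b[of 5] b[of 6] b[of 7]
    by (simp add: power_divide)
qed

lemma G_of_strict_mono:
  assumes "239/250 \<le> s" "s < t" "t \<le> 241/250"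
  shows "G_of s < G_of t"
proof (rule DERIV_pos_imp_increasing[OF assms(2)])
  fix x assume "s \<le> x" "x \<le> t"
  then show "\<exists>y. (G_of has_real_derivative y) (at x) \<and> 0 < y"
    using G_of_derivative_pos[of x] assms unfolding G_of_def
    by (intro exI conjI) (auto intro!: derivative_eq_intros)
qed

text \<open>
  A zero of \<open>G_of\<close> yields a root of the polynomial that defines \<open>q53\<close>. The cofactor was obtained
  by division of polynomials in \<open>s\<close>.
\<close>

lemma q53_polynomial_factor:
  fixes s :: real
  assumes "q * n_of s = p_of s * s * (2 * s - 1)"
  shows "(89 * q^8 + 1344 * q^7 + 4008 * q^6 - 464 * q^5 - 2410 * q^4 + 176 * q^3 + 296 * q^2
      - 96 * q + 1) * (n_of s)^8 = G_of s * (729088 * s^24 - 5103616 * s^23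
          + 11810816 * s^22 - 2658304 * s^21 - 31973888 * s^20 + 43715072 * s^19
          + 14080128 * s^18 - 72113152 * s^17 + 35505408 * s^16
          + 43468416 * s^15 - 53431360 * s^14 + 2657152 * s^13
          + 28980160 * s^12 - 17880320 * s^11 - 3774464 * s^10
          + 9788416 * s^9 - 3196544 * s^8 - 1995136 * s^7
          + 1698816 * s^6 - 87680 * s^5 - 330176 * s^4 + 101120 * s^3 + 23040 * s^2 - 11776 * s + 256)"
proof -
  define n a where "n = n_of s" "a = p_of s * s * (2 * s - 1)"
  note na = this
  have e: "q * n = a" using assms by (simp add: na)
  have "(89 * q^8 + 1344 * q^7 + 4008 * q^6 - 464 * q^5 - 2410 * q^4 + 176 * q^3 + 296 * q^2
      - 96 * q + 1) * n^8 = 89 * a^8 + 1344 * a^7 * n + 4008 * a^6 * n^2 - 464 * a^5 * n^3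
      - 2410 * a^4 * n^4 + 176 * a^3 * n^5 + 296 * a^2 * n^6 - 96 * a * n^7 + n^8"
    unfolding e[symmetric] by algebra
  also have "\<dots> = G_of s * (729088 * s^24 - 5103616 * s^23
      + 11810816 * s^22 - 2658304 * s^21 - 31973888 * s^20 + 43715072 * s^19
      + 14080128 * s^18 - 72113152 * s^17 + 35505408 * s^16 + 43468416 * s^15 - 53431360 * s^14
      + 2657152 * s^13 + 28980160 * s^12 - 17880320 * s^11 - 3774464 * s^10
      + 9788416 * s^9 - 3196544 * s^8 - 1995136 * s^7 + 1698816 * s^6 - 87680 * s^5 - 330176 * s^4
      + 101120 * s^3 + 23040 * s^2 - 11776 * s + 256)"
    unfolding na G_of_def n_of_def p_of_def by algebra
  finally show ?thesis by (simp add: na)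
qed

lemma q53_polynomial_strict_mono:
  fixes x y :: real
  assumes "81/125 \<le> x" "x < y" "y \<le> 163/250"
  shows "89 * x^8 + 1344 * x^7 + 4008 * x^6 - 464 * x^5 - 2410 * x^4 + 176 * x^3 + 296 * x^2
      - 96 * x + 1 < 89 * y^8 + 1344 * y^7 + 4008 * y^6 - 464 * y^5 - 2410 * y^4 + 176 * y^3
      + 296 * y^2 - 96 * y + 1"
proof (rule DERIV_pos_imp_increasing[OF assms(2)])
  fix z assume z: "x \<le> z" "z \<le> y"
  define h where "h = z - 13/20"
  have h: "z = 13/20 + h" by (simp add: h_def)
  have "\<bar>h\<bar> \<le> 1/500" using assms z unfolding h_def by (intro abs_leI) linarith+
  note b = power_bound[OF this]
  have "712 * z^7 + 9408 * z^6 + 24048 * z^5 - 2320 * z^4 - 9640 * z^3 + 528 * z^2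
      + 592 * z - 96 = (157611548893/160000000) + (119202142167/8000000)*h
      + (27526515417/400000)*h^2 + (568210463/4000)*h^3 + (28460571/200)*h^4 + (3352821/50)*h^5
      + (63238/5)*h^6 + (712)*h^7"
    unfolding h by algebra
  then have "0 < 712 * z^7 + 9408 * z^6 + 24048 * z^5 - 2320 * z^4 - 9640 * z^3 + 528 * z^2
      + 592 * z - 96" using b[of 1] b[of 2] b[of 3] b[of 4] b[of 5] b[of 6] b[of 7]
    by (simp add: power_divide)
  then show "\<exists>d. ((\<lambda>x. 89 * x^8 + 1344 * x^7 + 4008 * x^6 - 464 * x^5 - 2410 * x^4 + 176 * x^3
      + 296 * x^2 - 96 * x + 1) has_real_derivative d) (at z) \<and> 0 < d"
    by (intro exI conjI) (auto intro!: derivative_eq_intros)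
qed

text \<open>
  The parameters from \<open>239/250\<close> to \<open>241/250\<close> are admissible. This is the working interval; its
  image under \<open>q_of\<close> contains \<open>[0.651, 0.67]\<close>.
\<close>

lemma param_domain:
  fixes s :: real assumes "239/250 \<le> s" "s \<le> 241/250" shows "0 < s" "s < 1" "1 < 2 * s^2"
proof -
  show "0 < s" "s < 1" using assms by auto
  have "(239/250)^2 \<le> s^2" using assms by (intro power_mono) auto
  then show "1 < 2 * s^2" by (simp add: power_divide)
qed

lemma continuous_q_of: "continuous_on {239/250..241/250} q_of"
proof -
  have "n_of s \<noteq> 0" if "s \<in> {239/250..241/250}" for s
    using n_of_pos[of s] that by simp
  then show ?thesis unfolding q_of_def n_of_def p_of_def
    by (intro continuous_intros) (auto simp: n_of_def)
qed

lemma q53_parameter: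
  obtains s0 where "957681064565/1000000000000 \<le> s0" "s0 \<le> 957681064566/1000000000000"
    "G_of s0 = 0" "q53 = q_of s0"
proof -
  let ?a = "957681064565/1000000000000 :: real" and ?b = "957681064566/1000000000000 :: real"
  \<comment> \<open>The end points bracket the zero so closely that the digits of its image are determined.\<close>
  have "\<exists>s\<ge>?a. s \<le> ?b \<and> G_of s = 0"
  proof (rule IVT')
    show "G_of ?a \<le> 0" by (simp add: G_of_def power_divide)
    show "0 \<le> G_of ?b" by (simp add: G_of_def power_divide)
    show "continuous_on {?a..?b} G_of" unfolding G_of_def by (intro continuous_intros)
  qed simp
  then obtain s0 where s0: "?a \<le> s0" "s0 \<le> ?b" "G_of s0 = 0" by blast
  have q0: "0.6510501858 \<le> q_of ?a" "q_of ?b < 0.6510501859"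
    by (simp_all add: q_of_def p_of_def n_of_def power_divide)
  have "q_of ?a \<le> q_of s0" "q_of s0 \<le> q_of ?b"
    using s0 param_domain[of ?a] param_domain[of s0] by (auto intro!: q_of_mono)
  then have q: "0.6510501858 \<le> q_of s0" "q_of s0 < 0.6510501859" using q0 by linarith+
  have n: "0 < n_of s0" using n_of_pos s0 by simp
  then have "q_of s0 * n_of s0 = p_of s0 * s0 * (2 * s0 - 1)" by (simp add: q_of_def)
  from q53_polynomial_factor[OF this] have root: "89 * (q_of s0)^8 + 1344 * (q_of s0)^7
      + 4008 * (q_of s0)^6 - 464 * (q_of s0)^5 - 2410 * (q_of s0)^4 + 176 * (q_of s0)^3
      + 296 * (q_of s0)^2 - 96 * (q_of s0) + 1 = 0"
    using s0 n by simp
  have "q53 = q_of s0" unfolding q53_def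
  proof (rule the_equality)
    fix x :: real
    assume x: "0.6510501858 \<le> x \<and> x < 0.6510501859 \<and>
     89 * x^8 + 1344 * x^7 + 4008 * x^6 - 464 * x^5 - 2410 * x^4 + 176 * x^3 + 296 * x^2
       - 96 * x + 1 = 0"
    then show "x = q_of s0"
      using q53_polynomial_strict_mono[of x "q_of s0"] q53_polynomial_strict_mono[of "q_of s0" x]
        root q by (cases x "q_of s0" rule: linorder_cases) auto
  qed (use q root in simp)
  then show thesis using that s0 by blast
qed

text \<open>
  The logarithm of \<open>\<Delta> (q_of s) / \<pi>\<close>.
\<close>

definition log_density :: "real \<Rightarrow> real" where
  "log_density s = ln (T_of s) + 2 * ln (M_of s) - 2 * ln (n_of s) - 2 * ln (p_of s)
     - 3/2 * ln (4 * s^2 - 1) - ln (1 + s * n_of s)"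

lemma param_factors_pos:
  assumes "239/250 \<le> s" "s \<le> 241/250"
  shows "0 < T_of s" "0 < M_of s" "0 < n_of s" "0 < p_of s" "0 < 4 * s^2 - 1" "0 < 1 + s * n_of s"
proof -
  note d = param_domain[OF assms]
  show n: "0 < n_of s" and "0 < M_of s" using n_of_pos M_of_pos d by simp_all
  show "0 < T_of s" unfolding T_of_eq using n by (intro add_pos_nonneg mult_pos_pos) auto
  show "0 < p_of s" "0 < 4 * s^2 - 1" using d by (simp_all add: p_of_def)
  show "0 < 1 + s * n_of s" using n d by (simp add: add_pos_pos)
qed

lemma \<Delta>_q_of_exp:
  assumes "239/250 \<le> s" "s \<le> 241/250"
  shows "\<Delta> (q_of s) = pi * exp (log_density s)"
proof -
  note d = param_domain[OF assms] and P = param_factors_pos[OF assms]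
  have w: "0 < w_of s" using w_of_sq[OF d(3)] by simp
  have lw: "3/2 * ln (4 * s^2 - 1) = 3 * ln (w_of s)"
    unfolding w_of_def using P(5) by (simp add: ln_sqrt)
  have sum: "1 + (p_of s)^2 + (q_of s)^2 = T_of s / (n_of s)^2"
    unfolding T_of_eq q_of_def using P(3) by (simp add: field_simps)
  have "exp (log_density s) = T_of s * (M_of s)^2 / ((n_of s)^2 * (p_of s)^2 * (w_of s)^3 * (1
      + s * n_of s))"
    unfolding log_density_def lw using P w
    by (simp add: exp_diff exp_add exp_of_nat_mult[of 2, simplified] exp_of_nat_mult[of 3, simplified])
  then show ?thesis unfolding \<Delta>_q_of[OF d] sum by simp
qed

lemma log_density_derivative_neg:
  assumes x: "239/250 \<le> x" "x \<le> 241/250"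
  shows "\<exists>y. (log_density has_real_derivative y) (at x) \<and> y < 0"
proof -
  note P = param_factors_pos[OF x] and B = log_derivative_bounds[OF x]
  have ln_deriv: "((\<lambda>x. ln (f x)) has_real_derivative d / f x) (at x)"
    if "(f has_real_derivative d) (at x)" "0 < f x" for f :: "real \<Rightarrow> real" and d
    using that by (auto intro!: derivative_eq_intros)
  have D1: "(T_of has_real_derivative (256 * x^7 - 224 * x^6 - 336 * x^5 + 240 * x^4
      + 208 * x^3 - 84 * x^2 - 58 * x + 8)) (at x)"
    unfolding T_of_def by (auto intro!: derivative_eq_intros)
  have D2: "(M_of has_real_derivative (8 * x^3 - 3 * x^2 - 4 * x + 1)) (at x)"
    unfolding M_of_def by (auto intro!: derivative_eq_intros)
  have D3: "(n_of has_real_derivative - (4 * x - 1)) (at x)"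
    unfolding n_of_def by (auto intro!: derivative_eq_intros)
  have D4: "(p_of has_real_derivative - (-4 * x)) (at x)"
    unfolding p_of_def by (auto intro!: derivative_eq_intros)
  have D5: "((\<lambda>x. 4 * x^2 - 1) has_real_derivative - (-8 * x)) (at x)"
    by (auto intro!: derivative_eq_intros)
  have D6: "((\<lambda>x. 1 + x * n_of x) has_real_derivative - (6 * x^2 - 2 * x - 2)) (at x)"
    unfolding n_of_def by (auto intro!: derivative_eq_intros simp: algebra_simps power2_eq_square)
  note D = DERIV_diff[OF DERIV_diff[OF DERIV_diff[OF DERIV_diff[OF DERIV_add[OF
      ln_deriv[OF D1 P(1)] DERIV_cmult[OF ln_deriv[OF D2 P(2)], of 2]]
      DERIV_cmult[OF ln_deriv[OF D3 P(3)], of 2]] DERIV_cmult[OF ln_deriv[OF D4 P(4)], of 2]]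
      DERIV_cmult[OF ln_deriv[OF D5 P(5)], of "3/2"]] ln_deriv[OF D6 P(6)],
      folded log_density_def]
  have "(256 * x^7 - 224 * x^6 - 336 * x^5 + 240 * x^4 + 208 * x^3 - 84 * x^2 - 58 * x
      + 8) / T_of x \<le> 12/5" "(8 * x^3 - 3 * x^2 - 4 * x
      + 1) / M_of x \<le> 33/20" "(4 * x - 1) / n_of x \<le> 13/5"
      "(-4 * x) / p_of x \<le> - 22/5"
      "(-8 * x) / (4 * x^2 - 1) \<le> - 14/5" "(6 * x^2 - 2 * x - 2) / (1 + x * n_of x) \<le> 4/5"
    using B P by (simp_all only: pos_divide_le_eq)
  then show ?thesis
    using D by (intro exI conjI) (assumption, simp only: minus_divide_left[symmetric])
qed

lemma log_density_strict_antimono: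
  assumes "239/250 \<le> s" "s < t" "t \<le> 241/250"
  shows "log_density t < log_density s"
  using assms by (intro DERIV_neg_imp_decreasing[OF assms(2)] log_density_derivative_neg) auto

lemma continuous_log_density: "continuous_on {239/250..241/250} log_density"
  using log_density_derivative_neg
  by (intro continuous_at_imp_continuous_on ballI) (meson DERIV_isCont atLeastAtMost_iff)

lemma exp_log_density:
  assumes "239/250 \<le> s" "s \<le> 241/250"
  shows "exp (2 * log_density s) = (T_of s)^2 * (M_of s)^4 /
    ((n_of s)^4 * (p_of s)^4 * (4 * s^2 - 1)^3 * (1 + s * n_of s)^2)"
proof -
  note P = param_factors_pos[OF assms]
  have "2 * log_density s = 2 * ln (T_of s) + 4 * ln (M_of s) - 4 * ln (n_of s) - 4 * ln (p_of s)
     - 3 * ln (4 * s^2 - 1) - 2 * ln (1 + s * n_of s)"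
    unfolding log_density_def by simp
  also have "\<dots> = ln ((T_of s)^2) + ln ((M_of s)^4) - ln ((n_of s)^4) - ln ((p_of s)^4)
     - ln ((4 * s^2 - 1)^3) - ln ((1 + s * n_of s)^2)"
    using P by (simp add: ln_realpow)
  finally show ?thesis using P by (simp add: exp_diff exp_add)
qed

text \<open>
  The level \<open>\<pi> / sqrt 12\<close> of \<open>\<Delta>\<close> is the level \<open>1/12\<close> of \<open>exp (2 * log_density s)\<close>, which is a
  rational function of \<open>s\<close>. This lemma and the next bracket the crossing between two rational
  parameters, so close together that their images under \<open>q_of\<close> have the ten digits claimed for
  \<open>q_max\<close>. The factors are first rounded to thirteen decimals in the safe direction to keep the
  numbers short.
\<close>

lemma exp_log_density_lower: "1/12 \<le> exp (2 * log_density (191757421289/200000000000))"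
proof -
  define a :: real where "a = 191757421289/200000000000"
  have T: "26815909056296/10000000000000 \<le> T_of a"
    unfolding T_of_def a_def by (simp add: power_divide)
  have M: "9289794994317/10000000000000 \<le> M_of a"
    unfolding M_of_def a_def by (simp add: power_divide)
  have n: "n_of a \<le> 11202416754747/10000000000000"
    unfolding n_of_def a_def by (simp add: power_divide)
  have p: "p_of a \<le> 8385454309704/10000000000000"
    unfolding p_of_def a_def by (simp add: power_divide)
  have w: "4 * a^2 - 1 \<le> 26770908619408/10000000000000"
    unfolding  a_def by (simp add: power_divide)
  have U: "1 + a * n_of a \<le> 20740732745475/10000000000000"
    unfolding n_of_def a_def by (simp add: power_divide)
  have I: "239/250 \<le> a" "a \<le> 241/250" by (simp_all add: a_def)
  note P = param_factors_pos[OF I]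
  have "(n_of a)^4 * (p_of a)^4 * (4 * a^2 - 1)^3 * (1
      + a * n_of a)^2 \<le> (11202416754747/10000000000000)^4 * (8385454309704/10000000000000)^4
      * (26770908619408/10000000000000)^3 * (20740732745475/10000000000000)^2"
    using P n p w U T M by (intro mult_mono power_mono mult_nonneg_nonneg zero_le_power) auto
  also have "\<dots> \<le> 12 * ((26815909056296/10000000000000)^2
      * (9289794994317/10000000000000)^4)" by (simp add: power_divide)
  also have "\<dots> \<le> 12 * ((T_of a)^2 * (M_of a)^4)"
    using P n p w U T M by (intro mult_mono power_mono mult_nonneg_nonneg zero_le_power) auto
  finally show ?thesis
    using P unfolding a_def[symmetric] exp_log_density[OF I] by (simp add: field_simps)
qed

lemma exp_log_density_upper: "exp (2 * log_density (958787106457/1000000000000)) \<le> 1/12"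
proof -
  define a :: real where "a = 958787106457/1000000000000"
  have T: "T_of a \<le> 26815909056986/10000000000000"
    unfolding T_of_def a_def by (simp add: power_divide)
  have M: "M_of a \<le> 9289794994493/10000000000000"
    unfolding M_of_def a_def by (simp add: power_divide)
  have n: "11202416754406/10000000000000 \<le> n_of a"
    unfolding n_of_def a_def by (simp add: power_divide)
  have p: "8385454310163/10000000000000 \<le> p_of a"
    unfolding p_of_def a_def by (simp add: power_divide)
  have w: "26770908620327/10000000000000 \<le> 4 * a^2 - 1"
    unfolding  a_def by (simp add: power_divide)
  have U: "20740732745282/10000000000000 \<le> 1 + a * n_of a"
    unfolding n_of_def a_def by (simp add: power_divide)
  have I: "239/250 \<le> a" "a \<le> 241/250" by (simp_all add: a_def)
  note P = param_factors_pos[OF I]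
  have "12 * ((T_of a)^2 * (M_of a)^4) \<le> 12 * ((26815909056986/10000000000000)^2
      * (9289794994493/10000000000000)^4)"
    using P n p w U T M by (intro mult_mono power_mono mult_nonneg_nonneg zero_le_power) auto
  also have "\<dots> \<le> (11202416754406/10000000000000)^4 * (8385454310163/10000000000000)^4
      * (26770908620327/10000000000000)^3
      * (20740732745282/10000000000000)^2" by (simp add: power_divide)
  also have "\<dots> \<le> (n_of a)^4 * (p_of a)^4 * (4 * a^2 - 1)^3 * (1 + a * n_of a)^2"
    using P n p w U T M by (intro mult_mono power_mono mult_nonneg_nonneg zero_le_power) auto
  finally show ?thesis
    using P unfolding a_def[symmetric] exp_log_density[OF I] by (simp add: field_simps)
qed

lemma hexagonal_level: "pi / sqrt 12 = pi * exp (- ln 12 / 2)"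
proof -
  have "exp (- ln 12 / 2) = inverse (exp (ln (sqrt 12)))" by (simp add: ln_sqrt exp_minus)
  then show ?thesis by (simp add: field_simps)
qed

lemma \<Delta>_compare_hexagonal:
  assumes "239/250 \<le> s" "s \<le> 241/250"
  shows "\<Delta> (q_of s) = pi / sqrt 12 \<longleftrightarrow> log_density s = - ln 12 / 2"
    and "pi / sqrt 12 \<le> \<Delta> (q_of s) \<longleftrightarrow> - ln 12 / 2 \<le> log_density s"
  unfolding hexagonal_level \<Delta>_q_of_exp[OF assms] by simp_all

lemma hexagonal_density_param:
  obtains s1 where "191757421289/200000000000 \<le> s1" "s1 \<le> 958787106457/1000000000000"
    "log_density s1 = - ln 12 / 2"
proof -
  let ?a = "191757421289/200000000000 :: real" and ?b = "958787106457/1000000000000 :: real"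
  have "\<exists>s\<ge>?a. s \<le> ?b \<and> log_density s = - ln 12 / 2"
  proof (rule IVT2')
    have "1/12 \<le> exp (2 * log_density ?a)"
      by (rule exp_log_density_lower)
    then have "exp (- ln 12) \<le> exp (2 * log_density ?a)" by (simp add: exp_minus inverse_eq_divide)
    then show "- ln 12 / 2 \<le> log_density ?a" by simp
    have "exp (2 * log_density ?b) \<le> 1/12"
      by (rule exp_log_density_upper)
    then have "exp (2 * log_density ?b) \<le> exp (- ln 12)" by (simp add: exp_minus inverse_eq_divide)
    then show "log_density ?b \<le> - ln 12 / 2" by simp
    show "continuous_on {?a..?b} log_density"
      by (rule continuous_on_subset[OF continuous_log_density]) auto
  qed simp
  then show thesis using that by blast
qed

lemma q_of_surj:
  assumes "0.651 \<le> x" "x \<le> 0.67"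
  obtains s where "239/250 \<le> s" "s \<le> 241/250" "x = q_of s"
proof -
  have "\<exists>s\<ge>239/250. s \<le> 241/250 \<and> q_of s = x"
  proof (rule IVT')
    have "q_of (239/250) \<le> 0.651" "0.67 \<le> q_of (241/250)"
      by (simp_all add: q_of_def p_of_def n_of_def power_divide)
    then show "q_of (239/250) \<le> x" "x \<le> q_of (241/250)" using assms by linarith+
    show "continuous_on {239/250..241/250} q_of" by (rule continuous_q_of)
  qed simp
  then show thesis using that by blast
qed

lemma q_of_less_iff:
  assumes "239/250 \<le> s" "s \<le> 241/250" "239/250 \<le> t" "t \<le> 241/250"
  shows "q_of s < q_of t \<longleftrightarrow> s < t" "q_of s \<le> q_of t \<longleftrightarrow> s \<le> t"
  using q_of_strict_mono[of s t] q_of_mono[of t s] q_of_mono[of s t] q_of_strict_mono[of t s]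
    param_domain[OF assms(1,2)] param_domain[OF assms(3,4)]
  by (meson less_le_not_le not_le order.strict_implies_order)+

lemma q53_bounds: "0.651 < q53" "q53 < 0.6511"
proof -
  obtain s0 where s0: "957681064565/1000000000000 \<le> s0" "s0 \<le> 957681064566/1000000000000"
    "G_of s0 = 0" "q53 = q_of s0" by (rule q53_parameter)
  have "0.651 < q_of (957681064565/1000000000000)" "q_of (957681064566/1000000000000) < 0.6511"
    by (simp_all add: q_of_def p_of_def n_of_def power_divide)
  moreover have "q_of (957681064565/1000000000000) \<le> q_of s0" "q_of s0
      \<le> q_of (957681064566/1000000000000)"
    using s0(1,2) by (simp_all add: q_of_less_iff)
  ultimately show "0.651 < q53" "q53 < 0.6511" unfolding s0(4) by linarith+
qed

lemma hexagonal_density_unique: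
  obtains s1 where "191757421289/200000000000 \<le> s1" "s1 \<le> 958787106457/1000000000000"
    "log_density s1 = - ln 12 / 2" "q53 < q_of s1"
    "\<And>x. q53 < x \<and> x < 0.67 \<and> \<Delta> x = pi / sqrt 12 \<longleftrightarrow> x = q_of s1"
    "0.6585340820 \<le> q_of s1" "q_of s1 < 0.6585340821"
proof -
  obtain s1 where s1: "191757421289/200000000000 \<le> s1" "s1 \<le> 958787106457/1000000000000"
    "log_density s1 = - ln 12 / 2" by (rule hexagonal_density_param)
  have I: "239/250 \<le> s1" "s1 \<le> 241/250" using s1 by linarith+
  have "0.6585340820 \<le> q_of (191757421289/200000000000)"
    "q_of (958787106457/1000000000000) < 0.6585340821"
    by (simp_all add: q_of_def p_of_def n_of_def power_divide)
  moreover have "q_of (191757421289/200000000000) \<le> q_of s1" "q_of s1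
      \<le> q_of (958787106457/1000000000000)"
    using s1 by (simp_all add: q_of_less_iff)
  ultimately have q: "0.6585340820 \<le> q_of s1" "q_of s1 < 0.6585340821" by linarith+
  have "x = q_of s1" if x: "q53 < x" "x < 0.67" "\<Delta> x = pi / sqrt 12" for x
  proof -
    obtain s where s: "239/250 \<le> s" "s \<le> 241/250" "x = q_of s"
      using q_of_surj[of x] x q53_bounds by auto
    have "log_density s = log_density s1" using x s s1 \<Delta>_compare_hexagonal(1)[OF s(1,2)] by simp
    then have "s = s1" using log_density_strict_antimono[of s s1] log_density_strict_antimono[of
        s1 s] s I
      by (cases s s1 rule: linorder_cases) auto
    then show ?thesis using s by simp
  qed
  moreover have "\<Delta> (q_of s1) = pi / sqrt 12" using \<Delta>_compare_hexagonal(1)[OF I] s1 by simp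
  moreover have "q53 < q_of s1" "q_of s1 < 0.67" using q q53_bounds by simp_all
  ultimately show thesis using that s1 q by blast
qed

lemma q_max_parameter:
  obtains s1 where "191757421289/200000000000 \<le> s1" "s1 \<le> 958787106457/1000000000000"
    "log_density s1 = - ln 12 / 2" "q_max = q_of s1"
proof -
  obtain s1 where s1: "191757421289/200000000000 \<le> s1" "s1 \<le> 958787106457/1000000000000"
    "log_density s1 = - ln 12 / 2"
    "\<And>x. q53 < x \<and> x < 0.67 \<and> \<Delta> x = pi / sqrt 12 \<longleftrightarrow> x = q_of s1"
    by (rule hexagonal_density_unique) blast
  have "q_max = q_of s1" unfolding q_max_def s1(4) by simp
  then show thesis using that s1 by blast
qed

lemma q_max_properties:
  "\<exists>!x. q53 < x \<and> x < 0.67 \<and> \<Delta> x = pi / sqrt 12"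
  "0.6585340820 \<le> q_max" "q_max < 0.6585340821"
proof -
  obtain s1 where u: "\<And>x. q53 < x \<and> x < 0.67 \<and> \<Delta> x = pi / sqrt 12 \<longleftrightarrow> x = q_of s1"
    and b: "0.6585340820 \<le> q_of s1" "q_of s1 < 0.6585340821"
    by (rule hexagonal_density_unique) blast
  show "\<exists>!x. q53 < x \<and> x < 0.67 \<and> \<Delta> x = pi / sqrt 12" unfolding u by simp
  have "q_max = q_of s1" unfolding q_max_def u by simp
  then show "0.6585340820 \<le> q_max" "q_max < 0.6585340821" using b by simp_all
qed

text \<open>
  The range \<open>q53 < q \<le> q_max\<close> in terms of the parameter, with everything that the geometry needs.
\<close>

lemma range_parameter:
  assumes "q53 < q" "q \<le> q_max"
  obtains s where "239/250 \<le> s" "s \<le> 241/250" "q = q_of s" "0 < G_of s"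
    "pi / sqrt 12 \<le> \<Delta> q" "957/1000 \<le> s" "s \<le> 959/1000"
proof -
  obtain s where s: "239/250 \<le> s" "s \<le> 241/250" "q = q_of s"
    using q_of_surj[of q] assms q53_bounds q_max_properties by auto
  obtain s0 where s0: "957681064565/1000000000000 \<le> s0" "s0 \<le> 957681064566/1000000000000"
    "G_of s0 = 0" "q53 = q_of s0" by (rule q53_parameter)
  obtain s1 where s1: "191757421289/200000000000 \<le> s1" "s1 \<le> 958787106457/1000000000000"
    "log_density s1 = - ln 12 / 2" "q_max = q_of s1" by (rule q_max_parameter)
  have l: "s0 < s" using assms s s0 q_of_less_iff(1)[of s0 s] by simp
  have u: "s \<le> s1" using assms s s1 q_of_less_iff(2)[of s s1] by simp
  have "0 < G_of s" using G_of_strict_mono[of s0 s] l s s0 by simp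
  moreover have "log_density s1 \<le> log_density s"
    using log_density_strict_antimono[of s s1] u s s1 by (cases "s = s1") auto
  then have "pi / sqrt 12 \<le> \<Delta> q" using \<Delta>_compare_hexagonal(2)[OF s(1,2)] s s1 by simp
  ultimately show thesis using that s l u s0 s1 by simp
qed

section \<open>The density function of Fejes Toth\<close>

text \<open>
  The square root that occurs in the density of Fejes Toth's packing.
\<close>

definition FT_root :: "real \<Rightarrow> real" where "FT_root q = sqrt (2 * q^3 + 5 * q^2 + 2 * q)"

text \<open>
  The logarithm of \<open>4 / \<pi>\<close> times the density expression, see \<open>FT_density_expr_exp\<close>. It is strictly
  decreasing near \<open>q_FT2\<close>, which makes that number well defined.
\<close>

definition FT_log :: "real \<Rightarrow> real" where
  "FT_log q = ln (q^2 + 1) + 4 * ln (q + 1) + 1/2 * ln (1 + 2 * q) - ln q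
     - ln (2 * q^2 + 5 * q + FT_root q + 2) - ln (q + FT_root q)"

lemma FT_root_pos: "0 < q \<Longrightarrow> 0 < FT_root q"
  unfolding FT_root_def by (simp add: add_pos_pos)

lemma FT_density_expr_exp:
  assumes "0 < q" shows "FT_density_expr q = pi / 4 * exp (FT_log q)"
proof -
  have R: "0 < FT_root q" using assms by (rule FT_root_pos)
  have w: "1/2 * ln (1 + 2 * q) = ln (sqrt (1 + 2 * q))" using assms by (simp add: ln_sqrt)
  have "FT_log q = ln (q^2 + 1) + ln ((q + 1)^4) + ln (sqrt (1 + 2 * q)) - ln q
     - ln (2 * q^2 + 5 * q + FT_root q + 2) - ln (q + FT_root q)"
    unfolding FT_log_def w using assms by (simp add: ln_realpow)
  then have "exp (FT_log q) = (q^2 + 1) * (q + 1)^4 * sqrt (1 + 2 * q)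
      / q / (2 * q^2 + 5 * q + FT_root q + 2) / (q + FT_root q)"
    using assms R by (simp add: exp_diff exp_add add_pos_pos)
  then show ?thesis unfolding FT_density_expr_def FT_root_def by (simp add: mult.assoc)
qed

lemma FT_log_strict_antimono:
  assumes "0.6457 \<le> x" "x < y" "y \<le> 0.6458"
  shows "FT_log y < FT_log x"
proof (rule DERIV_neg_imp_decreasing[OF assms(2)])
  fix q assume "x \<le> q" "q \<le> y"
  then have q: "6457/10000 \<le> q" "q \<le> 6458/10000" using assms by simp_all
  have q2: "(6457/10000)^2 \<le> q^2" "q^2 \<le> (6458/10000)^2"
    and q3: "(6457/10000)^3 \<le> q^3" "q^3 \<le> (6458/10000)^3" using q by (auto intro!: power_mono)
  note b = q q2[unfolded power_divide, simplified] q3[unfolded power_divide, simplified]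
  define r where "r = FT_root q"
  have r: "1978/1000 \<le> r"
    unfolding r_def FT_root_def by (rule real_le_rsqrt) (use b in \<open>simp add: power_divide\<close>)
  have r2: "r \<le> 1979/1000"
    unfolding r_def FT_root_def by (rule real_le_lsqrt) (use b in \<open>simp_all add: power_divide\<close>)
  note r = r r2
  define r' where "r' = (6 * q^2 + 10 * q + 2) / (2 * r)"
  have r': "276/100 \<le> r'" unfolding r'_def using b r by (simp add: pos_le_divide_eq)
  have Dr: "(FT_root has_real_derivative r') (at q)"
    unfolding FT_root_def[abs_def] r'_def r_def using b
    by (auto intro!: derivative_eq_intros simp: FT_root_def divide_simps)
  have ln_deriv: "((\<lambda>x. ln (f x)) has_real_derivative d / f q) (at q)"
    if "(f has_real_derivative d) (at q)" "0 < f q" for f :: "real \<Rightarrow> real" and d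
    using that by (auto intro!: derivative_eq_intros)
  have "((\<lambda>q. q^2 + 1) has_real_derivative 2 * q) (at q)" by (auto intro!: derivative_eq_intros)
  note L1 = ln_deriv[OF this]
  have "((\<lambda>q. q + 1) has_real_derivative 1) (at q)" by (auto intro!: derivative_eq_intros)
  note L2 = ln_deriv[OF this]
  have "((\<lambda>q. 1 + 2 * q) has_real_derivative 2) (at q)" by (auto intro!: derivative_eq_intros)
  note L3 = ln_deriv[OF this]
  have "((\<lambda>q. 2 * q^2 + 5 * q + FT_root q + 2) has_real_derivative 4 * q + 5 + r') (at q)"
    by (auto intro!: derivative_eq_intros Dr)
  note L5 = ln_deriv[OF this]
  have "((\<lambda>q. q + FT_root q) has_real_derivative 1 + r') (at q)"
    by (auto intro!: derivative_eq_intros Dr)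
  note L6 = ln_deriv[OF this]
  have D: "(FT_log has_real_derivative 2 * q / (q^2 + 1) + 4 * (1 / (q + 1)) + 1/2 * (2 / (1
      + 2 * q)) - 1 / q
      - (4 * q + 5 + r') / (2 * q^2 + 5 * q + r + 2) - (1 + r') / (q + r)) (at q)"
    unfolding FT_log_def[abs_def] r_def using b r
    by (intro DERIV_diff DERIV_add DERIV_cmult L1 L2 L3 L5 L6 ln_deriv[OF DERIV_ident])
      (auto simp: r_def)
  have "2 * q / (q^2 + 1) \<le> 92/100" using b by (simp add: pos_divide_le_eq add_pos_pos)
  moreover have "1 / (q + 1) \<le> 61/100" using b by (simp add: pos_divide_le_eq)
  moreover have "2 / (1 + 2 * q) \<le> 88/100" using b by (simp add: pos_divide_le_eq)
  moreover have "154/100 \<le> 1 / q" using b by (simp add: pos_le_divide_eq)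
  moreover have "128/100 \<le> (4 * q + 5 + r') / (2 * q^2 + 5 * q + r + 2)"
    using b r r' by (simp add: pos_le_divide_eq add_pos_pos)
  moreover have "143/100 \<le> (1 + r') / (q + r)"
    using b r r' by (simp add: pos_le_divide_eq)
  ultimately have "2 * q / (q^2 + 1) + 4 * (1 / (q + 1)) + 1/2 * (2 / (1 + 2 * q)) - 1 / q
      - (4 * q + 5 + r') / (2 * q^2 + 5 * q + r + 2) - (1 + r') / (q + r) < 0" by linarith
  then show "\<exists>d. (FT_log has_real_derivative d) (at q) \<and> d < 0" using D by blast
qed

lemma FT_density_expr_left: "pi / sqrt 12 \<le> FT_density_expr 0.6457072159"
proof -
  define q :: real where "q = 6457072159/10000000000"
  have R: "0 < FT_root q" by (rule FT_root_pos) (simp add: q_def)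
  \<comment> \<open>The value exceeds the level by a few units in the twelfth decimal only, so fourteen decimals
      are kept.\<close>
  have R2: "FT_root q \<le> 197852040131007/100000000000000"
    unfolding q_def FT_root_def by (rule real_le_lsqrt) (simp_all add: power_divide)
  note R = R R2
  have W: "151374186432165/100000000000000 \<le> sqrt (1 + 2 * q)"
    unfolding q_def by (rule real_le_rsqrt) (simp add: power_divide)
  have S: "346410161513775/100000000000000 \<le> sqrt 12"
    by (rule real_le_rsqrt) (simp add: power_divide)
  have q: "0 < q" by (simp add: q_def)
  have "4 * q * (2 * q^2 + 5 * q + FT_root q + 2) * (q + FT_root q)
     \<le> 4 * q * (2 * q^2 + 5 * q + 197852040131007/100000000000000 + 2) * (q
         + 197852040131007/100000000000000)"
    using q R by (intro mult_mono) auto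
  also have "\<dots> \<le> (q^2 + 1) * (q
      + 1)^4 * (151374186432165/100000000000000 * (346410161513775/100000000000000))"
    unfolding q_def by (simp add: power_divide)
  also have "\<dots> \<le> (q^2 + 1) * (q + 1)^4 * (sqrt (1 + 2 * q) * sqrt 12)"
    using q W S by (intro mult_left_mono mult_mono) auto
  finally have "pi * (4 * q * (2 * q^2 + 5 * q + FT_root q + 2) * (q + FT_root q))
     \<le> pi * ((q^2 + 1) * (q + 1)^4 * (sqrt (1 + 2 * q) * sqrt 12))" by simp
  moreover have "0 < 4 * q * (2 * q^2 + 5 * q + FT_root q + 2) * (q + FT_root q)"
    using q R by (simp add: add_pos_pos)
  ultimately have "pi / sqrt 12 \<le> FT_density_expr q"
    unfolding FT_density_expr_def FT_root_def by (simp add: pos_le_divide_eq pos_divide_le_eq ac_simps)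
  then show ?thesis by (simp add: q_def)
qed

lemma FT_density_expr_right: "FT_density_expr 0.6457072160 < pi / sqrt 12"
proof -
  define q :: real where "q = 6457072160/10000000000"
  have R: "197852040158700/100000000000000 \<le> FT_root q"
    unfolding q_def FT_root_def by (rule real_le_rsqrt) (simp add: power_divide)
  have W: "sqrt (1 + 2 * q) \<le> 151374186438772/100000000000000"
    unfolding q_def by (rule real_le_lsqrt) (simp_all add: power_divide)
  have S: "sqrt 12 \<le> 346410161513776/100000000000000"
    by (rule real_le_lsqrt) (simp_all add: power_divide)
  have q: "0 < q" by (simp add: q_def)
  have "(q^2 + 1) * (q + 1)^4 * (sqrt (1 + 2 * q) * sqrt 12)
    \<le> (q^2 + 1) * (q + 1)^4 * (151374186438772/100000000000000 * (346410161513776/100000000000000))"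
    using q W S by (intro mult_left_mono mult_mono) auto
  also have "\<dots> < 4 * q * (2 * q^2 + 5 * q + 197852040158700/100000000000000 + 2) * (q
      + 197852040158700/100000000000000)"
    unfolding q_def by (simp add: power_divide)
  also have "\<dots> \<le> 4 * q * (2 * q^2 + 5 * q + FT_root q + 2) * (q + FT_root q)"
    using q R by (intro mult_mono) auto
  finally have "pi * ((q^2 + 1) * (q + 1)^4 * (sqrt (1 + 2 * q) * sqrt 12))
     < pi * (4 * q * (2 * q^2 + 5 * q + FT_root q + 2) * (q + FT_root q))" by simp
  moreover have "0 < 4 * q * (2 * q^2 + 5 * q + FT_root q + 2) * (q + FT_root q)"
    using q FT_root_pos[OF q] by (simp add: add_pos_pos)
  ultimately have "FT_density_expr q < pi / sqrt 12"
    unfolding FT_density_expr_def FT_root_def by (simp add: pos_less_divide_eq pos_divide_less_eq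
        ac_simps)
  then show ?thesis by (simp add: q_def)
qed

lemma q_FT2_bounds: "0.6457072159 \<le> q_FT2" "q_FT2 < 0.6457072160"
proof -
  let ?I = "\<lambda>x. 0.6457072159 \<le> x \<and> x < 0.6457072160 \<and> FT_density_expr x = pi / sqrt 12"
  have cont: "continuous_on {0.6457072159..0.6457072160} FT_density_expr"
    unfolding FT_density_expr_def
  proof (intro continuous_intros ballI)
    fix q :: real assume "q \<in> {0.6457072159..0.6457072160}"
    then have "0 < q" by simp
    then show "4 * q * (2 * q^2 + 5 * q + sqrt (2 * q^3 + 5 * q^2 + 2 * q) + 2)
        * (q + sqrt (2 * q^3 + 5 * q^2 + 2 * q)) \<noteq> 0"
      using FT_root_pos[of q] by (simp add: FT_root_def[symmetric] add_pos_pos less_imp_neq[symmetric])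
  qed
  have "\<exists>x\<ge>0.6457072159. x \<le> 0.6457072160 \<and> FT_density_expr x = pi / sqrt 12"
    by (rule IVT2'[OF less_imp_le[OF FT_density_expr_right] FT_density_expr_left _ cont]) simp
  then obtain x where x: "0.6457072159 \<le> x" "x \<le> 0.6457072160" "FT_density_expr x = pi / sqrt 12"
    by blast
  then have "x \<noteq> 0.6457072160" using FT_density_expr_right x(3) less_irrefl by metis
  then have x': "?I x" using x by (simp add: less_le)
  have "y = x" if y: "?I y" for y
  proof -
    have "FT_log x = FT_log y"
      using FT_density_expr_exp[of x] FT_density_expr_exp[of y] x' y by simp
    moreover have "0.6457 \<le> x" "x \<le> 0.6458" "0.6457 \<le> y" "y \<le> 0.6458" using x' y by simp_all
    ultimately have "\<not> x < y" "\<not> y < x"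
      using FT_log_strict_antimono[of x y] FT_log_strict_antimono[of y x] by (metis less_irrefl)+
    then show ?thesis by simp
  qed
  then have "q_FT2 = x" unfolding q_FT2_def by (intro the_equality x')
  then show "0.6457072159 \<le> q_FT2" "q_FT2 < 0.6457072160" using x' by blast+
qed

lemma \<delta>_FT_hexagonal:
  assumes "0.651 < q" "q \<le> 1" shows "\<delta>_FT q = pi / sqrt 12"
  using assms q_FT2_bounds unfolding \<delta>_FT_def by simp

section \<open>Coordinates of the disk centers and their separation\<close>

text \<open>
  The polynomial in \<open>cos \<gamma> = N / (2 M)\<close>.
\<close>

definition N_of :: "real \<Rightarrow> real" where "N_of s = 2 * s^3 + 3 * s^2 - 2 * s - 2"

lemma N_of_pos:
  assumes "957/1000 \<le> s" shows "0 < N_of s"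
proof -
  have "(957/1000)^2 \<le> s^2" using assms by (intro power_mono) auto
  then have q: "915849/1000000 \<le> s^2" by (simp add: power_divide)
  define t u where "t = s * (s^2 - 9/10)" and "u = s * (s - 957/1000)"
  have "0 \<le> t" "0 \<le> u"
    using assms q by (auto intro!: mult_nonneg_nonneg simp: t_def u_def)
  moreover have "N_of s = 2 * t + 3/5 * u + 12/5 * s^2 + 1871/5000 * s - 2"
    unfolding N_of_def t_def u_def by algebra
  ultimately show ?thesis using q assms by linarith
qed

text \<open>
  Since \<open>y = s w N / M\<close>, the conclusion says \<open>y \<ge> 1\<close>: the two large disks next to the origin do
  not overlap.
\<close>

lemma height_ge_one:
  assumes "1 < 2 * s^2" "0 \<le> G_of s"
  shows "(M_of s)^2 \<le> (4 * s^2 - 1) * s^2 * (N_of s)^2"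
proof -
  have "(4 * s^2 - 1) * s^2 * (N_of s)^2 - (M_of s)^2 = p_of s * G_of s"
    unfolding N_of_def M_of_def p_of_def G_of_def by algebra
  moreover have "0 \<le> p_of s * G_of s" using assms by (simp add: p_of_def)
  ultimately show ?thesis by linarith
qed

text \<open>
  A common denominator of all coordinates, and the numerators of the half periods: the cell has
  half-width \<open>A = a / K\<close> and half-height \<open>B = w b / K\<close>.
\<close>

definition K_of :: "real \<Rightarrow> real" where "K_of s = 2 * s * n_of s * M_of s"
definition a_of :: "real \<Rightarrow> real" where "a_of s = p_of s * (4 * s^2 - 1) * (2 * s * n_of s)"
definition b_of :: "real \<Rightarrow> real" where "b_of s = 2 * s * n_of s * p_of s * (1 + s * n_of s)"

text \<open>
  The three classes of disks, with radii \<open>1\<close>, \<open>p\<close> and \<open>q\<close>.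
\<close>

datatype disk_size = Large | Medium | Small

text \<open>
  In the frame rotated by \<open>\<beta>\<close> the three representative disks have centers \<open>(x / K, w y / K)\<close> and
  radii \<open>r / K\<close>, where \<open>x\<close>, \<open>y\<close>, \<open>r\<close> are the polynomials in \<open>s\<close> given by the following functions.
  In these units the squared length of \<open>(x, y)\<close> is \<open>x^2 + (4 s^2 - 1) y^2\<close>.
\<close>

fun x_of :: "real \<Rightarrow> disk_size \<Rightarrow> real" where
  "x_of s Large = - ((4 * s^2 - 1) * N_of s * s * n_of s)"
| "x_of s Medium = 2 * (M_of s)^2 - (N_of s)^2 + 2 * p_of s * (2 * s * M_of s - 2 * s - 1)"
| "x_of s Small = 2 * (M_of s)^2 - (N_of s)^2"

fun y_of :: "real \<Rightarrow> disk_size \<Rightarrow> real" where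
  "y_of s Large = N_of s * s * n_of s"
| "y_of s Medium = 2 * (M_of s)^2 - (N_of s)^2 + 2 * (p_of s)^2"
| "y_of s Small = 2 * (M_of s)^2 - (N_of s)^2"

fun r_of :: "real \<Rightarrow> disk_size \<Rightarrow> real" where
  "r_of s Large = K_of s"
| "r_of s Medium = p_of s * K_of s"
| "r_of s Small = 2 * s^2 * M_of s * p_of s * (2 * s - 1)"

declare x_of.simps [simp del] y_of.simps [simp del] r_of.simps [simp del]

text \<open>
  Signs are encoded as booleans, \<open>True\<close> standing for \<open>+1\<close>.
\<close>

definition sgn_of :: "bool \<Rightarrow> real" where "sgn_of b = (if b then 1 else - 1)"

lemma shifted_square_ge:
  fixes a \<alpha> :: real
  assumes "\<bar>a\<bar> \<le> \<alpha>" shows "a^2 \<le> (a + 2 * \<alpha> * of_int m)^2"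
proof -
  have "0 \<le> \<alpha> * (of_int m * (a + \<alpha> * of_int m))"
  proof (rule mult_nonneg_nonneg)
    show \<alpha>: "0 \<le> \<alpha>" using assms by linarith
    show "0 \<le> of_int m * (a + \<alpha> * of_int m)"
    proof (cases m "0::int" rule: linorder_cases)
      case less
      then have "of_int m \<le> (-1::real)" by linarith
      then have "\<alpha> * of_int m \<le> \<alpha> * (-1)" using \<alpha> by (intro mult_left_mono)
      then show ?thesis using less assms by (intro mult_nonpos_nonpos) auto
    next
      case greater
      then have "1 \<le> (of_int m :: real)" by linarith
      then have "\<alpha> * 1 \<le> \<alpha> * of_int m" using \<alpha> by (intro mult_left_mono)
      then show ?thesis using greater assms by (intro mult_nonneg_nonneg) auto
    qed simp
  qed
  then show ?thesis by (simp add: power2_eq_square algebra_simps)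
qed

text \<open>
  Among the vectors that differ by the lattice with half periods \<open>\<alpha>\<close> and \<open>\<beta>\<close>, one inside the
  rectangle \<open>[-\<alpha>, \<alpha>] \<times> [-\<beta>, \<beta>]\<close> is shortest.
\<close>

lemma lattice_distance_ge:
  fixes a b \<alpha> \<beta> c w :: real
  assumes "c^2 \<le> (a + \<alpha> * of_int j0)^2 + w * (b + \<beta> * of_int l0)^2"
    and "\<bar>a + \<alpha> * of_int j0\<bar> \<le> \<alpha>" "\<bar>b + \<beta> * of_int l0\<bar> \<le> \<beta>" "0 \<le> w"
    and "even (j - j0)" "even (l - l0)"
  shows "c^2 \<le> (a + \<alpha> * of_int j)^2 + w * (b + \<beta> * of_int l)^2"
proof -
  obtain m where m: "j - j0 = 2 * m" using assms(5) by (rule evenE)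
  obtain n where n: "l - l0 = 2 * n" using assms(6) by (rule evenE)
  have "j = j0 + 2 * m" "l = l0 + 2 * n" using m n by linarith+
  then have e: "a + \<alpha> * of_int j = a + \<alpha> * of_int j0 + 2 * \<alpha> * of_int m"
    "b + \<beta> * of_int l = b + \<beta> * of_int l0 + 2 * \<beta> * of_int n" by (simp_all add: algebra_simps)
  have "w * (b + \<beta> * of_int l0)^2 \<le> w * (b + \<beta> * of_int l)^2"
    unfolding e by (intro mult_left_mono shifted_square_ge assms)
  moreover have "(a + \<alpha> * of_int j0)^2 \<le> (a + \<alpha> * of_int j)^2"
    unfolding e by (intro shifted_square_ge assms)
  ultimately show ?thesis using assms(1) by linarith
qed

text \<open>
  Numerical enclosures on the range of the packing. They are used to locate differences of centers
  in the cell and to separate those pairs of disks that do not touch.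
\<close>

lemma center_bounds:
  fixes s :: real assumes "957/1000 \<le> s" "s \<le> 959/1000"
  shows "-7/4 \<le> x_of s Large" "x_of s Large \<le> -42/25"
  and "-11/20 \<le> x_of s Medium" "x_of s Medium \<le> -13/25"
  and "34/25 \<le> x_of s Small" "x_of s Small \<le> 69/50"
  and "63/100 \<le> y_of s Large" "y_of s Large \<le> 13/20"
  and "11/4 \<le> y_of s Medium" "y_of s Medium \<le> 139/50"
  and "34/25 \<le> y_of s Small" "y_of s Small \<le> 69/50"
  and "199/100 \<le> r_of s Large" "r_of s Large \<le> 2"
  and "33/20 \<le> r_of s Medium" "r_of s Medium \<le> 42/25"
  and "32/25 \<le> r_of s Small" "r_of s Small \<le> 33/25"
  and "477/100 \<le> a_of s" "a_of s \<le> 483/100"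
  and "93/25 \<le> b_of s" "b_of s \<le> 187/50"
proof -
  define h where "h = s - 479/500"
  have h: "s = 479/500 + h" by (simp add: h_def)
  have "\<bar>h\<bar> \<le> 1/1000" using assms unfolding h_def by (intro abs_leI) linarith+
  note b = power_bound[OF this]
  note bs = b[of 1, unfolded power_divide, simplified] b[of 2, unfolded power_divide, simplified]
      b[of 3, unfolded power_divide, simplified] b[of 4, unfolded power_divide, simplified]
      b[of 5, unfolded power_divide, simplified] b[of 6, unfolded power_divide, simplified]
      b[of 7, unfolded power_divide, simplified] b[of 8, unfolded power_divide, simplified]
      b[of 9, unfolded power_divide, simplified] b[of 10, unfolded power_divide, simplified]
      b[of 11, unfolded power_divide, simplified]
  note D = x_of.simps y_of.simps r_of.simps a_of_def b_of_def K_of_def p_of_def n_of_def M_of_def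
      N_of_def
  have "x_of s Large = (-417745668470982575139/244140625000000000000)
      + (-3535180146507536707/122070312500000000)*h + (-6081940181386639/122070312500000)*h^2
      + (87086926136961/488281250000)*h^3 + (249022500617/390625000)*h^4
      + (1531726471/1953125)*h^5 + (7350848/15625)*h^6 + (17328/125)*h^7 + (16)*h^8"
    unfolding h by (simp only: D) algebra
  then show "-7/4 \<le> x_of s Large" "x_of s Large \<le> -42/25" using bs by linarith+
  have "x_of s Medium = (-261348472578802637639/488281250000000000000)
      + (-2436039547490255457/244140625000000000)*h + (-14151609381757653/488281250000000)*h^2
      + (59305679574461/976562500000)*h^3 + (224324906867/781250000)*h^4
      + (1479007721/3906250)*h^5 + (3644174/15625)*h^6 + (8664/125)*h^7 + (8)*h^8"
    unfolding h by (simp only: D) algebra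
  then show "-11/20 \<le> x_of s Medium" "x_of s Medium \<le> -13/25" using bs by linarith+
  have "x_of s Small = (667415131055267653361/488281250000000000000)
      + (-1379572173994842207/244140625000000000)*h + (-33735157239914903/488281250000000)*h^2
      + (-101562093384289/976562500000)*h^3 + (6144945367/781250000)*h^4 + (547817471/3906250)*h^5
      + (2092674/15625)*h^6 + (6664/125)*h^7 + (8)*h^8"
    unfolding h by (simp only: D) algebra
  then show "34/25 \<le> x_of s Small" "x_of s Small \<le> 69/50" using bs by linarith+
  have "y_of s Large = (2502355134274879/3906250000000000) + (35172499168553/3906250000000)*h
      + (-25442931443/3125000000)*h^2 + (-88899989/1562500)*h^3 + (-790323/12500)*h^4
      + (-3374/125)*h^5 + (-4)*h^6"
    unfolding h by (simp only: D) algebra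
  then show "63/100 \<le> y_of s Large" "y_of s Large \<le> 13/20" using bs by linarith+
  have "y_of s Medium = (1349160286117767653361/488281250000000000000)
      + (1747130263505157793/244140625000000000)*h + (-16131313489914903/488281250000000)*h^2
      + (-71624593384289/976562500000)*h^3 + (12394945367/781250000)*h^4 + (547817471/3906250)*h^5
      + (2092674/15625)*h^6 + (6664/125)*h^7 + (8)*h^8"
    unfolding h by (simp only: D) algebra
  then show "11/4 \<le> y_of s Medium" "y_of s Medium \<le> 139/50" using bs by linarith+
  have "y_of s Small = (667415131055267653361/488281250000000000000)
      + (-1379572173994842207/244140625000000000)*h + (-33735157239914903/488281250000000)*h^2
      + (-101562093384289/976562500000)*h^3 + (6144945367/781250000)*h^4 + (547817471/3906250)*h^5
      + (2092674/15625)*h^6 + (6664/125)*h^7 + (8)*h^8"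
    unfolding h by (simp only: D) algebra
  then show "34/25 \<le> y_of s Small" "y_of s Small \<le> 69/50" using bs by linarith+
  have "r_of s Large = (1948687053368538041/976562500000000000)
      + (319375071892653/1953125000000000)*h + (-840832753879/3906250000000)*h^2
      + (-35411854367/1562500000)*h^3 + (-253091673/3125000)*h^4 + (-2943761/31250)*h^5
      + (-5706/125)*h^6 + (-8)*h^7"
    unfolding h by (simp only: D) algebra
  then show "199/100 \<le> r_of s Large" "r_of s Large \<le> 2" using bs by linarith+
  have "r_of s Medium = (203522824540863481540081/122070312500000000000000)
      + (1900198049010600015251/244140625000000000000)*h + (8464183432007121/1907348632812500)*h^2
      + (-2372298764505333/122070312500000)*h^3 + (-151314676135387/976562500000)*h^4
      + (-848408864053/1953125000)*h^5 + (-1095887894/1953125)*h^6 + (-5781376/15625)*h^7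
      + (-15244/125)*h^8 + (-16)*h^9"
    unfolding h by (simp only: D) algebra
  then show "33/20 \<le> r_of s Medium" "r_of s Medium \<le> 42/25" using bs by linarith+
  have "r_of s Small = (159110407363118945709919/122070312500000000000000)
      + (3315389264993986734749/244140625000000000000)*h
      + (1912275274972714189/30517578125000000)*h^2 + (23457332884349083/122070312500000)*h^3
      + (424039628010387/976562500000)*h^4 + (1314003989053/1953125000)*h^5
      + (1289825394/1953125)*h^6 + (6031376/15625)*h^7 + (15244/125)*h^8 + (16)*h^9"
    unfolding h by (simp only: D) algebra
  then show "32/25 \<le> r_of s Small" "r_of s Small \<le> 33/25" using bs by linarith+
  have "a_of s = (1171804266393382791/244140625000000000) + (14006429144294153/488281250000000)*h
      + (7533426692371/976562500000)*h^2 + (-86739093367/390625000)*h^3 + (-397047423/781250)*h^4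
      + (-7324522/15625)*h^5 + (-24824/125)*h^6 + (-32)*h^7"
    unfolding h by (simp only: D) algebra
  then show "477/100 \<le> a_of s" "a_of s \<le> 483/100" using bs by linarith+
  have "b_of s = (910455793814580153361/244140625000000000000)
      + (1065567738583282793/122070312500000000)*h + (-12268252708664903/244140625000000)*h^2
      + (-49118187134289/488281250000)*h^3 + (25801195367/390625000)*h^4 + (563442471/1953125)*h^5
      + (4185348/15625)*h^6 + (13328/125)*h^7 + (16)*h^8"
    unfolding h by (simp only: D) algebra
  then show "93/25 \<le> b_of s" "b_of s \<le> 187/50" using bs by linarith+
qed

text \<open>
  The nine contacts, up to symmetry: three between a large and a small disk, three between a large
  and a medium disk, two between a small and a medium disk, one between two medium disks.
\<close>

lemma center_identities:
  fixes s :: real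
  defines "x \<equiv> x_of s" and "y \<equiv> y_of s" and "r \<equiv> r_of s" and "a \<equiv> a_of s" and "b \<equiv> b_of s" and "w
      \<equiv> 4 * s^2 - 1"
  shows "(x Large - x Small)^2 + w * (y Large - y Small)^2 = (r Large + r Small)^2"
    and "(x Large + x Small)^2 + w * (y Large + y Small)^2 = (r Large + r Small)^2"
    and "(x Large - x Small + a)^2 + w * (y Large + y Small - b)^2 = (r Large + r Small)^2"
    and "(x Large - x Medium)^2 + w * (y Large - y Medium)^2 = (r Large + r Medium)^2"
    and "(x Large + x Medium + a)^2 + w * (y Large - y Medium + b)^2 = (r Large + r Medium)^2"
    and "(x Large - x Medium + a)^2 + w * (y Large + y Medium - b)^2 = (r Large + r Medium)^2"
    and "(x Small - x Medium)^2 + w * (y Small - y Medium)^2 = (r Small + r Medium)^2"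
    and "(x Small - x Medium - a)^2 + w * (y Small + y Medium - b)^2 = (r Small + r Medium)^2"
    and "(x Medium + x Medium)^2 + w * (y Medium + y Medium - 2 * b)^2 = (r Medium + r Medium)^2"
  unfolding x_def y_def r_def a_def b_def w_def x_of.simps y_of.simps r_of.simps a_of_def b_of_def
      K_of_def
    p_of_def n_of_def M_of_def N_of_def
  by algebra+

lemma large_distance:
  fixes s :: real
  assumes "(M_of s)^2 \<le> (4 * s^2 - 1) * s^2 * (N_of s)^2"
  shows "(r_of s Large + r_of s Large)^2
    \<le> (x_of s Large + x_of s Large)^2 + (4 * s^2 - 1) * (y_of s Large + y_of s Large)^2"
proof -
  have "(x_of s Large + x_of s Large)^2 + (4 * s^2 - 1) * (y_of s Large + y_of s Large)^2
      - (r_of s Large + r_of s Large)^2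
      = 16 * s^2 * (n_of s)^2 * ((4 * s^2 - 1) * s^2 * (N_of s)^2 - (M_of s)^2)"
    unfolding x_of.simps y_of.simps r_of.simps K_of_def by algebra
  also have "\<dots> \<ge> 0" using assms by (intro mult_nonneg_nonneg) auto
  finally show ?thesis by simp
qed

lemma square_le_first:
  fixes a b c w :: real assumes "0 \<le> w" "0 \<le> c" "c \<le> \<bar>a\<bar>" shows "c^2 \<le> a^2 + w * b^2"
proof -
  have "c^2 \<le> \<bar>a\<bar>^2" using assms by (intro power_mono) auto
  moreover have "0 \<le> w * b^2" using assms by simp
  ultimately show ?thesis by simp
qed

text \<open>
  The constant is the square of \<open>8/5\<close>, so that no root of \<open>w\<close> has to be taken.
\<close>

lemma square_le_second:
  fixes a b c w :: real assumes "256/100 \<le> w" "0 \<le> c" "5 * c \<le> 8 * \<bar>b\<bar>" shows "c^2 \<le> a^2 + w * b^2"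
proof -
  have "(5 * c)^2 \<le> (8 * \<bar>b\<bar>)^2" using assms by (intro power_mono) auto
  then have "c^2 \<le> 256/100 * b^2" by (simp add: power_mult_distrib)
  also have "\<dots> \<le> w * b^2" using assms by (intro mult_right_mono) auto
  finally show ?thesis by (simp add: add_increasing)
qed

text \<open>
  No element of the group brings a disk of size \<open>k\<close> into a position where it overlaps the
  representative disk of size \<open>i\<close>. An element of the group acts by
  \<open>(X, Y) \<mapsto> (\<plusminus> X + A j, \<plusminus> Y + B l)\<close>, where \<open>j\<close> and \<open>l\<close> are both even if the signs agree and both
  odd otherwise. Only the identity is excepted, for \<open>i = k\<close>.
\<close>

definition separation :: "real \<Rightarrow> disk_size \<Rightarrow> disk_size \<Rightarrow> bool" where
  "separation s i k \<longleftrightarrow> (\<forall>b c j l. even j = (b = c) \<longrightarrow> even l = (b = c) \<longrightarrow>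
     (i, b, c, j, l) \<noteq> (k, True, True, 0, 0) \<longrightarrow>
     (r_of s i + r_of s k)^2 \<le> (x_of s i - sgn_of b * x_of s k + a_of s * of_int j)^2
       + (4 * s^2 - 1) * (y_of s i - sgn_of c * y_of s k + b_of s * of_int l)^2)"

lemma separation_sym:
  assumes "separation s i k" shows "separation s k i"
  unfolding separation_def
proof (intro allI impI)
  fix b c :: bool and j l :: int
  assume par: "even j = (b = c)" "even l = (b = c)" and ne: "(k, b, c, j, l) \<noteq> (i, True, True, 0, 0)"
  define \<epsilon> \<delta> :: int where "\<epsilon> = (if b then 1 else -1)" and "\<delta> = (if c then 1 else -1)"
  have "(r_of s i + r_of s k)^2 \<le> (x_of s i - sgn_of b * x_of s k + a_of s * of_int (- (\<epsilon> * j)))^2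
       + (4 * s^2 - 1) * (y_of s i - sgn_of c * y_of s k + b_of s * of_int (- (\<delta> * l)))^2"
    using par ne
    by (intro assms[unfolded separation_def, rule_format]) (auto simp: \<epsilon>_def \<delta>_def)
  also have "(x_of s i - sgn_of b * x_of s k + a_of s * of_int (- (\<epsilon> * j)))^2
      = (x_of s k - sgn_of b * x_of s i + a_of s * of_int j)^2"
    by (auto simp: sgn_of_def \<epsilon>_def power2_eq_square algebra_simps)
  also have "(y_of s i - sgn_of c * y_of s k + b_of s * of_int (- (\<delta> * l)))^2
      = (y_of s k - sgn_of c * y_of s i + b_of s * of_int l)^2"
    by (auto simp: sgn_of_def \<delta>_def power2_eq_square algebra_simps)
  finally show "(r_of s k + r_of s i)^2 \<le> (x_of s k - sgn_of b * x_of s i + a_of s * of_int j)^2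
       + (4 * s^2 - 1) * (y_of s k - sgn_of c * y_of s i + b_of s * of_int l)^2"
    by (simp add: add.commute)
qed

text \<open>
  Two disks of one size that differ by a translation of the lattice.
\<close>

lemma same_class_distance:
  fixes \<alpha> \<beta> r w :: real
  assumes "0 \<le> r" "r \<le> \<alpha>" "r \<le> \<beta>" "256/100 \<le> w" "even j" "even l" "(j, l) \<noteq> (0, 0)"
  shows "(r + r)^2 \<le> (\<alpha> * of_int j)^2 + w * (\<beta> * of_int l)^2"
proof -
  have two: "2 \<le> \<bar>of_int i :: real\<bar>" if "even i" "i \<noteq> 0" for i :: int
  proof -
    have "2 \<le> \<bar>i\<bar>" using that by (auto elim!: evenE)
    then show ?thesis by linarith
  qed
  show ?thesis
  proof (cases "j = 0")
    case False
    have "r * 2 \<le> \<alpha> * \<bar>of_int j\<bar>" using assms two[of j] False by (intro mult_mono) auto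
    then show ?thesis using assms by (intro square_le_first) (auto simp: abs_mult)
  next
    case True
    have "r * 2 \<le> \<beta> * \<bar>of_int l\<bar>" using assms two[of l] True by (intro mult_mono) auto
    then show ?thesis using assms by (intro square_le_second) (auto simp: abs_mult)
  qed
qed

text \<open>
  A difference vector \<open>(X, Y)\<close> of centers that lies in the cell, hence is shortest among its
  lattice translates, and is long enough for the disks not to overlap.
\<close>

definition close_pair :: "real \<Rightarrow> disk_size \<Rightarrow> disk_size \<Rightarrow> real \<Rightarrow> real \<Rightarrow> bool" where
  "close_pair s i k X Y \<longleftrightarrow> \<bar>X\<bar> \<le> a_of s \<and> \<bar>Y\<bar> \<le> b_of s \<and>
     (r_of s i + r_of s k)^2 \<le> X^2 + (4 * s^2 - 1) * Y^2"

text \<open>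
  For each pair of signs it suffices to exhibit one translate of the difference vector that lies
  in the cell. Equal positive signs are left to a separate argument because of the exceptional
  identity.
\<close>

lemma separation_intro:
  assumes w: "256/100 \<le> 4 * s^2 - 1"
    and tt: "\<And>j l. even j \<Longrightarrow> even l \<Longrightarrow> (i, j, l) \<noteq> (k, 0, 0) \<Longrightarrow>
      (r_of s i + r_of s k)^2 \<le> (x_of s i - x_of s k + a_of s * of_int j)^2
       + (4 * s^2 - 1) * (y_of s i - y_of s k + b_of s * of_int l)^2"
    and ff: "even j1" "even l1" "close_pair s i k (x_of s i + x_of s k + a_of s * of_int j1)
      (y_of s i + y_of s k + b_of s * of_int l1)"
    and ft: "odd j2" "odd l2" "close_pair s i k (x_of s i + x_of s k + a_of s * of_int j2)
      (y_of s i - y_of s k + b_of s * of_int l2)"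
    and tf: "odd j3" "odd l3" "close_pair s i k (x_of s i - x_of s k + a_of s * of_int j3)
      (y_of s i + y_of s k + b_of s * of_int l3)"
  shows "separation s i k"
  unfolding separation_def
proof (intro allI impI)
  fix b c :: bool and j l :: int
  assume par: "even j = (b = c)" "even l = (b = c)" and ne: "(i, b, c, j, l) \<noteq> (k, True, True, 0, 0)"
  have w0: "0 \<le> 4 * s^2 - 1" using w by simp
  consider "b" "c" | "\<not> b" "\<not> c" | "\<not> b" "c" | "b" "\<not> c" by blast
  then show "(r_of s i + r_of s k)^2 \<le> (x_of s i - sgn_of b * x_of s k + a_of s * of_int j)^2
       + (4 * s^2 - 1) * (y_of s i - sgn_of c * y_of s k + b_of s * of_int l)^2"
  proof cases
    case 1
    then show ?thesis using tt[of j l] par ne by (simp add: sgn_of_def)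
  next
    case 2
    then show ?thesis using lattice_distance_ge[OF _ _ _ w0, of _ _ _ j1 _ _ l1 j l] ff par
      by (simp add: sgn_of_def close_pair_def)
  next
    case 3
    then show ?thesis using lattice_distance_ge[OF _ _ _ w0, of _ _ _ j2 _ _ l2 j l] ft par
      by (simp add: sgn_of_def close_pair_def)
  next
    case 4
    then show ?thesis using lattice_distance_ge[OF _ _ _ w0, of _ _ _ j3 _ _ l3 j l] tf par
      by (simp add: sgn_of_def close_pair_def)
  qed
qed

lemma even_translates_ge:
  assumes "256/100 \<le> 4 * s^2 - 1" "close_pair s i k (x_of s i - x_of s k) (y_of s i - y_of s k)"
    "even j" "even l"
  shows "(r_of s i + r_of s k)^2 \<le> (x_of s i - x_of s k + a_of s * of_int j)^2
       + (4 * s^2 - 1) * (y_of s i - y_of s k + b_of s * of_int l)^2"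
  using lattice_distance_ge[of "r_of s i + r_of s k" "x_of s i - x_of s k" "a_of s" 0 "4 * s^2 - 1"
      "y_of s i - y_of s k" "b_of s" 0 j l] assms
  unfolding close_pair_def by simp

lemma close_pairI_eq:
  assumes "X^2 + (4 * s^2 - 1) * Y^2 = (r_of s i + r_of s k)^2" "\<bar>X\<bar> \<le> a_of s" "\<bar>Y\<bar> \<le> b_of s"
  shows "close_pair s i k X Y"
  using assms unfolding close_pair_def by simp

lemma close_pairI_first:
  assumes "256/100 \<le> 4 * s^2 - 1" "0 \<le> r_of s i + r_of s k" "r_of s i + r_of s k \<le> \<bar>X\<bar>"
    "\<bar>X\<bar> \<le> a_of s" "\<bar>Y\<bar> \<le> b_of s"
  shows "close_pair s i k X Y"
  unfolding close_pair_def using assms by (intro conjI square_le_first) linarith+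

lemma close_pairI_second:
  assumes "256/100 \<le> 4 * s^2 - 1" "0 \<le> r_of s i + r_of s k" "5 * (r_of s i + r_of s k) \<le> 8 * \<bar>Y\<bar>"
    "\<bar>X\<bar> \<le> a_of s" "\<bar>Y\<bar> \<le> b_of s"
  shows "close_pair s i k X Y"
  unfolding close_pair_def using assms by (intro conjI square_le_second)

text \<open>
  The translates in the cell are found by rounding the coordinates of the differences. Each is
  treated as a contact, or by its first or its second coordinate alone; the two large disks at
  \<open>\<plusminus> i y\<close> are the only case in which the assumption on the height enters.
\<close>

lemma separation_any:
  assumes s: "957/1000 \<le> s" "s \<le> 959/1000"
    and y: "(M_of s)^2 \<le> (4 * s^2 - 1) * s^2 * (N_of s)^2"
  shows "separation s i k"
proof -
  note B = center_bounds[OF s] and T = center_identities[of s]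
  have w: "256/100 \<le> 4 * s^2 - 1"
    using power_mono[OF s(1), of 2] by (simp add: power_divide)
  have LL: "separation s Large Large"
  proof (rule separation_intro[OF w])
    fix j l :: int assume jl: "even j" "even l" "(Large, j, l) \<noteq> (Large, 0, 0)"
    show "(r_of s Large + r_of s Large)^2 \<le> (x_of s Large - x_of s Large + a_of s * of_int j)^2
       + (4 * s^2 - 1) * (y_of s Large - y_of s Large + b_of s * of_int l)^2"
      using same_class_distance[of "r_of s Large" "a_of s" "b_of s" "4 * s^2 - 1" j l] B w jl by simp
  next
    show "close_pair s Large Large (x_of s Large + x_of s Large + a_of s * of_int (0))
        (y_of s Large + y_of s Large + b_of s * of_int (0))"
      using large_distance[OF y] B unfolding close_pair_def by simp
    show "close_pair s Large Large (x_of s Large + x_of s Large + a_of s * of_int (1))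
        (y_of s Large - y_of s Large + b_of s * of_int (-1))"
      by (rule close_pairI_second[OF w]) (use B in simp_all)
    show "close_pair s Large Large (x_of s Large - x_of s Large + a_of s * of_int (-1))
        (y_of s Large + y_of s Large + b_of s * of_int (-1))"
      by (rule close_pairI_first[OF w]) (use B in simp_all)
  qed simp_all
  have SS: "separation s Small Small"
  proof (rule separation_intro[OF w])
    fix j l :: int assume jl: "even j" "even l" "(Small, j, l) \<noteq> (Small, 0, 0)"
    show "(r_of s Small + r_of s Small)^2 \<le> (x_of s Small - x_of s Small + a_of s * of_int j)^2
       + (4 * s^2 - 1) * (y_of s Small - y_of s Small + b_of s * of_int l)^2"
      using same_class_distance[of "r_of s Small" "a_of s" "b_of s" "4 * s^2 - 1" j l] B w jl by simp
  next
    show "close_pair s Small Small (x_of s Small + x_of s Small + a_of s * of_int (0))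
        (y_of s Small + y_of s Small + b_of s * of_int (0))"
      by (rule close_pairI_second[OF w]) (use B in simp_all)
    show "close_pair s Small Small (x_of s Small + x_of s Small + a_of s * of_int (-1))
        (y_of s Small - y_of s Small + b_of s * of_int (-1))"
      by (rule close_pairI_second[OF w]) (use B in simp_all)
    show "close_pair s Small Small (x_of s Small - x_of s Small + a_of s * of_int (-1))
        (y_of s Small + y_of s Small + b_of s * of_int (-1))"
      by (rule close_pairI_first[OF w]) (use B in simp_all)
  qed simp_all
  have MM: "separation s Medium Medium"
  proof (rule separation_intro[OF w])
    fix j l :: int assume jl: "even j" "even l" "(Medium, j, l) \<noteq> (Medium, 0, 0)"
    show "(r_of s Medium + r_of s Medium)^2 \<le> (x_of s Medium - x_of s Medium + a_of s * of_int j)^2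
       + (4 * s^2 - 1) * (y_of s Medium - y_of s Medium + b_of s * of_int l)^2"
      using same_class_distance[of "r_of s Medium" "a_of s" "b_of s" "4 * s^2 - 1" j l] B w jl by simp
  next
    show "close_pair s Medium Medium (x_of s Medium + x_of s Medium + a_of s * of_int (0))
        (y_of s Medium + y_of s Medium + b_of s * of_int (-2))"
      by (rule close_pairI_eq) (use T(9) B in \<open>simp_all add: algebra_simps\<close>)
    show "close_pair s Medium Medium (x_of s Medium + x_of s Medium + a_of s * of_int (1))
        (y_of s Medium - y_of s Medium + b_of s * of_int (-1))"
      by (rule close_pairI_second[OF w]) (use B in simp_all)
    show "close_pair s Medium Medium (x_of s Medium - x_of s Medium + a_of s * of_int (-1))
        (y_of s Medium + y_of s Medium + b_of s * of_int (-1))"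
      by (rule close_pairI_first[OF w]) (use B in simp_all)
  qed simp_all
  have LS: "separation s Large Small"
  proof (rule separation_intro[OF w])
    fix j l :: int assume jl: "even j" "even l" "(Large, j, l) \<noteq> (Small, 0, 0)"
    show "(r_of s Large + r_of s Small)^2 \<le> (x_of s Large - x_of s Small + a_of s * of_int j)^2
       + (4 * s^2 - 1) * (y_of s Large - y_of s Small + b_of s * of_int l)^2"
      by (rule even_translates_ge[OF w close_pairI_eq[OF T(1)] jl(1,2)]; use B in linarith)
  next
    show "close_pair s Large Small (x_of s Large + x_of s Small + a_of s * of_int (0))
        (y_of s Large + y_of s Small + b_of s * of_int (0))"
      by (rule close_pairI_eq) (use T(2) B in \<open>simp_all add: algebra_simps\<close>)
    show "close_pair s Large Small (x_of s Large + x_of s Small + a_of s * of_int (1))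
        (y_of s Large - y_of s Small + b_of s * of_int (1))"
      by (rule close_pairI_first[OF w]) (use B in simp_all)
    show "close_pair s Large Small (x_of s Large - x_of s Small + a_of s * of_int (1))
        (y_of s Large + y_of s Small + b_of s * of_int (-1))"
      by (rule close_pairI_eq) (use T(3) B in \<open>simp_all add: algebra_simps\<close>)
  qed simp_all
  have LM: "separation s Large Medium"
  proof (rule separation_intro[OF w])
    fix j l :: int assume jl: "even j" "even l" "(Large, j, l) \<noteq> (Medium, 0, 0)"
    show "(r_of s Large + r_of s Medium)^2 \<le> (x_of s Large - x_of s Medium + a_of s * of_int j)^2
       + (4 * s^2 - 1) * (y_of s Large - y_of s Medium + b_of s * of_int l)^2"
      by (rule even_translates_ge[OF w close_pairI_eq[OF T(4)] jl(1,2)]; use B in linarith)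
  next
    show "close_pair s Large Medium (x_of s Large + x_of s Medium + a_of s * of_int (0))
        (y_of s Large + y_of s Medium + b_of s * of_int (0))"
      by (rule close_pairI_second[OF w]) (use B in simp_all)
    show "close_pair s Large Medium (x_of s Large + x_of s Medium + a_of s * of_int (1))
        (y_of s Large - y_of s Medium + b_of s * of_int (1))"
      by (rule close_pairI_eq) (use T(5) B in \<open>simp_all add: algebra_simps\<close>)
    show "close_pair s Large Medium (x_of s Large - x_of s Medium + a_of s * of_int (1))
        (y_of s Large + y_of s Medium + b_of s * of_int (-1))"
      by (rule close_pairI_eq) (use T(6) B in \<open>simp_all add: algebra_simps\<close>)
  qed simp_all
  have SM: "separation s Small Medium"
  proof (rule separation_intro[OF w])
    fix j l :: int assume jl: "even j" "even l" "(Small, j, l) \<noteq> (Medium, 0, 0)"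
    show "(r_of s Small + r_of s Medium)^2 \<le> (x_of s Small - x_of s Medium + a_of s * of_int j)^2
       + (4 * s^2 - 1) * (y_of s Small - y_of s Medium + b_of s * of_int l)^2"
      by (rule even_translates_ge[OF w close_pairI_eq[OF T(7)] jl(1,2)]; use B in linarith)
  next
    show "close_pair s Small Medium (x_of s Small + x_of s Medium + a_of s * of_int (0))
        (y_of s Small + y_of s Medium + b_of s * of_int (-2))"
      by (rule close_pairI_second[OF w]) (use B in simp_all)
    show "close_pair s Small Medium (x_of s Small + x_of s Medium + a_of s * of_int (-1))
        (y_of s Small - y_of s Medium + b_of s * of_int (1))"
      by (rule close_pairI_first[OF w]) (use B in simp_all)
    show "close_pair s Small Medium (x_of s Small - x_of s Medium + a_of s * of_int (-1))
        (y_of s Small + y_of s Medium + b_of s * of_int (-1))"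
      by (rule close_pairI_eq) (use T(8) B in \<open>simp_all add: algebra_simps\<close>)
  qed simp_all
  show ?thesis
    by (cases i; cases k) (simp_all add: LL SS MM LS LM SM separation_sym)
qed

section \<open>Angles and lengths of the construction\<close>

lemma K_of_pos:
  assumes "0 < s" "s < 1" shows "0 < K_of s"
  unfolding K_of_def using n_of_pos[of s] M_of_pos[of s] assms by simp

lemma cos_sin_arccos:
  fixes c d :: real
  assumes "c^2 + d^2 = 1" "0 \<le> d"
  shows "cos (arccos c) = c" "sin (arccos c) = d"
proof -
  have c: "\<bar>c\<bar> \<le> 1"
  proof (rule power2_le_imp_le)
    have "c^2 \<le> 1" using assms(1) zero_le_power2[of d] by linarith
    then show "\<bar>c\<bar>^2 \<le> 1^2" by simp
  qed simp
  then show "cos (arccos c) = c" by (simp add: cos_arccos_abs)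
  have "sin (arccos c) = sqrt (1 - c^2)" using c by (simp add: sin_arccos_abs)
  also have "\<dots> = d" using assms by (intro real_sqrt_unique) auto
  finally show "sin (arccos c) = d" .
qed

lemma construction_angles_lengths:
  assumes s: "0 < s" "s < 1" "1 < 2 * s^2" and N: "0 < N_of s"
  defines "q \<equiv> q_of s" and "w \<equiv> w_of s"
  shows "cos (\<beta>_angle q) = 1 / (2 * s)" and "sin (\<beta>_angle q) = w / (2 * s)"
    and "cos (\<gamma>_angle q) = N_of s / (2 * M_of s)" and "sin (\<gamma>_angle q) = n_of s * s * w / (2 * M_of s)"
    and "x53 q = (2 * (M_of s)^2 - (N_of s)^2) / (n_of s * M_of s)"
    and "y53 q = s * w * N_of s / M_of s"
    and "D53 q = n_of s * s^2 * w^2 / M_of s"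
proof -
  define p n M N where "p = p_of s" "n = n_of s" "M = M_of s" "N = N_of s"
  note d = this
  have pos: "0 < n" "0 < M" "0 < p" "0 < N" "0 < w" "w^2 = 4 * s^2 - 1"
    using n_of_pos[of s] M_of_pos[of s] s N w_of_sq[OF s(3)] by (simp_all add: d w_def p_of_def)
  have P: "p = 2 * s^2 - 1" "n = 2 + s - 2 * s^2" "M = 2 * s^4 - s^3 - 2 * s^2 + s + 1"
     "N = 2 * s^3 + 3 * s^2 - 2 * s - 2"
    by (simp_all add: d p_of_def n_of_def M_of_def N_of_def)
  have med: "med_radius q = p" using med_radius_q_of[OF s] by (simp add: d q_def)
  have S: "1 + p = 2 * s^2" "p + q = 2 * p / n" "1 + q = 2 * M / n"
    using radii_sums[of s] pos(1) by (simp_all add: d q_def)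
  have N4: "N^2 + (n * s * w)^2 = 4 * M^2"
    unfolding power_mult_distrib pos(6) unfolding P by algebra
  have "\<beta>_angle q = arccos (1 / (2 * s))"
  proof -
    have e: "s^4 * n^2 + p^2 - M^2 = s * p * n" unfolding P by algebra
    have "((1 + p)^2 + (p + q)^2 - (1 + q)^2) / (2 * (1 + p) * (p + q))
        = (s^4 * n^2 + p^2 - M^2) / (2 * s^2 * p * n)"
      unfolding S using pos s by (simp add: field_simps power2_eq_square power4_eq_xxxx)
    also have "\<dots> = 1 / (2 * s)" unfolding e using pos s by (simp add: field_simps power2_eq_square)
    finally show ?thesis by (simp add: \<beta>_angle_def Let_def med triangle_angle_def)
  qed
  moreover have "(1 / (2 * s))^2 + (w / (2 * s))^2 = 1"
    unfolding power_divide pos(6) using s by (simp add: field_simps power2_eq_square)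
  ultimately show "cos (\<beta>_angle q) = 1 / (2 * s)" "sin (\<beta>_angle q) = w / (2 * s)"
    using cos_sin_arccos[of "1 / (2 * s)" "w / (2 * s)"] pos s by simp_all
  have "\<gamma>_angle q = arccos (N / (2 * M))"
  proof -
    have e: "M^2 + p^2 - s^4 * n^2 = p * N" unfolding P by algebra
    have "((1 + q)^2 + (p + q)^2 - (1 + p)^2) / (2 * (1 + q) * (p + q))
        = (M^2 + p^2 - s^4 * n^2) / (2 * M * p)"
      unfolding S using pos s by (simp add: field_simps power2_eq_square power4_eq_xxxx)
    also have "\<dots> = N / (2 * M)" unfolding e using pos s by (simp add: field_simps)
    finally show ?thesis by (simp add: \<gamma>_angle_def Let_def med triangle_angle_def)
  qed
  moreover have "(N / (2 * M))^2 + (n * s * w / (2 * M))^2 = 1"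
    unfolding power_divide add_divide_distrib[symmetric] N4 using pos by (simp add: power_mult_distrib)
  ultimately show "cos (\<gamma>_angle q) = N_of s / (2 * M_of s)" "sin (\<gamma>_angle q)
      = n_of s * s * w / (2 * M_of s)"
    using cos_sin_arccos[of "N / (2 * M)" "n * s * w / (2 * M)"] pos s by (simp_all add: d)
  have R: "p * q * (1 + p + q) = (p * s * w / n)^2" using radii_product[OF s] by (simp add: d
      q_def w_def)
  have x: "x53 q = n * s^2 * w^2 / M - 2 * M / n"
  proof -
    have "x53 q = 8 * (p * q * (1 + p + q)) / ((p + q)^2 * (1 + q)) - (1 + q)"
      by (simp add: x53_def Let_def med mult.assoc)
    also have "\<dots> = n * s^2 * w^2 / M - 2 * M / n"
      unfolding R unfolding S using pos s by (simp add: field_simps power2_eq_square)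
    finally show ?thesis .
  qed
  have "N^2 = 4 * M^2 - n^2 * s^2 * w^2" using N4 by (simp add: power_mult_distrib)
  then have x2: "x53 q = (2 * M^2 - N^2) / (n * M)"
    unfolding x using pos by (simp add: field_simps power2_eq_square)
  then show "x53 q = (2 * (M_of s)^2 - (N_of s)^2) / (n_of s * M_of s)" by (simp add: d)
  have "D53 q = x53 q + (1 + q)" by (simp add: D53_def)
  then show "D53 q = n_of s * s^2 * w^2 / M_of s" unfolding x S by (simp add: d)
  have "(1 + q)^2 - (x53 q)^2 = (s * w * N / M)^2"
  proof -
    have "(2 * M^2)^2 - (2 * M^2 - N^2)^2 = n^2 * (s * w * N)^2"
      using N4 by algebra
    then show ?thesis unfolding x2 S using pos by (simp add: field_simps power2_eq_square)
  qed
  then have "y53 q = s * w * N / M" unfolding y53_def using pos s by (simp add: real_sqrt_unique)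
  then show "y53 q = s * w * N_of s / M_of s" by (simp add: d)
qed

text \<open>
  The direction of the first axis of the cell; multiplication by it turns the rotated frame back.
\<close>

definition frame :: "real \<Rightarrow> complex" where "frame q = cis (- \<beta>_angle q)"

text \<open>
  The representative center of each size in the rotated frame.
\<close>

definition center :: "real \<Rightarrow> disk_size \<Rightarrow> complex" where
  "center s i = Complex (x_of s i / K_of s) (w_of s * y_of s i / K_of s)"

lemma frame_mult:
  assumes s: "0 < s" "s < 1" "1 < 2 * s^2" and N: "0 < N_of s"
  shows "frame (q_of s) * Complex X Y = Complex ((X
      + w_of s * Y) / (2 * s)) ((Y - w_of s * X) / (2 * s))"
proof -
  have "frame (q_of s) = Complex (1 / (2 * s)) (- (w_of s / (2 * s)))"
    using construction_angles_lengths(1,2)[OF s N] by (simp add: frame_def complex_eq_iff)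
  then show ?thesis by (simp add: complex_eq_iff add_divide_distrib diff_divide_distrib)
qed

lemma centers_in_frame:
  assumes s: "0 < s" "s < 1" "1 < 2 * s^2" and N: "0 < N_of s"
  defines "q \<equiv> q_of s"
  shows "\<i> * of_real (y53 q) = frame q * center s Large"
    and "of_real (x53 q) = frame q * center s Small"
    and "of_real (x53 q) + of_real (p_of s + q) * cis (\<gamma>_angle q) = frame q * center s Medium"
proof -
  define p n M N w where "p = p_of s" "n = n_of s" "M = M_of s" "N = N_of s" "w = w_of s"
  note d = this
  have pos: "0 < n" "0 < M" "0 < p" "w^2 = 4 * s^2 - 1" "s \<noteq> 0"
    using n_of_pos[of s] M_of_pos[of s] s w_of_sq[OF s(3)] by (simp_all add: d p_of_def)
  have P: "p = 2 * s^2 - 1" "n = 2 + s - 2 * s^2" "M = 2 * s^4 - s^3 - 2 * s^2 + s + 1"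
     "N = 2 * s^3 + 3 * s^2 - 2 * s - 2"
    by (simp_all add: d p_of_def n_of_def M_of_def N_of_def)
  have pq: "p + q = 2 * p / n" using radii_sums[of s] pos(1) by (simp add: d q_def)
  have ww: "w * (w * t) = (4 * s^2 - 1) * t" for t using pos(4) by (simp add: power2_eq_square
      mult.assoc[symmetric])
  have K: "K_of s = 2 * s * n * M" by (simp add: K_of_def d)
  note G = construction_angles_lengths[OF s N, folded q_def]
  show "\<i> * of_real (y53 q) = frame q * center s Large"
    unfolding center_def q_def frame_mult[OF s N] unfolding q_def[symmetric] G K x_of.simps
        y_of.simps d[symmetric]
    using pos by (simp add: complex_eq_iff field_simps ww power2_eq_square)
  show "of_real (x53 q) = frame q * center s Small"
    unfolding center_def q_def frame_mult[OF s N] unfolding q_def[symmetric] G K x_of.simps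
        y_of.simps d[symmetric]
    using pos by (simp add: complex_eq_iff field_simps ww power2_eq_square)
  have e1: "2 * s * M - 2 * s - 1 + (4 * s^2 - 1) * p = 2 * s^2 * N" unfolding P by algebra
  have e2: "p - 2 * s * M + 2 * s + 1 = 2 * s^3 * n" unfolding P by algebra
  show "of_real (x53 q) + of_real (p_of s + q) * cis (\<gamma>_angle q) = frame q * center s Medium"
  proof (rule complex_eqI)
    have "Re (of_real (x53 q) + of_real (p + q) * cis (\<gamma>_angle q)) = (2 * M^2 - N^2) / (n * M)
        + p * N / (n * M)"
      using pos by (simp add: G pq d[symmetric])
    also have "\<dots> = ((2 * M^2 - N^2 + 2 * p * (2 * s * M - 2 * s - 1))
        + (4 * s^2 - 1) * (2 * M^2 - N^2 + 2 * p^2)) / (2 * s * (2 * s * n * M))"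
    proof -
      have "(2 * M^2 - N^2 + 2 * p * (2 * s * M - 2 * s - 1)) + (4 * s^2 - 1) * (2 * M^2 - N^2
          + 2 * p^2)
        = 4 * s^2 * (2 * M^2 - N^2 + p * N)" using e1 by algebra
      then show ?thesis using pos by (simp add: field_simps power2_eq_square)
    qed
    also have "\<dots> = Re (frame q * center s Medium)"
      unfolding center_def q_def frame_mult[OF s N] unfolding K x_of.simps y_of.simps d[symmetric]
      using pos by (simp add: add_divide_distrib[symmetric] ww)
    finally show "Re (of_real (x53 q) + of_real (p_of s
        + q) * cis (\<gamma>_angle q)) = Re (frame q * center s Medium)"
      by (simp add: d)
    have "Im (of_real (x53 q) + of_real (p + q) * cis (\<gamma>_angle q)) = p * s * w / M"
      using pos by (simp add: G pq d[symmetric])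
    also have "\<dots> = w * ((2 * M^2 - N^2 + 2 * p^2) - (2 * M^2 - N^2
        + 2 * p * (2 * s * M - 2 * s - 1))) / (2 * s * (2 * s * n * M))"
    proof -
      have "(2 * M^2 - N^2 + 2 * p^2) - (2 * M^2 - N^2
          + 2 * p * (2 * s * M - 2 * s - 1)) = 4 * s^3 * n * p"
        using e2 by algebra
      then show ?thesis using pos by (simp add: field_simps power2_eq_square power3_eq_cube)
    qed
    also have "\<dots> = Im (frame q * center s Medium)"
      unfolding center_def q_def frame_mult[OF s N] unfolding K x_of.simps y_of.simps d[symmetric]
      using pos by (simp add: field_simps)
    finally show "Im (of_real (x53 q) + of_real (p_of s
        + q) * cis (\<gamma>_angle q)) = Im (frame q * center s Medium)"
      by (simp add: d)
  qed
qed

text \<open>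
  In the rotated frame the glide reflection is \<open>(X, Y) \<mapsto> (- X - A, Y + B)\<close>.
\<close>

lemma glide53_frame:
  assumes s: "0 < s" "s < 1" "1 < 2 * s^2" and N: "0 < N_of s"
  shows "glide53 (q_of s) (frame (q_of s) * Complex X Y) =
    frame (q_of s) * Complex (- X - a_of s / K_of s) (Y + w_of s * b_of s / K_of s)"
proof -
  define q e \<beta> where "q = q_of s" "e = frame q" "\<beta> = \<beta>_angle q"
  note d = this
  define p n M N w where "p = p_of s" "n = n_of s" "M = M_of s" "N = N_of s" "w = w_of s"
  note d2 = this
  have pos: "0 < n" "0 < M" "0 < p" "w^2 = 4 * s^2 - 1" "s \<noteq> 0"
    using n_of_pos[of s] M_of_pos[of s] s w_of_sq[OF s(3)] by (simp_all add: d2 p_of_def)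
  have P: "p = 2 * s^2 - 1" "n = 2 + s - 2 * s^2" "M = 2 * s^4 - s^3 - 2 * s^2 + s + 1"
     "N = 2 * s^3 + 3 * s^2 - 2 * s - 2"
    by (simp_all add: d2 p_of_def n_of_def M_of_def N_of_def)
  have K: "K_of s = 2 * s * n * M" by (simp add: K_of_def d2)
  note G = construction_angles_lengths[OF s N, folded d(1) d2, folded d(3)]
  have cis: "cis (pi - 2 * \<beta>) = - (e * e)"
    by (simp add: complex_eq_iff d frame_def cos_double sin_double cos_diff sin_diff power2_eq_square)
  have ee: "e * cnj e = 1" by (simp add: d frame_def cis_cnj cis_mult)
  have fr: "x / M * c + y / M * c' = (x * c
      + y * c') / M" for x y c c' by (simp add: add_divide_distrib)
  have A: "a_of s / K_of s = D53 q * cos \<beta> + y53 q * sin \<beta>"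
  proof -
    have "p * w^2 = (n * s^2 * w^2) * (1 / (2 * s)) + s * w * N * (w / (2 * s))"
      using pos(5) by (simp add: field_simps) (simp add: P, algebra)
    then have "p * w^2 / M = (n * s^2 * w^2 / M) * (1 / (2 * s)) + s * w * N / M * (w / (2 * s))"
      unfolding fr by simp
    moreover have "a_of s / K_of s = p * w^2 / M"
      unfolding a_of_def K pos(4)[symmetric] d2[symmetric] using pos by (simp add: field_simps)
    ultimately show ?thesis unfolding G by simp
  qed
  have B: "w_of s * b_of s / K_of s = y53 q * cos \<beta> + D53 q * sin \<beta>"
  proof -
    have "w * p * (1 + s * n) = s * w * N * (1 / (2 * s)) + n * s^2 * w^2 * (w / (2 * s))"
    proof -
      have "2 * p * (1 + s * n) = N + n * s * (4 * s^2 - 1)" unfolding P by algebra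
      then have "2 * (w * p * (1 + s * n)) = w * N + n * s * w^2 * w" unfolding pos(4) by algebra
      then show ?thesis using pos(5) by (simp add: field_simps power2_eq_square)
    qed
    then have "w * p * (1 + s * n) / M = s * w * N / M * (1 / (2 * s))
        + (n * s^2 * w^2 / M) * (w / (2 * s))"
      unfolding fr by simp
    moreover have "w_of s * b_of s / K_of s = w * p * (1 + s * n) / M"
      unfolding b_of_def K d2[symmetric] using pos by (simp add: field_simps)
    ultimately show ?thesis unfolding G by simp
  qed
  have off: "\<i> * of_real (y53 q) + of_real (D53 q) * - (e * e)
      = e * Complex (- (a_of s / K_of s)) (w_of s * b_of s / K_of s)"
  proof -
    have "cnj e * (\<i> * of_real (y53 q)) - of_real (D53 q) * e
        = Complex (- (a_of s / K_of s)) (w_of s * b_of s / K_of s)"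
      unfolding A B by (simp add: complex_eq_iff d frame_def algebra_simps)
    then have "e * (cnj e * (\<i> * of_real (y53 q)) - of_real (D53 q) * e)
        = e * Complex (- (a_of s / K_of s)) (w_of s * b_of s / K_of s)" by simp
    moreover have "e * (cnj e * (\<i> * of_real (y53 q)) - of_real (D53 q) * e)
        = (e * cnj e) * (\<i> * of_real (y53 q))
            + of_real (D53 q) * - (e * e)" by (simp add: algebra_simps)
    ultimately show ?thesis using ee by simp
  qed
  have "glide53 q (e * Complex X Y) = - (e * e) * cnj (e * Complex X Y)
      + (\<i> * of_real (y53 q) + of_real (D53 q) * - (e * e))"
    unfolding glide53_def by (simp only: cis d(3)[symmetric] add.assoc)
  also have "- (e * e) * cnj (e * Complex X Y) = (e * cnj e) * (e * Complex (- X) Y)"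
    by (simp add: complex_eq_iff algebra_simps)
  finally show ?thesis unfolding off ee d[symmetric]
    by (simp add: complex_eq_iff algebra_simps)
qed

section \<open>Orbits of the symmetry group\<close>

lemma half_turn_Bij: "half_turn \<in> carrier (BijGroup UNIV)"
proof -
  have "bij half_turn" by (rule bij_betw_byWitness[where f' = half_turn]) (auto simp: half_turn_def)
  then show ?thesis by (simp add: BijGroup_def Bij_def)
qed

text \<open>
  The inverse of the glide reflection: the translation is undone, then the linear part, an
  involution, is applied again.
\<close>

definition glide_inv :: "real \<Rightarrow> complex \<Rightarrow> complex" where
  "glide_inv q z = cis (pi - 2 * \<beta>_angle q) * cnj (z - (\<i> * of_real (y53 q)
     + of_real (D53 q) * cis (pi - 2 * \<beta>_angle q)))"

lemma glide53_inverse: "glide53 q (glide_inv q z) = z" "glide_inv q (glide53 q z) = z"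
proof -
  have c: "cis t * (cnj (cis t) * a) = a" for t a by (simp add: cis_cnj cis_mult mult.assoc[symmetric])
  show "glide53 q (glide_inv q z) = z" "glide_inv q (glide53 q z) = z"
    unfolding glide53_def glide_inv_def by (simp_all add: c add.assoc del: cis_cnj)
qed

lemma glide53_Bij: "glide53 q \<in> carrier (BijGroup UNIV)" "glide_inv q \<in> carrier (BijGroup UNIV)"
proof -
  have "bij (glide53 q)" "bij (glide_inv q)"
    by (rule bij_betw_byWitness[where f' = "glide_inv q"], auto simp: glide53_inverse)
      (rule bij_betw_byWitness[where f' = "glide53 q"], auto simp: glide53_inverse)
  then show "glide53 q \<in> carrier (BijGroup UNIV)" "glide_inv q \<in> carrier (BijGroup UNIV)"
    by (simp_all add: BijGroup_def Bij_def)
qed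

lemma BijGroup_mult:
  assumes "f \<in> carrier (BijGroup UNIV)" "g \<in> carrier (BijGroup UNIV)"
  shows "(f \<otimes>\<^bsub>BijGroup UNIV\<^esub> g) z = f (g z)"
  using assms by (simp add: BijGroup_def compose_def)

lemma inv_glide53: "inv\<^bsub>BijGroup UNIV\<^esub> (glide53 q) = glide_inv q"
proof (rule group.inv_equality[OF group_BijGroup])
  show "glide_inv q \<otimes>\<^bsub>BijGroup UNIV\<^esub> glide53 q = \<one>\<^bsub>BijGroup UNIV\<^esub>"
    by (rule ext) (simp add: BijGroup_mult glide53_Bij glide53_inverse, simp add: BijGroup_def)
qed (rule glide53_Bij)+

lemma inv_half_turn: "inv\<^bsub>BijGroup UNIV\<^esub> half_turn = half_turn"
proof (rule group.inv_equality[OF group_BijGroup])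
  show "half_turn \<otimes>\<^bsub>BijGroup UNIV\<^esub> half_turn = \<one>\<^bsub>BijGroup UNIV\<^esub>"
    by (rule ext) (simp add: BijGroup_mult half_turn_Bij, simp add: BijGroup_def half_turn_def)
qed (rule half_turn_Bij)+

lemma G53_carrier: "G53 q \<subseteq> carrier (BijGroup UNIV)"
  unfolding G53_def
  by (rule group.generate_incl[OF group_BijGroup]) (simp add: half_turn_Bij glide53_Bij)

lemma orbit53_closed:
  assumes "z \<in> orbit53 q z0"
  shows "half_turn z \<in> orbit53 q z0" "glide53 q z \<in> orbit53 q z0" "glide_inv q z \<in> orbit53 q z0"
proof -
  obtain g where g: "g \<in> G53 q" "z = g z0" using assms unfolding orbit53_def by blast
  have gc: "g \<in> carrier (BijGroup UNIV)" using g G53_carrier by blast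
  have step: "f z \<in> orbit53 q z0" if "f \<in> G53 q" for f
  proof -
    have "f \<otimes>\<^bsub>BijGroup UNIV\<^esub> g \<in> G53 q" using that g unfolding G53_def by (intro generate.eng)
    moreover have "(f \<otimes>\<^bsub>BijGroup UNIV\<^esub> g) z0 = f z"
      using that G53_carrier gc g by (subst BijGroup_mult) auto
    ultimately show ?thesis unfolding orbit53_def by (metis image_eqI)
  qed
  show "half_turn z \<in> orbit53 q z0" "glide53 q z \<in> orbit53 q z0"
    by (intro step; simp add: G53_def generate.incl)+
  have "glide_inv q \<in> G53 q" unfolding G53_def inv_glide53[symmetric] by (intro generate.inv) simp
  then show "glide_inv q z \<in> orbit53 q z0" by (rule step)
qed

lemma orbit53_self: "z \<in> orbit53 q z"
proof -
  have "\<one>\<^bsub>BijGroup UNIV\<^esub> \<in> G53 q" unfolding G53_def by (rule generate.one)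
  moreover have "\<one>\<^bsub>BijGroup UNIV\<^esub> z = z" by (simp add: BijGroup_def)
  ultimately show ?thesis unfolding orbit53_def by (metis image_eqI)
qed

lemma orbit53_subset:
  assumes "z0 \<in> T"
    and "\<And>z. z \<in> T \<Longrightarrow> half_turn z \<in> T" "\<And>z. z \<in> T \<Longrightarrow> glide53 q z \<in> T" "\<And>z. z \<in> T \<Longrightarrow> glide_inv q z \<in> T"
  shows "orbit53 q z0 \<subseteq> T"
proof -
  have "\<forall>z\<in>T. g z \<in> T" if "g \<in> G53 q" for g
    using that unfolding G53_def
  proof (induction rule: generate.induct)
    case one
    then show ?case by (simp add: BijGroup_def)
  next
    case (incl h)
    then show ?case using assms by auto
  next
    case (inv h)
    then consider "h = half_turn" | "h = glide53 q" by blast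
    then show ?case by cases (auto simp only: inv_half_turn inv_glide53 intro: assms(2,4))
  next
    case (eng h1 h2)
    then have "h1 \<in> carrier (BijGroup UNIV)" "h2 \<in> carrier (BijGroup UNIV)"
      using G53_carrier[of q] unfolding G53_def by auto
    then show ?case using eng.IH by (simp add: BijGroup_mult)
  qed
  then show ?thesis using assms(1) unfolding orbit53_def by auto
qed

text \<open>
  The square of the glide is the vertical translation by \<open>2 B\<close>; the square of its product with the
  half-turn is the horizontal translation by \<open>2 A\<close>.
\<close>

lemma orbit53_eq:
  assumes gl: "\<And>X Y. glide53 q (e * Complex X Y) = e * Complex (- X - A) (Y + B)"
  shows "orbit53 q (e * Complex X Y) =
    {e * Complex (sgn_of b * X + A * of_int j) (sgn_of c * Y + B * of_int l) | b c j l.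
      even j = (b = c) \<and> even l = (b = c)}" (is "_ = ?O")
proof (rule subset_antisym)
  define pt where "pt = (\<lambda>X Y. e * Complex X Y)"
  have h: "half_turn (pt X Y) = pt (- X) (- Y)" for X Y
    by (simp add: half_turn_def pt_def complex_eq_iff algebra_simps)
  have g: "glide53 q (pt X Y) = pt (- X - A) (Y + B)" for X Y by (simp add: gl pt_def)
  have gi: "glide_inv q (pt X Y) = pt (- X - A) (Y - B)" for X Y
    using glide53_inverse(2)[of q "pt (- X - A) (Y - B)"] by (simp add: g)
  have inO: "pt (sgn_of b * X + A * of_int j) (sgn_of c * Y + B * of_int l) \<in> ?O"
    if "even j = (b = c)" "even l = (b = c)" for b c j l using that unfolding pt_def by blast
  show "orbit53 q (e * Complex X Y) \<subseteq> ?O"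
  proof (rule orbit53_subset)
    show "e * Complex X Y \<in> ?O" using inO[of 0 True True 0] by (simp add: pt_def sgn_of_def)
  next
    fix z assume "z \<in> ?O"
    then obtain b c j l where z: "z = pt (sgn_of b * X + A * of_int j) (sgn_of c * Y + B * of_int l)"
      and p: "even j = (b = c)" "even l = (b = c)" unfolding pt_def by blast
    have "half_turn z = pt (sgn_of (\<not> b) * X + A * of_int (- j)) (sgn_of (\<not> c) * Y + B * of_int (- l))"
      unfolding z h by (rule arg_cong2[of _ _ _ _ pt]) (simp_all add: sgn_of_def)
    also have "\<dots> \<in> ?O" using p by (intro inO) auto
    finally show "half_turn z \<in> ?O" .
    have "glide53 q z = pt (sgn_of (\<not> b) * X + A * of_int (- j - 1)) (sgn_of c * Y + B * of_int (l
        + 1))"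
      unfolding z g by (rule arg_cong2[of _ _ _ _ pt]) (simp_all add: sgn_of_def algebra_simps)
    also have "\<dots> \<in> ?O" using p by (intro inO) auto
    finally show "glide53 q z \<in> ?O" .
    have "glide_inv q z = pt (sgn_of (\<not> b) * X + A * of_int (- j - 1)) (sgn_of c * Y
        + B * of_int (l - 1))"
      unfolding z gi by (rule arg_cong2[of _ _ _ _ pt]) (simp_all add: sgn_of_def algebra_simps)
    also have "\<dots> \<in> ?O" using p by (intro inO) auto
    finally show "glide_inv q z \<in> ?O" .
  qed
  let ?Z = "orbit53 q (e * Complex X Y)"
  have ch: "pt (- X') (- Y') \<in> ?Z" if "pt X' Y' \<in> ?Z" for X' Y'
    using orbit53_closed(1)[OF that] unfolding h .
  have cg: "pt (- X' - A) (Y' + B) \<in> ?Z" if "pt X' Y' \<in> ?Z" for X' Y'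
    using orbit53_closed(2)[OF that] unfolding g .
  have ci: "pt (- X' - A) (Y' - B) \<in> ?Z" if "pt X' Y' \<in> ?Z" for X' Y'
    using orbit53_closed(3)[OF that] unfolding gi .
  have up: "pt X' (Y' + 2 * B) \<in> ?Z" if "pt X' Y' \<in> ?Z" for X' Y'
    using cg[OF cg[OF that]] by (simp add: algebra_simps)
  have down: "pt X' (Y' - 2 * B) \<in> ?Z" if "pt X' Y' \<in> ?Z" for X' Y'
    using ci[OF ci[OF that]] by (simp add: algebra_simps)
  have right: "pt (X' + 2 * A) Y' \<in> ?Z" if "pt X' Y' \<in> ?Z" for X' Y'
    using ch[OF cg[OF ch[OF cg[OF that]]]] by (simp add: algebra_simps)
  have left: "pt (X' - 2 * A) Y' \<in> ?Z" if "pt X' Y' \<in> ?Z" for X' Y'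
    using ch[OF right[OF ch[OF that]]] by (simp add: algebra_simps)
  have vert: "pt X' (Y' + 2 * B * of_int n) \<in> ?Z" if "pt X' Y' \<in> ?Z" for X' Y' n
  proof (induction n rule: int_induct[of _ 0])
    case base
    then show ?case using that by simp
  next
    case (step1 i)
    then show ?case using up[of X' "Y' + 2 * B * of_int i"] by (simp add: algebra_simps)
  next
    case (step2 i)
    then show ?case using down[of X' "Y' + 2 * B * of_int i"] by (simp add: algebra_simps)
  qed
  have horiz: "pt (X' + 2 * A * of_int n) Y' \<in> ?Z" if "pt X' Y' \<in> ?Z" for X' Y' n
  proof (induction n rule: int_induct[of _ 0])
    case base
    then show ?case using that by simp
  next
    case (step1 i)
    then show ?case using right[of "X' + 2 * A * of_int i" Y'] by (simp add: algebra_simps)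
  next
    case (step2 i)
    then show ?case using left[of "X' + 2 * A * of_int i" Y'] by (simp add: algebra_simps)
  qed
  have trans: "pt (X' + 2 * A * of_int m) (Y' + 2 * B * of_int n) \<in> ?Z" if "pt X' Y' \<in> ?Z" for X' Y' m n
    by (intro horiz vert that)
  have base: "pt X Y \<in> ?Z" unfolding pt_def by (rule orbit53_self)
  have even2: "\<exists>m. j = 2 * m" if "even j" for j :: int using that by (auto elim: evenE)
  have odd2: "\<exists>m. j = 2 * m + 1" if "odd j" for j :: int using that by (auto elim: oddE)
  show "?O \<subseteq> ?Z"
  proof
    fix z assume "z \<in> ?O"
    then obtain b c j l where z: "z = pt (sgn_of b * X + A * of_int j) (sgn_of c * Y + B * of_int l)"
      and p: "even j = (b = c)" "even l = (b = c)" unfolding pt_def by blast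
    show "z \<in> ?Z"
    proof (cases "b = c")
      case True
      then obtain m n where mn: "j = 2 * m" "l = 2 * n" using p even2 by meson
      have "pt (sgn_of b * X) (sgn_of c * Y) \<in> ?Z" using base ch[OF base] True by (cases c)
          (simp_all add: sgn_of_def)
      from trans[OF this, of m n] show ?thesis unfolding z mn by (simp add: algebra_simps)
    next
      case False
      then obtain m n where mn: "j = 2 * m + 1" "l = 2 * n + 1" using p odd2 by meson
      show ?thesis
      proof (cases b)
        case True
        then have "\<not> c" using False by simp
        have e: "- (- X - A) = X + A" "- (Y + B) = - Y - B" by simp_all
        have "pt (X + A) (- Y - B) \<in> ?Z" using ch[OF cg[OF base]] unfolding e .
        from trans[OF this, of m "n + 1"] show ?thesis using True \<open>\<not> c\<close> unfolding z mn
          by (simp add: sgn_of_def algebra_simps)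
      next
        case b: False
        then have "c" using False by simp
        from trans[OF cg[OF base], of "m + 1" n] show ?thesis using b \<open>c\<close> unfolding z mn
          by (simp add: sgn_of_def algebra_simps)
      qed
    qed
  qed
qed

section \<open>The perturbed packing as a lattice packing\<close>

text \<open>
  The two sides of the rectangular cell, of lengths \<open>2 A\<close> and \<open>2 B\<close>.
\<close>

definition cell_u :: "real \<Rightarrow> complex" where
  "cell_u s = frame (q_of s) * of_real (2 * a_of s / K_of s)"

definition cell_v :: "real \<Rightarrow> complex" where
  "cell_v s = frame (q_of s) * (\<i> * of_real (2 * w_of s * b_of s / K_of s))"

text \<open>
  The twelve disks of a cell. Those with index \<open>(i, b, c)\<close> are obtained from the representative of
  size \<open>i\<close> with the signs \<open>b\<close> and \<open>c\<close>, shifted by the half periods if the signs differ.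
\<close>

definition disk_center :: "real \<Rightarrow> disk_size \<times> bool \<times> bool \<Rightarrow> complex" where
  "disk_center s = (\<lambda>(i, b, c). frame (q_of s) *
     Complex ((sgn_of b * x_of s i + of_bool (b \<noteq> c) * a_of s) / K_of s)
       (w_of s * (sgn_of c * y_of s i + of_bool (b \<noteq> c) * b_of s) / K_of s))"

definition disk_radius :: "real \<Rightarrow> disk_size \<times> bool \<times> bool \<Rightarrow> real" where
  "disk_radius s = (\<lambda>(i, b, c). r_of s i / K_of s)"

lemma disk_center_translate:
  "disk_center s (i, b, c) + lattice_point (cell_u s) (cell_v s) (m, n) = frame (q_of s) *
     Complex ((sgn_of b * x_of s i + a_of s * of_int (2 * m + of_bool (b \<noteq> c))) / K_of s)
       (w_of s * (sgn_of c * y_of s i + b_of s * of_int (2 * n + of_bool (b \<noteq> c))) / K_of s)"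
proof -
  have "lattice_point (cell_u s) (cell_v s) (m, n) = frame (q_of s) *
      Complex (2 * a_of s / K_of s * of_int m) (2 * w_of s * b_of s / K_of s * of_int n)"
    by (simp add: lattice_point_def cell_u_def cell_v_def complex_eq_iff algebra_simps)
  moreover have "Complex ((sgn_of b * x_of s i + of_bool (b \<noteq> c) * a_of s) / K_of s)
       (w_of s * (sgn_of c * y_of s i + of_bool (b \<noteq> c) * b_of s) / K_of s)
     + Complex (2 * a_of s / K_of s * of_int m) (2 * w_of s * b_of s / K_of s * of_int n)
     = Complex ((sgn_of b * x_of s i + a_of s * of_int (2 * m + of_bool (b \<noteq> c))) / K_of s)
       (w_of s * (sgn_of c * y_of s i + b_of s * of_int (2 * n + of_bool (b \<noteq> c))) / K_of s)"
  proof (rule complex_eqI)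
    have e: "(u + \<theta> * a) / k + 2 * a / k * t = (u + a * (2 * t + \<theta>)) / k"
      "w * (u + \<theta> * a) / k + 2 * w * a / k * t = w * (u + a * (2 * t + \<theta>)) / k" for u \<theta> a k t w :: real
      by (simp_all add: add_divide_distrib[symmetric] algebra_simps)
    show "Re (Complex ((sgn_of b * x_of s i + of_bool (b \<noteq> c) * a_of s) / K_of s)
       (w_of s * (sgn_of c * y_of s i + of_bool (b \<noteq> c) * b_of s) / K_of s)
     + Complex (2 * a_of s / K_of s * of_int m) (2 * w_of s * b_of s / K_of s * of_int n))
     = Re (Complex ((sgn_of b * x_of s i + a_of s * of_int (2 * m + of_bool (b \<noteq> c))) / K_of s)
       (w_of s * (sgn_of c * y_of s i + b_of s * of_int (2 * n + of_bool (b \<noteq> c))) / K_of s))"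
      by (simp only: plus_complex.sel complex.sel e of_int_add of_int_mult of_int_numeral
          of_int_of_bool)
    show "Im (Complex ((sgn_of b * x_of s i + of_bool (b \<noteq> c) * a_of s) / K_of s)
       (w_of s * (sgn_of c * y_of s i + of_bool (b \<noteq> c) * b_of s) / K_of s)
     + Complex (2 * a_of s / K_of s * of_int m) (2 * w_of s * b_of s / K_of s * of_int n))
     = Im (Complex ((sgn_of b * x_of s i + a_of s * of_int (2 * m + of_bool (b \<noteq> c))) / K_of s)
       (w_of s * (sgn_of c * y_of s i + b_of s * of_int (2 * n + of_bool (b \<noteq> c))) / K_of s))"
      by (simp only: plus_complex.sel complex.sel e of_int_add of_int_mult of_int_numeral
          of_int_of_bool)
  qed
  ultimately show ?thesis
    unfolding disk_center_def prod.case by (simp only: distrib_left[symmetric])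
qed

lemma UNIV_disk_size: "(UNIV :: disk_size set) = {Large, Medium, Small}"
  by (auto intro: disk_size.exhaust)

lemma finite_disk_size: "finite (UNIV :: (disk_size \<times> bool \<times> bool) set)"
  by (simp add: UNIV_Times_UNIV[symmetric] UNIV_disk_size del: UNIV_Times_UNIV)

text \<open>
  Passage from pairs \<open>(j, l)\<close> with prescribed parity to a lattice index \<open>(m, n)\<close>.
\<close>

lemma parity_image:
  "{f b c j l | b c (j::int) (l::int). even j = (b = c) \<and> even l = (b = c)} =
   {f b c (2 * m + of_bool (b \<noteq> c)) (2 * n + of_bool (b \<noteq> c)) | b c m n. True}"
proof (rule subset_antisym; rule subsetI)
  fix x assume "x \<in> {f b c j l | b c (j::int) (l::int). even j = (b = c) \<and> even l = (b = c)}"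
  then obtain b c j l where x: "x = f b c j l" and p: "even j = (b = c)" "even l = (b = c)" by blast
  have "j = 2 * (j div 2) + of_bool (b \<noteq> c)" "l = 2 * (l div 2) + of_bool (b \<noteq> c)"
    using p by (cases "b = c"; simp)+
  then have "x = f b c (2 * (j div 2) + of_bool (b \<noteq> c)) (2 * (l div 2) + of_bool (b \<noteq> c))"
    unfolding x by (rule arg_cong2)
  then show "x \<in> {f b c (2 * m + of_bool (b \<noteq> c)) (2 * n + of_bool (b \<noteq> c)) | b c m n. True}"
    by blast
next
  fix x assume "x \<in> {f b c (2 * m + of_bool (b \<noteq> c)) (2 * n + of_bool (b \<noteq> c)) | b c m n. True}"
  then obtain b c m n where "x = f b c (2 * m + of_bool (b \<noteq> c)) (2 * n + of_bool (b \<noteq> c))" by blast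
  moreover have "even (2 * m + of_bool (b \<noteq> c)) = (b = c)" "even (2 * n + of_bool (b \<noteq> c)) = (b = c)"
    by auto
  ultimately show "x \<in> {f b c j l | b c (j::int) (l::int). even j = (b = c) \<and> even l = (b
      = c)}" by blast
qed

lemma orbit53_center:
  assumes s: "0 < s" "s < 1" "1 < 2 * s^2" and N: "0 < N_of s"
  shows "orbit53 (q_of s) (frame (q_of s) * center s i) =
    {disk_center s (i, b, c) + lattice_point (cell_u s) (cell_v s) (m, n) | b c m n. True}"
proof -
  have "orbit53 (q_of s) (frame (q_of s) * center s i) =
    {frame (q_of s) * Complex (sgn_of b * (x_of s i / K_of s) + a_of s / K_of s * of_int j)
      (sgn_of c * (w_of s * y_of s i / K_of s) + w_of s * b_of s / K_of s * of_int l) | b c j l.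
      even j = (b = c) \<and> even l = (b = c)}"
    unfolding center_def by (rule orbit53_eq) (rule glide53_frame[OF s N])
  also have "\<dots> = {frame (q_of s) * Complex ((sgn_of b * x_of s i + a_of s * of_int j) / K_of s)
      (w_of s * (sgn_of c * y_of s i + b_of s * of_int l) / K_of s) | b c j l.
      even j = (b = c) \<and> even l = (b = c)}"
    by (simp add: add_divide_distrib algebra_simps)
  also have "\<dots> = {disk_center s (i, b, c) + lattice_point (cell_u s) (cell_v s) (m, n) | b c m n. True}"
    unfolding disk_center_translate by (rule parity_image)
  finally show ?thesis .
qed

lemma disk_radius_values:
  assumes s: "0 < s" "s < 1" "1 < 2 * s^2"
  shows "r_of s Large / K_of s = 1" "r_of s Medium / K_of s = p_of s" "r_of s Small / K_of s = q_of s"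
proof -
  have n: "0 < n_of s" "0 < M_of s" using n_of_pos[of s] M_of_pos[of s] s by simp_all
  show "r_of s Large / K_of s = 1" "r_of s Medium / K_of s = p_of s"
    using K_of_pos[of s] s by (simp_all add: r_of.simps)
  show "r_of s Small / K_of s = q_of s"
    using n s by (simp add: r_of.simps K_of_def q_of_def field_simps power2_eq_square)
qed

lemma perturbed_packing53_eq:
  assumes s: "0 < s" "s < 1" "1 < 2 * s^2" and N: "0 < N_of s"
  shows "perturbed_packing53 (q_of s) =
    lattice_packing UNIV (disk_center s) (disk_radius s) (cell_u s) (cell_v s)"
proof -
  let ?D = "\<lambda>i. (\<lambda>z. cball z (r_of s i / K_of s)) ` orbit53 (q_of s) (frame (q_of s) * center s i)"
  have "perturbed_packing53 (q_of s) = ?D Large \<union> ?D Small \<union> ?D Medium"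
    unfolding perturbed_packing53_def Let_def med_radius_q_of[OF s]
    unfolding centers_in_frame(3)[OF s N] unfolding centers_in_frame(1,2)[OF s N]
        disk_radius_values[OF s] ..
  also have "\<dots> = (\<Union>i. ?D i)" unfolding UNIV_disk_size by auto
  also have "\<dots> = lattice_packing UNIV (disk_center s) (disk_radius s) (cell_u s) (cell_v s)"
  proof -
    have img: "(\<lambda>z. cball z \<rho>) ` {g b c m n | b c m n. True} = {cball (g b c m n) \<rho> | b c m n. True}"
      for g :: "bool \<Rightarrow> bool \<Rightarrow> int \<Rightarrow> int \<Rightarrow> complex" and \<rho> by blast
    have "?D i = {cball (disk_center s (i, b, c) + lattice_point (cell_u s) (cell_v s) (m, n))
        (disk_radius s (i, b, c)) | b c m n. True}" for i
      unfolding orbit53_center[OF s N] disk_radius_def prod.case by (rule img)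
    moreover have "lattice_packing UNIV (disk_center s) (disk_radius s) (cell_u s) (cell_v s) =
        (\<Union>i. {cball (disk_center s (i, b, c) + lattice_point (cell_u s) (cell_v s) (m, n))
        (disk_radius s (i, b, c)) | b c m n. True})"
    proof (rule Set.set_eqI)
      fix A
      have "A \<in> lattice_packing UNIV (disk_center s) (disk_radius s) (cell_u s) (cell_v s) \<longleftrightarrow>
        (\<exists>i b c m n. A = cball (disk_center s (i, b, c) + lattice_point (cell_u s) (cell_v s) (m, n))
          (disk_radius s (i, b, c)))"
        unfolding lattice_packing_def by (simp add: image_iff split_paired_Ex)
      then show "A \<in> lattice_packing UNIV (disk_center s) (disk_radius s) (cell_u s) (cell_v s) \<longleftrightarrow>
        A \<in> (\<Union>i. {cball (disk_center s (i, b, c) + lattice_point (cell_u s) (cell_v s) (m, n))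
          (disk_radius s (i, b, c)) | b c m n. True})"
        by blast
    qed
    ultimately show ?thesis by simp
  qed
  finally show ?thesis .
qed

lemma norm_frame: "cmod (frame q) = 1" by (simp add: frame_def)

text \<open>
  The difference of two centers of the packing is, up to the signs of its coordinates, a
  difference as in \<open>separation\<close>: the group element of the first disk can be moved to the second.
\<close>

lemma separated_disks_perturbed:
  assumes s: "957/1000 \<le> s" "s \<le> 959/1000" "1 < 2 * s^2"
    and y: "(M_of s)^2 \<le> (4 * s^2 - 1) * s^2 * (N_of s)^2"
  shows "separated_disks UNIV (disk_center s) (disk_radius s) (cell_u s) (cell_v s)"
  unfolding separated_disks_def
proof (intro conjI ballI allI impI)
  have s': "0 < s" "s < 1" using s by linarith+
  have K: "0 < K_of s" by (rule K_of_pos) fact+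
  have r: "0 < r_of s i" for i
    by (cases i) (use center_bounds(13,15,17)[OF s(1,2)] in simp_all)
  show "0 < disk_radius s k" for k using r K by (simp add: disk_radius_def split: prod.split)
  fix k k' :: "disk_size \<times> bool \<times> bool" and mn mn' :: "int \<times> int"
  assume ne: "(k, mn) \<noteq> (k', mn')"
  obtain i b c where k: "k = (i, b, c)" by (cases k)
  obtain i' b' c' where k': "k' = (i', b', c')" by (cases k')
  obtain m n where mn: "mn = (m, n)" by (cases mn)
  obtain m' n' where mn': "mn' = (m', n')" by (cases mn')
  define j l j' l' :: int where "j = 2 * m + of_bool (b \<noteq> c)" "l = 2 * n + of_bool (b \<noteq> c)"
    "j' = 2 * m' + of_bool (b' \<noteq> c')" "l' = 2 * n' + of_bool (b' \<noteq> c')"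
  note d = this
  \<comment> \<open>Reflecting the coordinates by the signs of the first disk makes it the representative.\<close>
  define \<epsilon> \<delta> :: int where "\<epsilon> = (if b then 1 else -1)" "\<delta> = (if c then 1 else -1)"
  note d2 = this
  define X where "X = x_of s i - sgn_of (b = b') * x_of s i' + a_of s * of_int (\<epsilon> * (j - j'))"
  define Y where "Y = y_of s i - sgn_of (c = c') * y_of s i' + b_of s * of_int (\<delta> * (l - l'))"
  note S = separation_any[OF s(1,2) y, unfolded separation_def, rule_format]
  have sep: "(r_of s i + r_of s i')^2 \<le> X^2 + (4 * s^2 - 1) * Y^2"
    unfolding X_def Y_def
  proof (rule S)
    show "even (\<epsilon> * (j - j')) = ((b = b') = (c = c'))" "even (\<delta> * (l - l')) = ((b = b') = (c = c'))"
      by (auto simp: d d2)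
    show "(i, b = b', c = c', \<epsilon> * (j - j'), \<delta> * (l - l')) \<noteq> (i', True, True, 0, 0)"
      using ne unfolding k k' mn mn' by (auto simp: d d2)
  qed
  have dX: "(sgn_of b * x_of s i + a_of s * of_int j) - (sgn_of b' * x_of s i' + a_of s * of_int j')
      = sgn_of b * X"
    by (cases b; cases b') (simp_all add: X_def sgn_of_def d2 algebra_simps)
  have dY: "(sgn_of c * y_of s i + b_of s * of_int l) - (sgn_of c' * y_of s i' + b_of s * of_int l')
      = sgn_of c * Y"
    by (cases c; cases c') (simp_all add: Y_def sgn_of_def d2 algebra_simps)
  have diff: "Complex (t / \<kappa>) (w * u / \<kappa>) - Complex (t' / \<kappa>) (w * u' / \<kappa>)
      = Complex ((t - t') / \<kappa>) (w * (u - u') / \<kappa>)" for t u t' u' w \<kappa> :: real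
    by (simp add: complex_eq_iff diff_divide_distrib right_diff_distrib)
  have "(disk_center s k + lattice_point (cell_u s) (cell_v s) mn)
      - (disk_center s k' + lattice_point (cell_u s) (cell_v s) mn')
      = frame (q_of s) * Complex (sgn_of b * X / K_of s) (sgn_of c * w_of s * Y / K_of s)"
    unfolding k k' mn mn' disk_center_translate d[symmetric] right_diff_distrib[symmetric] diff
    unfolding dX dY by (simp add: mult.assoc mult.left_commute)
  then have "(dist (disk_center s k + lattice_point (cell_u s) (cell_v s) mn)
      (disk_center s k' + lattice_point (cell_u s) (cell_v s) mn'))^2
      = (sgn_of b * X / K_of s)^2 + (sgn_of c * w_of s * Y / K_of s)^2"
    unfolding dist_norm by (simp add: norm_mult norm_frame cmod_power2)
  also have "\<dots> = (X^2 + (4 * s^2 - 1) * Y^2) / (K_of s)^2"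
    using w_of_sq(1)[OF s(3)]
    by (simp add: power_mult_distrib power_divide add_divide_distrib sgn_of_def)
  also have "\<dots> \<ge> (r_of s i + r_of s i')^2 / (K_of s)^2"
    using sep by (simp add: divide_right_mono)
  finally have "((r_of s i + r_of s i') / K_of s)^2 \<le>
      (dist (disk_center s k + lattice_point (cell_u s) (cell_v s) mn)
      (disk_center s k' + lattice_point (cell_u s) (cell_v s) mn'))^2" by (simp add: power_divide)
  then have "(r_of s i + r_of s i') / K_of s \<le> dist (disk_center s k
      + lattice_point (cell_u s) (cell_v s) mn)
      (disk_center s k' + lattice_point (cell_u s) (cell_v s) mn')"
    by (rule power2_le_imp_le) simp
  then show "disk_radius s k + disk_radius s k' \<le>
      dist (disk_center s k + lattice_point (cell_u s) (cell_v s) mn)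
      (disk_center s k' + lattice_point (cell_u s) (cell_v s) mn')"
    unfolding k k' by (simp add: disk_radius_def add_divide_distrib)
qed

lemma cell_area:
  assumes s: "0 < s" "s < 1" "1 < 2 * s^2"
  shows "Im (cnj (cell_u s) * cell_v s)
    = 4 * (p_of s)^2 * (w_of s)^3 * (1 + s * n_of s) / (M_of s)^2"
proof -
  have f: "cnj (frame q) * frame q = 1" for q by (simp add: frame_def cis_cnj cis_mult)
  have "cnj (cell_u s) * cell_v s = (cnj (frame (q_of s)) * frame (q_of s)) *
      (\<i> * of_real (2 * a_of s / K_of s * (2 * w_of s * b_of s / K_of s)))"
    unfolding cell_u_def cell_v_def by (simp add: algebra_simps)
  then have "Im (cnj (cell_u s) * cell_v s) = 4 * (a_of s / K_of s) * (w_of s * (b_of s / K_of s))"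
    unfolding f by simp
  also have "a_of s / K_of s = p_of s * (w_of s)^2 / M_of s"
    unfolding a_of_def K_of_def w_of_sq(1)[OF s(3)]
    using n_of_pos[of s] M_of_pos[of s] s by (simp add: field_simps)
  also have "b_of s / K_of s = p_of s * (1 + s * n_of s) / M_of s"
    unfolding b_of_def K_of_def
    using n_of_pos[of s] M_of_pos[of s] s by (simp add: field_simps)
  finally show ?thesis by (simp add: field_simps power2_eq_square power3_eq_cube)
qed

lemma sum_disk_radius:
  assumes s: "0 < s" "s < 1" "1 < 2 * s^2"
  shows "(\<Sum>k\<in>UNIV. (disk_radius s k)^2) = 4 * (1 + (p_of s)^2 + (q_of s)^2)"
proof -
  have "(\<Sum>k\<in>UNIV. (disk_radius s k)^2)
      = (\<Sum>i\<in>UNIV. \<Sum>bc\<in>(UNIV :: (bool \<times> bool) set). (r_of s i / K_of s)^2)"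
    unfolding UNIV_Times_UNIV[symmetric] sum.cartesian_product
    by (simp add: disk_radius_def case_prod_beta)
  also have "\<dots> = (\<Sum>i\<in>UNIV. 4 * (r_of s i / K_of s)^2)"
    by (simp add: UNIV_Times_UNIV[symmetric] card_cartesian_product del: UNIV_Times_UNIV)
  finally show ?thesis
    unfolding UNIV_disk_size using disk_radius_values[OF s] by simp
qed

lemma has_radius_ratio_perturbed:
  assumes s: "0 < s" "s < 1" "1 < 2 * s^2" and N: "0 < N_of s"
  shows "has_radius_ratio (perturbed_packing53 (q_of s)) (q_of s)"
proof -
  note b = q_of_bounds[OF s]
  have "disk_radii (perturbed_packing53 (q_of s)) = (\<lambda>i. r_of s i / K_of s) ` UNIV"
  proof (rule subset_antisym; rule subsetI)
    fix r assume "r \<in> disk_radii (perturbed_packing53 (q_of s))"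
    then obtain z i bc mn where "0 < r" "cball z r =
        cball (disk_center s (i, bc) + lattice_point (cell_u s) (cell_v s) mn) (disk_radius s (i, bc))"
      unfolding disk_radii_def perturbed_packing53_eq[OF s N] lattice_packing_def by auto
    then have "r = disk_radius s (i, bc)" by (auto simp: cball_eq_cball_iff)
    then show "r \<in> (\<lambda>i. r_of s i / K_of s) ` UNIV" by (auto simp: disk_radius_def)
  next
    fix r assume "r \<in> (\<lambda>i. r_of s i / K_of s) ` UNIV"
    then obtain i where i: "r = r_of s i / K_of s" by blast
    have "0 < r" unfolding i using disk_radius_values[OF s] b by (cases i) simp_all
    moreover have "cball (disk_center s (i, True, True) + lattice_point (cell_u s) (cell_v s) 0) r
        \<in> perturbed_packing53 (q_of s)"
      unfolding perturbed_packing53_eq[OF s N] lattice_packing_def i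
      by (rule image_eqI[of _ _ "((i, True, True), 0)"]) (simp_all add: disk_radius_def)
    ultimately show "r \<in> disk_radii (perturbed_packing53 (q_of s))"
      unfolding disk_radii_def by blast
  qed
  then have "disk_radii (perturbed_packing53 (q_of s)) = {1, p_of s, q_of s}"
    unfolding UNIV_disk_size using disk_radius_values[OF s] by simp
  then show ?thesis unfolding has_radius_ratio_def using b by simp
qed

lemma has_density_perturbed:
  assumes s: "957/1000 \<le> s" "s \<le> 959/1000" "1 < 2 * s^2" and N: "0 < N_of s"
    and y: "(M_of s)^2 \<le> (4 * s^2 - 1) * s^2 * (N_of s)^2"
  shows "disk_packing (perturbed_packing53 (q_of s))"
    and "has_density (perturbed_packing53 (q_of s)) (\<Delta> (q_of s))"
proof -
  have s': "0 < s" "s < 1" "1 < 2 * s^2" using s by auto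
  note sep = separated_disks_perturbed[OF s y]
  show "disk_packing (perturbed_packing53 (q_of s))"
    unfolding perturbed_packing53_eq[OF s' N] by (rule disk_packing_lattice_packing[OF sep])
  have pos: "0 < p_of s" "0 < w_of s" "0 < 1 + s * n_of s" "0 < M_of s"
    using q_of_bounds[OF s'] w_of_sq[OF s'(3)] n_of_pos[of s] M_of_pos[of s] s'
    by (simp_all add: add_pos_pos)
  define C where "C = 4 * (p_of s)^2 * (w_of s)^3 * (1 + s * n_of s) / (M_of s)^2"
  have C: "0 < C" using pos by (simp add: C_def)
  have area: "Im (cnj (cell_u s) * cell_v s) = C" unfolding C_def by (rule cell_area[OF s'])
  have "has_density (perturbed_packing53 (q_of s))
      (pi * (\<Sum>k\<in>UNIV. (disk_radius s k)^2) / \<bar>Im (cnj (cell_u s) * cell_v s)\<bar>)"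
    unfolding perturbed_packing53_eq[OF s' N]
    by (rule has_density_lattice_packing[OF _ finite_disk_size sep]) (use area C in simp)
  also have "pi * (\<Sum>k\<in>UNIV. (disk_radius s k)^2) / \<bar>Im (cnj (cell_u s) * cell_v s)\<bar> = \<Delta> (q_of s)"
    unfolding area sum_disk_radius[OF s'] \<Delta>_q_of[OF s'] using C pos
    unfolding C_def by (simp add: field_simps)
  finally show "has_density (perturbed_packing53 (q_of s)) (\<Delta> (q_of s))" .
qed

section \<open>Comparison with the hexagonal packing\<close>

theorem theorem4p1:
  shows "(\<exists>!x. q53 < x \<and> x < 0.67 \<and> \<Delta> x = pi / sqrt 12) \<and>
    0.6585340820 \<le> q_max \<and> q_max < 0.6585340821 \<and>
    has_density hexagonal_packing (pi / sqrt 12) \<and>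
    (\<forall>q::real. q53 < q \<and> q \<le> q_max \<longrightarrow>
       \<Delta> q \<ge> \<delta>_FT q \<and>
       disk_packing (perturbed_packing53 q) \<and>
       doubly_periodic (perturbed_packing53 q) \<and>
       has_radius_ratio (perturbed_packing53 q) q \<and>
       has_density (perturbed_packing53 q) (\<Delta> q) \<and>
       \<Delta> q \<ge> pi / sqrt 12)"
proof (intro conjI allI impI q_max_properties has_density_hexagonal_packing)
  fix q :: real
  assume q: "q53 < q \<and> q \<le> q_max"
  then obtain s where s: "239/250 \<le> s" "s \<le> 241/250" "q = q_of s" "0 < G_of s"
    "pi / sqrt 12 \<le> \<Delta> q" "957/1000 \<le> s" "s \<le> 959/1000"
    by (auto elim: range_parameter)
  note d = param_domain[OF s(1,2)]
  have N: "0 < N_of s" using s(6) by (rule N_of_pos)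
  have y: "(M_of s)^2 \<le> (4 * s^2 - 1) * s^2 * (N_of s)^2"
    using s(4) d(3) by (intro height_ge_one) auto
  note D = has_density_perturbed[OF s(6,7) d(3) N y, folded s(3)]
  show "pi / sqrt 12 \<le> \<Delta> q" by (rule s(5))
  moreover have "\<delta>_FT q = pi / sqrt 12"
    using q q53_bounds q_max_properties by (intro \<delta>_FT_hexagonal) auto
  ultimately show "\<delta>_FT q \<le> \<Delta> q" by simp
  show "disk_packing (perturbed_packing53 q)" "has_density (perturbed_packing53 q) (\<Delta> q)"
    by (rule D)+
  then show "doubly_periodic (perturbed_packing53 q)" unfolding has_density_def by blast
  show "has_radius_ratio (perturbed_packing53 q) q"
    unfolding s(3) by (rule has_radius_ratio_perturbed[OF d N])
qed

end
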